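(* Let $\mathfrak L_1,\mathfrak L_2$ be essentially free left-resolving $\lambda$-graph systems and let $f_1:G_{\mathfrak L_1}\to\mathbb Z$, $f_2:G_{\mathfrak L_2}\to\mathbb Z$ be continuous homomorphisms. The following are equivalent: (i) there exists an isomorphism of étale groupoids $\varphi:G_{\mathfrak L_1}\to G_{\mathfrak L_2}$ with $f_1=f_2\circ\varphi$; (ii) there exists a $*$-isomorphism $\Phi:\mathcal O_{\mathfrak L_1}\to\mathcal O_{\mathfrak L_2}$ with $\Phi(\mathcal D_{\mathfrak L_1})=\mathcal D_{\mathfrak L_2}$ and $\Phi\circ\rho^{\mathfrak L_1,f_1}_t=\rho^{\mathfrak L_2,f_2}_t\circ\Phi$ for all $t\in\mathbb T$.
   Context: $\mathbb Z_+=\{0,1,2,\dots\}$, $\mathbb N=\{1,2,\dots\}$, $\mathbb T=\mathbb R/\mathbb Z$. A $\lambda$-graph system $\mathfrak L=(V,E,\lambda,\iota)$ over a finite alphabet $\Sigma$ consists of finite nonempty pairwise disjoint vertex sets $V_l$ ($l\in\mathbb Z_+$); finite pairwise disjoint edge sets $E_{l,l+1}$, each $e\in E_{l,l+1}$ having a source $s(e)\in V_l$ and a terminal $t(e)\in V_{l+1}$; a labeling map $\lambda:E\to\Sigma$; and surjections $\iota:V_{l+1}\to V_l$; such that every vertex is the source of some edge, every vertex in $V_l$ ($l\ge1$) is the terminal of some edge, and (local property) for all $l\ge1$, $u\in V_{l-1}$, $v\in V_{l+1}$ there is a label-preserving bijection between $\{e\in E_{l,l+1}: \iota(s(e))=u,\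 t(e)=v\}$ and $\{e\in E_{l-1,l}: s(e)=u,\ t(e)=\iota(v)\}$. Left-resolving: $t(e)=t(f)$, $\lambda(e)=\lambda(f)$ imply $e=f$. $\Omega_{\mathfrak L}=\{(u^l)_{l}\in\prod_l V_l: \iota(u^{l+1})=u^l\}$ (projective limit topology). $E_{\mathfrak L}$ = set of $(u,\alpha,w)\in\Omega_{\mathfrak L}\times\Sigma\times\Omega_{\mathfrak L}$ such that for each $l$ some $e\in E_{l,l+1}$ has $s(e)=u^l$, $t(e)=w^{l+1}$, $\lambda(e)=\alpha$. $X_{\mathfrak L}$ = set of $(\alpha_i,u_i)_{i\in\mathbb N}$ in $\Sigma\times\Omega_{\mathfrak L}$ with $(u_i,\alpha_{i+1},u_{i+1})\in E_{\mathfrak L}$ for all $i$ and $(u_0,\alpha_1,u_1)\in E_{\mathfrak L}$ for some $u_0$; relative product topology; $\sigma_{\mathfrak L}$ the left shift (a local homeomorphism). $\mathfrak L$ is essentially free if for $m\neq n$ the set $\{x:\sigma^m_{\mathfrak L}x=\sigma^n_{\mathfrak L}x\}$ has empty interior. $G_{\mathfrak L}=\{(x,n,z)\in X_{\mathfrak L}\times\mathbb Z\times X_{\mathfrak L}:\exists k,l\ge0,\ \sigma^k_{\mathfrak L}x=\sigma^l_{\mathfrak L}z,\ n=k-l\}$, with $(x,n,z)(z,m,w)=(x,n+m,w)$, $(x,n,z)^{-1}=(z,-n,x)$, topology generated by $Z(U,k,l,V)=\{(x,k-l,z):x\in U,z\in V,\sigma^kx=\sigma^lz\}$ ($U,V$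 open, $\sigma^k|_U,\sigma^l|_V$ homeomorphisms onto a common open set); étale, unit space identified with $X_{\mathfrak L}$ via $x\mapsto(x,0,x)$. A continuous homomorphism $f:G_{\mathfrak L}\to\mathbb Z$ is continuous with $f(\gamma_1\gamma_2)=f(\gamma_1)+f(\gamma_2)$. $\mathcal O_{\mathfrak L}$ = reduced groupoid $C^*$-algebra $C^*(G_{\mathfrak L})$ (closure of $C_c(G_{\mathfrak L})$ acting by convolution on the Hilbert $C_0(X_{\mathfrak L})$-module $l^2(G_{\mathfrak L})$). $\mathcal D_{\mathfrak L}\subset\mathcal O_{\mathfrak L}$ is the subalgebra $C(X_{\mathfrak L})$ of functions supported on the (clopen) unit space. For $t\in\mathbb T$: $(U_t(f)\xi)(\gamma)=\exp(2\pi\sqrt{-1}tf(\gamma))\xi(\gamma)$ on $l^2(G_{\mathfrak L})$ and $\rho^{\mathfrak L,f}_t=\operatorname{Ad}U_t(f)|_{\mathcal O_{\mathfrak L}}$ (generalized gauge action). *)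

theory Defs
  imports "HOL-Analysis.Analysis"
begin

text \<open>A lambda-graph system over alphabet lSig. lV l = V_l, lE l = E_{l,l+1}.\<close>
record ('v, 'e, 'a) lgs =
  lSig :: "'a set"
  lV   :: "nat \<Rightarrow> 'v set"
  lE   :: "nat \<Rightarrow> 'e set"
  lsrc :: "'e \<Rightarrow> 'v"
  ltrg :: "'e \<Rightarrow> 'v"
  llab :: "'e \<Rightarrow> 'a"
  liota :: "'v \<Rightarrow> 'v"

definition is_lgs :: "('v, 'e, 'a) lgs \<Rightarrow> bool" where
  "is_lgs L \<longleftrightarrow>
     finite (lSig L) \<and>
     (\<forall>l. finite (lV L l) \<and> lV L l \<noteq> {}) \<and>
     (\<forall>l m. l \<noteq> m \<longrightarrow> lV L l \<inter> lV L m = {}) \<and>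
     (\<forall>l. finite (lE L l)) \<and>
     (\<forall>l m. l \<noteq> m \<longrightarrow> lE L l \<inter> lE L m = {}) \<and>
     (\<forall>l. \<forall>e\<in>lE L l. lsrc L e \<in> lV L l \<and> ltrg L e \<in> lV L (Suc l) \<and> llab L e \<in> lSig L) \<and>
     (\<forall>l. liota L ` lV L (Suc l) = lV L l) \<and>
     (\<forall>l. \<forall>v\<in>lV L l. \<exists>e\<in>lE L l. lsrc L e = v) \<and>
     (\<forall>l. \<forall>v\<in>lV L (Suc l). \<exists>e\<in>lE L l. ltrg L e = v) \<and>
     (\<forall>l\<ge>1. \<forall>u\<in>lV L (l - 1). \<forall>v\<in>lV L (Suc l).
        \<exists>b. bij_betw b {e\<in>lE L l. liota L (lsrc L e) = u \<and> ltrg L e = v}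
                        {e\<in>lE L (l - 1). lsrc L e = u \<and> ltrg L e = liota L v}
            \<and> (\<forall>e\<in>{e\<in>lE L l. liota L (lsrc L e) = u \<and> ltrg L e = v}. llab L (b e) = llab L e))"

definition left_resolving :: "('v, 'e, 'a) lgs \<Rightarrow> bool" where
  "left_resolving L \<longleftrightarrow>
     (\<forall>e\<in>(\<Union>l. lE L l). \<forall>f\<in>(\<Union>l. lE L l).
        ltrg L e = ltrg L f \<and> llab L e = llab L f \<longrightarrow> e = f)"

definition Omega :: "('v, 'e, 'a) lgs \<Rightarrow> (nat \<Rightarrow> 'v) set" where
  "Omega L = {u. \<forall>l. u l \<in> lV L l \<and> liota L (u (Suc l)) = u l}"

definition Omega_top :: "('v, 'e, 'a) lgs \<Rightarrow> (nat \<Rightarrow> 'v) topology" where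
  "Omega_top L = subtopology (product_topology (\<lambda>l. discrete_topology (lV L l)) UNIV) (Omega L)"

definition EL :: "('v, 'e, 'a) lgs \<Rightarrow> ((nat \<Rightarrow> 'v) \<times> 'a \<times> (nat \<Rightarrow> 'v)) set" where
  "EL L = {(u, \<alpha>, w). u \<in> Omega L \<and> w \<in> Omega L \<and>
      (\<forall>l. \<exists>e\<in>lE L l. lsrc L e = u l \<and> ltrg L e = w (Suc l) \<and> llab L e = \<alpha>)}"

text \<open>Points of X_L: x i = (alpha_{i+1}, u_{i+1}) (index shifted to start at 0).\<close>
definition XL :: "('v, 'e, 'a) lgs \<Rightarrow> (nat \<Rightarrow> 'a \<times> (nat \<Rightarrow> 'v)) set" where
  "XL L = {x. (\<forall>i. (snd (x i), fst (x (Suc i)), snd (x (Suc i))) \<in> EL L) \<and>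
              (\<exists>u0. (u0, fst (x 0), snd (x 0)) \<in> EL L)}"

definition X_top :: "('v, 'e, 'a) lgs \<Rightarrow> (nat \<Rightarrow> 'a \<times> (nat \<Rightarrow> 'v)) topology" where
  "X_top L = subtopology
      (product_topology (\<lambda>i. prod_topology (discrete_topology (lSig L)) (Omega_top L)) UNIV) (XL L)"

definition shift :: "(nat \<Rightarrow> 'b) \<Rightarrow> (nat \<Rightarrow> 'b)" where
  "shift x = (\<lambda>i. x (Suc i))"

definition shifts :: "nat \<Rightarrow> (nat \<Rightarrow> 'b) \<Rightarrow> (nat \<Rightarrow> 'b)" where
  "shifts k = shift ^^ k"

definition essentially_free :: "('v, 'e, 'a) lgs \<Rightarrow> bool" where
  "essentially_free L \<longleftrightarrow>
     (\<forall>m n. m \<noteq> n \<longrightarrow> X_top L interior_of {x\<in>XL L. shifts m x = shifts n x} = {})"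

type_synonym ('v, 'a) gel = "(nat \<Rightarrow> 'a \<times> (nat \<Rightarrow> 'v)) \<times> int \<times> (nat \<Rightarrow> 'a \<times> (nat \<Rightarrow> 'v))"

definition GL :: "('v, 'e, 'a) lgs \<Rightarrow> ('v, 'a) gel set" where
  "GL L = {(x, n, z). x \<in> XL L \<and> z \<in> XL L \<and>
             (\<exists>k l. shifts k x = shifts l z \<and> n = int k - int l)}"

definition Zset :: "(nat \<Rightarrow> 'a \<times> (nat \<Rightarrow> 'v)) set \<Rightarrow> nat \<Rightarrow> nat
     \<Rightarrow> (nat \<Rightarrow> 'a \<times> (nat \<Rightarrow> 'v)) set \<Rightarrow> ('v, 'a) gel set" where
  "Zset U k l V = {(x, int k - int l, z) | x z. x \<in> U \<and> z \<in> V \<and> shifts k x = shifts l z}"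

definition Zadm :: "('v, 'e, 'a) lgs \<Rightarrow> (nat \<Rightarrow> 'a \<times> (nat \<Rightarrow> 'v)) set \<Rightarrow> nat \<Rightarrow> nat
     \<Rightarrow> (nat \<Rightarrow> 'a \<times> (nat \<Rightarrow> 'v)) set \<Rightarrow> bool" where
  "Zadm L U k l V \<longleftrightarrow> openin (X_top L) U \<and> openin (X_top L) V \<and>
     (\<exists>W. openin (X_top L) W \<and>
        homeomorphic_map (subtopology (X_top L) U) (subtopology (X_top L) W) (shifts k) \<and>
        homeomorphic_map (subtopology (X_top L) V) (subtopology (X_top L) W) (shifts l))"

definition G_top :: "('v, 'e, 'a) lgs \<Rightarrow> ('v, 'a) gel topology" where
  "G_top L = topology_generated_by {Zset U k l V | U k l V. Zadm L U k l V}"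

definition gcomp :: "('v, 'a) gel \<Rightarrow> ('v, 'a) gel \<Rightarrow> bool" where
  "gcomp g h \<longleftrightarrow> snd (snd g) = fst h"

definition gmult :: "('v, 'a) gel \<Rightarrow> ('v, 'a) gel \<Rightarrow> ('v, 'a) gel" where
  "gmult g h = (fst g, fst (snd g) + fst (snd h), snd (snd h))"

definition groupoid_iso :: "('v1, 'e1, 'a1) lgs \<Rightarrow> ('v2, 'e2, 'a2) lgs
     \<Rightarrow> (('v1, 'a1) gel \<Rightarrow> ('v2, 'a2) gel) \<Rightarrow> bool" where
  "groupoid_iso L1 L2 \<phi> \<longleftrightarrow>
     bij_betw \<phi> (GL L1) (GL L2) \<and>
     homeomorphic_map (G_top L1) (G_top L2) \<phi> \<and>
     (\<forall>g\<in>GL L1. \<forall>h\<in>GL L1. (gcomp g h \<longleftrightarrow> gcomp (\<phi> g) (\<phi> h)) \<and>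
        (gcomp g h \<longrightarrow> \<phi> (gmult g h) = gmult (\<phi> g) (\<phi> h)))"

definition cont_hom :: "('v, 'e, 'a) lgs \<Rightarrow> (('v, 'a) gel \<Rightarrow> int) \<Rightarrow> bool" where
  "cont_hom L f \<longleftrightarrow> continuous_map (G_top L) (discrete_topology UNIV) f \<and>
     (\<forall>g\<in>GL L. \<forall>h\<in>GL L. gcomp g h \<longrightarrow> f (gmult g h) = f g + f h)"

definition ell2 :: "('v, 'e, 'a) lgs \<Rightarrow> (('v, 'a) gel \<Rightarrow> complex) set" where
  "ell2 L = {\<xi>. (\<forall>g. g \<notin> GL L \<longrightarrow> \<xi> g = 0) \<and> (\<lambda>g. (cmod (\<xi> g))\<^sup>2) summable_on UNIV}"

definition l2inner :: "('g \<Rightarrow> complex) \<Rightarrow> ('g \<Rightarrow> complex) \<Rightarrow> complex" where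
  "l2inner \<xi> \<eta> = infsum (\<lambda>g. \<xi> g * cnj (\<eta> g)) UNIV"

definition l2norm :: "('g \<Rightarrow> complex) \<Rightarrow> real" where
  "l2norm \<xi> = sqrt (infsum (\<lambda>g. (cmod (\<xi> g))\<^sup>2) UNIV)"

type_synonym ('v, 'a) gop = "(('v, 'a) gel \<Rightarrow> complex) \<Rightarrow> (('v, 'a) gel \<Rightarrow> complex)"

definition bounded_op :: "('v, 'e, 'a) lgs \<Rightarrow> ('v, 'a) gop \<Rightarrow> bool" where
  "bounded_op L T \<longleftrightarrow>
     (\<forall>\<xi>. \<xi> \<notin> ell2 L \<longrightarrow> T \<xi> = (\<lambda>_. 0)) \<and>
     (\<forall>\<xi>\<in>ell2 L. T \<xi> \<in> ell2 L) \<and>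
     (\<forall>\<xi>\<in>ell2 L. \<forall>\<eta>\<in>ell2 L. \<forall>c. T (\<lambda>g. \<xi> g + c * \<eta> g) = (\<lambda>g. T \<xi> g + c * T \<eta> g)) \<and>
     bdd_above {l2norm (T \<xi>) | \<xi>. \<xi> \<in> ell2 L \<and> l2norm \<xi> \<le> 1}"

definition opnorm :: "('v, 'e, 'a) lgs \<Rightarrow> ('v, 'a) gop \<Rightarrow> real" where
  "opnorm L T = Sup {l2norm (T \<xi>) | \<xi>. \<xi> \<in> ell2 L \<and> l2norm \<xi> \<le> 1}"

definition op_add :: "('v, 'a) gop \<Rightarrow> ('v, 'a) gop \<Rightarrow> ('v, 'a) gop" where
  "op_add S T = (\<lambda>\<xi> g. S \<xi> g + T \<xi> g)"

definition op_diff :: "('v, 'a) gop \<Rightarrow> ('v, 'a) gop \<Rightarrow> ('v, 'a) gop" where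
  "op_diff S T = (\<lambda>\<xi> g. S \<xi> g - T \<xi> g)"

definition op_scale :: "complex \<Rightarrow> ('v, 'a) gop \<Rightarrow> ('v, 'a) gop" where
  "op_scale c T = (\<lambda>\<xi> g. c * T \<xi> g)"

definition op_adj :: "('v, 'e, 'a) lgs \<Rightarrow> ('v, 'a) gop \<Rightarrow> ('v, 'a) gop" where
  "op_adj L T = (\<lambda>\<eta>. if \<eta> \<in> ell2 L
       then (THE \<zeta>. \<zeta> \<in> ell2 L \<and> (\<forall>\<xi>\<in>ell2 L. l2inner (T \<xi>) \<eta> = l2inner \<xi> \<zeta>))
       else (\<lambda>_. 0))"

definition Cc :: "('v, 'e, 'a) lgs \<Rightarrow> (('v, 'a) gel \<Rightarrow> complex) set" where
  "Cc L = {a. continuous_map (G_top L) euclidean a \<and> (\<forall>g. g \<notin> GL L \<longrightarrow> a g = 0) \<and>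
              compactin (G_top L) (G_top L closure_of {g. a g \<noteq> 0})}"

text \<open>Convolution action of a function a on l^2(G_L):
  (a * xi)(x,n,w) = sum over beta = (z,m,w) in G_L of a(x,n-m,z) xi(z,m,w).\<close>
definition lam :: "('v, 'e, 'a) lgs \<Rightarrow> (('v, 'a) gel \<Rightarrow> complex) \<Rightarrow> ('v, 'a) gop" where
  "lam L a = (\<lambda>\<xi>. if \<xi> \<in> ell2 L then
      (\<lambda>g. if g \<in> GL L then
             infsum (\<lambda>b. a (fst g, fst (snd g) - fst (snd b), fst b) * \<xi> b)
                    {b \<in> GL L. snd (snd b) = snd (snd g)}
           else 0)
      else (\<lambda>_. 0))"

definition OL :: "('v, 'e, 'a) lgs \<Rightarrow> ('v, 'a) gop set" where
  "OL L = {T. bounded_op L T \<and>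
       (\<forall>\<epsilon>>0. \<exists>a\<in>Cc L. opnorm L (op_diff T (lam L a)) < \<epsilon>)}"

text \<open>D_L: C(X_L) realised as functions supported on the unit space.\<close>
definition DL :: "('v, 'e, 'a) lgs \<Rightarrow> ('v, 'a) gop set" where
  "DL L = {lam L (\<lambda>g. if fst (snd g) = 0 \<and> fst g = snd (snd g) then h (fst g) else 0) | h.
             continuous_map (X_top L) euclidean h}"

text \<open>Generalized gen_gauge action rho_t = Ad U_t(f), with U_t(f)^* = U_{-t}(f).\<close>
definition gen_gauge :: "('v, 'e, 'a) lgs \<Rightarrow> (('v, 'a) gel \<Rightarrow> int) \<Rightarrow> real \<Rightarrow> ('v, 'a) gop \<Rightarrow> ('v, 'a) gop" where
  "gen_gauge L f t T = (\<lambda>\<xi>. if \<xi> \<in> ell2 L then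
      (\<lambda>g. cis (2 * pi * t * of_int (f g)) *
             T (\<lambda>g'. cis (- (2 * pi * t * of_int (f g'))) * \<xi> g') g)
      else (\<lambda>_. 0))"

definition star_iso :: "('v1, 'e1, 'a1) lgs \<Rightarrow> ('v2, 'e2, 'a2) lgs
     \<Rightarrow> (('v1, 'a1) gop \<Rightarrow> ('v2, 'a2) gop) \<Rightarrow> bool" where
  "star_iso L1 L2 \<Phi> \<longleftrightarrow>
     bij_betw \<Phi> (OL L1) (OL L2) \<and>
     (\<forall>S\<in>OL L1. \<forall>T\<in>OL L1.
        \<Phi> (op_add S T) = op_add (\<Phi> S) (\<Phi> T) \<and>
        \<Phi> (S \<circ> T) = \<Phi> S \<circ> \<Phi> T) \<and>
     (\<forall>T\<in>OL L1. \<forall>c. \<Phi> (op_scale c T) = op_scale c (\<Phi> T)) \<and>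
     (\<forall>T\<in>OL L1. \<Phi> (op_adj L1 T) = op_adj L2 (\<Phi> T))"

end

theory Submission
  imports Defs
begin

text \<open>
  A groupoid isomorphism \<open>\<phi>\<close> conjugates convolution operators to convolution operators, which gives one
  implication. For the converse no C*-theory beyond matrix coefficients is needed. An element \<open>w\<close> of the
  algebra is determined by the function \<open>j w (g) = \<langle>w \<delta>, \<delta>\<rangle>\<close> on the groupoid, which is
  continuous. The isomorphism restricts to the projections of the diagonal, that is to clopen sets, hence
  yields a homeomorphism \<open>h\<close> of the unit spaces. If \<open>w\<close> is the image of the indicator of a compact open
  bisection \<open>B\<close>, then \<open>w P w\<^sup>*\<close> is a known diagonal projection for every diagonal projection \<open>P\<close>;
  positivity of the sum that computes it forces the open support of \<open>j w\<close> to consist of elements \<open>d\<close> whose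
  source is related to their range by the \<open>h\<close>-conjugate of the partial homeomorphism of \<open>B\<close>. By essential
  freeness an element of the groupoid is determined by its germ, so conjugation of germs by \<open>h\<close> is
  a bijection, and it is automatically multiplicative and bicontinuous. The gauge actions multiply \<open>j w\<close> by
  \<open>exp (2 \<pi> i t f)\<close>, so comparing them on \<open>w\<close> matches the cocycles.
\<close>

section \<open>Square-summable functions and bounded operators\<close>

text \<open>The obstacle is that the image w of a bisection operator is known only through algebraic
  identities; nothing says that w is again carried by a bisection. The relation
  \<open>germ_conj\<close> is shaped by this: it asks for open sets around two elements on which
  ranges matched by h force sources matched by h, and the open support of \<open>jfun w\<close> has
  this property. An element of the groupoid is its range, its source and an integer. The
  homeomorphism fixes the first two, and essential freeness fixes the integer, since two values
  would make two different powers of the shift agree on a nonempty open set. Conjugation of germs is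
  thus a relation first; uniqueness turns it into a map, and its inverse comes from running the same
  argument for the inverse isomorphism. Projections suffice to find h because points of
  \<open>X_top\<close> are separated by clopen sets. Cocycles are locally constant, so a bisection
  can be shrunk until f1 is constant on it; its operator is then a common eigenvector of the gauge
  automorphisms, a property that \<Phi> transports.\<close>

definition sq_summable :: "('g \<Rightarrow> complex) \<Rightarrow> bool" where
  "sq_summable \<xi> \<longleftrightarrow> (\<lambda>g. (cmod (\<xi> g))\<^sup>2) summable_on UNIV"

definition delta :: "'g \<Rightarrow> 'g \<Rightarrow> complex" where
  "delta b = (\<lambda>g. if g = b then 1 else 0)"

definition trunc :: "'g set \<Rightarrow> ('g \<Rightarrow> complex) \<Rightarrow> 'g \<Rightarrow> complex" where
  "trunc F \<xi> = (\<lambda>g. if g \<in> F then \<xi> g else 0)"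

lemma ell2_iff: "\<xi> \<in> ell2 L \<longleftrightarrow> (\<forall>g. g \<notin> GL L \<longrightarrow> \<xi> g = 0) \<and> sq_summable \<xi>"
  by (simp add: ell2_def sq_summable_def)

lemma ell2_outside: "\<xi> \<in> ell2 L \<Longrightarrow> g \<notin> GL L \<Longrightarrow> \<xi> g = 0"
  unfolding ell2_iff by blast

lemma l2norm_nonneg [simp]: "0 \<le> l2norm \<xi>"
  by (simp add: l2norm_def infsum_nonneg)

lemma L2_set_le_l2norm:
  assumes "sq_summable \<xi>" "finite F"
  shows "L2_set (\<lambda>g. cmod (\<xi> g)) F \<le> l2norm \<xi>"
  unfolding L2_set_def l2norm_def real_sqrt_le_iff
  by (rule finite_sum_le_infsum) (use assms in \<open>auto simp: sq_summable_def\<close>)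

text \<open>Norm estimates on infinite sums are reduced to finite sets, where \<open>L2_set\<close>
  supplies Minkowski and Cauchy-Schwarz; this lemma returns from the finite bounds to summability
  and norm at once.\<close>

lemma sq_summable_bounded:
  assumes "C \<ge> 0" "\<And>F. finite F \<Longrightarrow> L2_set (\<lambda>g. cmod (\<xi> g)) F \<le> C"
  shows "sq_summable \<xi>" "l2norm \<xi> \<le> C"
proof -
  have le: "(\<Sum>g\<in>F. (cmod (\<xi> g))\<^sup>2) \<le> C\<^sup>2" if "finite F" for F
    using assms(2)[OF that] unfolding L2_set_def by (rule sqrt_le_D)
  show s: "sq_summable \<xi>"
    unfolding sq_summable_def
    by (rule nonneg_bdd_above_summable_on) (auto intro!: bdd_aboveI[of _ "C\<^sup>2"] le)
  have "infsum (\<lambda>g. (cmod (\<xi> g))\<^sup>2) UNIV \<le> C\<^sup>2"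
    by (rule infsum_le_finite_sums) (use s le in \<open>auto simp: sq_summable_def\<close>)
  then show "l2norm \<xi> \<le> C"
    unfolding l2norm_def using assms(1) by (rule real_le_lsqrt[rotated])
qed

lemma sq_summable_add:
  assumes "sq_summable \<xi>" "sq_summable \<eta>"
  shows "sq_summable (\<lambda>g. \<xi> g + \<eta> g)" "l2norm (\<lambda>g. \<xi> g + \<eta> g) \<le> l2norm \<xi> + l2norm \<eta>"
proof -
  have "L2_set (\<lambda>g. cmod (\<xi> g + \<eta> g)) F \<le> l2norm \<xi> + l2norm \<eta>" if F: "finite F" for F
  proof -
    have "L2_set (\<lambda>g. cmod (\<xi> g + \<eta> g)) F \<le> L2_set (\<lambda>g. cmod (\<xi> g) + cmod (\<eta> g)) F"
      by (rule L2_set_mono) (auto intro: norm_triangle_ineq)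
    also have "\<dots> \<le> L2_set (\<lambda>g. cmod (\<xi> g)) F + L2_set (\<lambda>g. cmod (\<eta> g)) F"
      by (rule L2_set_triangle_ineq)
    finally show ?thesis
      using L2_set_le_l2norm[OF assms(1) F] L2_set_le_l2norm[OF assms(2) F] by linarith
  qed
  from sq_summable_bounded[OF _ this]
  show "sq_summable (\<lambda>g. \<xi> g + \<eta> g)" "l2norm (\<lambda>g. \<xi> g + \<eta> g) \<le> l2norm \<xi> + l2norm \<eta>"
    by simp_all
qed

lemma sq_summable_mult_bounded:
  assumes "sq_summable \<xi>" "c \<ge> 0" "\<And>g. cmod (\<eta> g) \<le> c * cmod (\<xi> g)"
  shows "sq_summable \<eta>" "l2norm \<eta> \<le> c * l2norm \<xi>"
proof -
  have "L2_set (\<lambda>g. cmod (\<eta> g)) F \<le> c * l2norm \<xi>" if F: "finite F" for F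
  proof -
    have "L2_set (\<lambda>g. cmod (\<eta> g)) F \<le> L2_set (\<lambda>g. c * cmod (\<xi> g)) F"
      by (rule L2_set_mono) (use assms in auto)
    also have "\<dots> = c * L2_set (\<lambda>g. cmod (\<xi> g)) F"
      using assms(2) by (simp add: L2_set_right_distrib)
    finally show ?thesis
      using L2_set_le_l2norm[OF assms(1) F] assms(2) by (meson mult_left_mono order_trans)
  qed
  from sq_summable_bounded[OF _ this] assms(2)
  show "sq_summable \<eta>" "l2norm \<eta> \<le> c * l2norm \<xi>"
    by simp_all
qed

lemma l2norm_scale: "l2norm (\<lambda>g. c * \<xi> g) = cmod c * l2norm \<xi>"
  unfolding l2norm_def
  by (simp add: norm_mult power_mult_distrib infsum_cmult_right' real_sqrt_mult)

lemma sq_summable_scale: "sq_summable \<xi> \<Longrightarrow> sq_summable (\<lambda>g. c * \<xi> g)"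
  by (rule sq_summable_mult_bounded(1)[where c = "cmod c"]) (auto simp: norm_mult)

lemma cmod_le_l2norm: "sq_summable \<xi> \<Longrightarrow> cmod (\<xi> g) \<le> l2norm \<xi>"
  using L2_set_le_l2norm[of \<xi> "{g}"] by simp

lemma l2norm_eq_0D: "sq_summable \<xi> \<Longrightarrow> l2norm \<xi> = 0 \<Longrightarrow> \<xi> = (\<lambda>_. 0)"
  using cmod_le_l2norm[of \<xi>] by fastforce

text \<open>The common estimate behind convolution by a function on a bisection and behind transport
  along a groupoid isomorphism: both move basis vectors injectively and multiply them by bounded
  weights.\<close>

lemma sq_summable_reindex:
  assumes "sq_summable \<xi>" "inj_on \<theta> {g. \<eta> g \<noteq> 0}" "c \<ge> 0" "\<And>g. \<eta> g \<noteq> 0 \<Longrightarrow> cmod (\<eta> g) \<le> c * cmod (\<xi> (\<theta> g))"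
  shows "sq_summable \<eta>" "l2norm \<eta> \<le> c * l2norm \<xi>"
proof -
  have "L2_set (\<lambda>g. cmod (\<eta> g)) F \<le> c * l2norm \<xi>" if F: "finite F" for F
  proof -
    define F' where "F' = F \<inter> {g. \<eta> g \<noteq> 0}"
    have F': "finite F'" "inj_on \<theta> F'"
      using F assms(2) by (auto simp: F'_def intro: inj_on_subset)
    have "L2_set (\<lambda>g. cmod (\<eta> g)) F = L2_set (\<lambda>g. cmod (\<eta> g)) F'"
      unfolding L2_set_def F'_def using F
      by (intro arg_cong[where f = sqrt] sum.mono_neutral_right) auto
    also have "\<dots> \<le> L2_set (\<lambda>g. c * cmod (\<xi> (\<theta> g))) F'"
      by (rule L2_set_mono) (use assms(4) in \<open>auto simp: F'_def\<close>)
    also have "\<dots> = c * L2_set (\<lambda>g. cmod (\<xi> (\<theta> g))) F'"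
      using assms(3) by (simp add: L2_set_right_distrib)
    also have "L2_set (\<lambda>g. cmod (\<xi> (\<theta> g))) F' = L2_set (\<lambda>g. cmod (\<xi> g)) (\<theta> ` F')"
      unfolding L2_set_def by (simp add: sum.reindex[OF F'(2)])
    finally show ?thesis
      using L2_set_le_l2norm[OF assms(1), of "\<theta> ` F'"] assms(3) F'(1)
      by (meson mult_left_mono order_trans finite_imageI)
  qed
  from sq_summable_bounded[OF _ this] assms(3)
  show "sq_summable \<eta>" "l2norm \<eta> \<le> c * l2norm \<xi>"
    by simp_all
qed

text \<open>Cauchy-Schwarz on finite sets bounds the sums of absolute values, so the inner product
  converges absolutely and obeys the same bound.\<close>

lemma l2inner_bound:
  assumes "sq_summable \<xi>" "sq_summable \<eta>"
  shows "(\<lambda>g. \<xi> g * cnj (\<eta> g)) summable_on UNIV" "cmod (l2inner \<xi> \<eta>) \<le> l2norm \<xi> * l2norm \<eta>"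
proof -
  have le: "(\<Sum>g\<in>F. norm (\<xi> g * cnj (\<eta> g))) \<le> l2norm \<xi> * l2norm \<eta>" if F: "finite F" for F
  proof -
    have "(\<Sum>g\<in>F. norm (\<xi> g * cnj (\<eta> g))) = (\<Sum>g\<in>F. \<bar>cmod (\<xi> g)\<bar> * \<bar>cmod (\<eta> g)\<bar>)"
      by (simp add: norm_mult)
    also have "\<dots> \<le> L2_set (\<lambda>g. cmod (\<xi> g)) F * L2_set (\<lambda>g. cmod (\<eta> g)) F"
      by (rule L2_set_mult_ineq)
    also have "\<dots> \<le> l2norm \<xi> * l2norm \<eta>"
      by (intro mult_mono L2_set_le_l2norm assms F) auto
    finally show ?thesis .
  qed
  then have abs: "(\<lambda>g. norm (\<xi> g * cnj (\<eta> g))) summable_on UNIV"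
    by (intro nonneg_bdd_above_summable_on bdd_aboveI[of _ "l2norm \<xi> * l2norm \<eta>"]) auto
  then show "(\<lambda>g. \<xi> g * cnj (\<eta> g)) summable_on UNIV"
    by (rule abs_summable_summable)
  have "cmod (l2inner \<xi> \<eta>) \<le> infsum (\<lambda>g. norm (\<xi> g * cnj (\<eta> g))) UNIV"
    unfolding l2inner_def by (rule norm_infsum_bound[OF abs])
  also have "\<dots> \<le> l2norm \<xi> * l2norm \<eta>"
    by (rule infsum_le_finite_sums[OF abs]) (use le in auto)
  finally show "cmod (l2inner \<xi> \<eta>) \<le> l2norm \<xi> * l2norm \<eta>" .
qed

lemma has_sum_single: "(\<And>h. h \<noteq> g \<Longrightarrow> f h = 0) \<Longrightarrow> (f has_sum f g) (UNIV :: 'g set)"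
  by (rule has_sum_finite_neutralI[of "{g}"]) auto

lemma infsum_delta: "infsum (\<lambda>h. (if h = g then 1 else 0) * f h) UNIV = (f g :: complex)"
  using has_sum_single[of g "\<lambda>h. (if h = g then 1 else 0) * f h"] by (simp add: infsumI)

lemma l2inner_delta_right: "l2inner \<xi> (delta g) = \<xi> g"
  using infsum_delta[of g \<xi>] by (simp add: l2inner_def delta_def mult.commute if_distrib[of cnj] cong: if_cong)

lemma l2inner_delta_left: "l2inner (delta g) \<xi> = cnj (\<xi> g)"
  using infsum_delta[of g "\<lambda>h. cnj (\<xi> h)"] by (simp add: l2inner_def delta_def)

lemma sq_summable_delta: "sq_summable (delta b)" and l2norm_delta: "l2norm (delta b) = 1"
proof -
  have "((\<lambda>g. (cmod (delta b g))\<^sup>2) has_sum (cmod (delta b b))\<^sup>2) UNIV"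
    by (rule has_sum_single) (simp add: delta_def)
  then show "sq_summable (delta b)" "l2norm (delta b) = 1"
    by (auto simp: sq_summable_def l2norm_def infsumI delta_def intro: has_sum_imp_summable)
qed

lemma ell2_delta [simp]: "b \<in> GL L \<Longrightarrow> delta b \<in> ell2 L"
  by (auto simp: ell2_iff sq_summable_delta) (auto simp: delta_def)

lemma ell2_lincomb: "\<xi> \<in> ell2 L \<Longrightarrow> \<eta> \<in> ell2 L \<Longrightarrow> (\<lambda>g. \<xi> g + c * \<eta> g) \<in> ell2 L"
  by (auto simp: ell2_iff intro: sq_summable_add sq_summable_scale)

lemma ell2_zero [simp]: "(\<lambda>_. 0) \<in> ell2 L"
  by (simp add: ell2_iff sq_summable_def)

lemma l2norm_zero [simp]: "l2norm (\<lambda>_. 0) = 0"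
  by (simp add: l2norm_def)

lemma ell2_scale: "\<xi> \<in> ell2 L \<Longrightarrow> (\<lambda>g. c * \<xi> g) \<in> ell2 L"
  using ell2_lincomb[of "\<lambda>_. 0" L \<xi> c] by simp

lemma ell2_trunc: "\<xi> \<in> ell2 L \<Longrightarrow> trunc F \<xi> \<in> ell2 L"
  by (auto simp: ell2_iff trunc_def intro: sq_summable_mult_bounded(1)[of \<xi> 1])

text \<open>The square of the tail norm is the full sum minus a finite partial sum, which tends to
  0. Truncations are the finitely supported vectors on which an operator can be computed from its
  values on \<open>delta\<close>.\<close>

lemma trunc_tendsto:
  assumes "sq_summable \<xi>"
  shows "((\<lambda>F. l2norm (\<lambda>g. \<xi> g - trunc F \<xi> g)) \<longlongrightarrow> 0) (finite_subsets_at_top UNIV)"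
proof -
  let ?f = "\<lambda>g. (cmod (\<xi> g))\<^sup>2"
  have s: "?f summable_on UNIV"
    using assms by (simp add: sq_summable_def)
  have eq: "l2norm (\<lambda>g. \<xi> g - trunc F \<xi> g) = sqrt (infsum ?f UNIV - sum ?f F)" if F: "finite F" for F
  proof -
    have "((\<lambda>g. if g \<in> F then ?f g else 0) has_sum sum ?f F) UNIV"
      by (rule has_sum_finite_neutralI[of F]) (use F in auto)
    from has_sum_add[OF has_sum_infsum[OF s] has_sum_uminusI[OF this]]
    have "((\<lambda>g. ?f g + - (if g \<in> F then ?f g else 0)) has_sum (infsum ?f UNIV + - sum ?f F)) UNIV" .
    moreover have "(\<lambda>g. ?f g + - (if g \<in> F then ?f g else 0)) = (\<lambda>g. (cmod (\<xi> g - trunc F \<xi> g))\<^sup>2)"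
      by (auto simp: trunc_def)
    ultimately show ?thesis
      by (simp add: l2norm_def infsumI)
  qed
  have "((\<lambda>F. sqrt (infsum ?f UNIV - sum ?f F)) \<longlongrightarrow> sqrt (infsum ?f UNIV - infsum ?f UNIV))
          (finite_subsets_at_top UNIV)"
    by (intro tendsto_intros infsum_tendsto s)
  then show ?thesis
    by (subst tendsto_cong[OF eventually_finite_subsets_at_top_weakI[of UNIV, OF eq]]) auto
qed

section \<open>Bounded operators and their matrix coefficients\<close>

lemma bounded_op_outside: "bounded_op L T \<Longrightarrow> \<xi> \<notin> ell2 L \<Longrightarrow> T \<xi> = (\<lambda>_. 0)"
  unfolding bounded_op_def by blast

lemma bounded_op_ell2: "bounded_op L T \<Longrightarrow> \<xi> \<in> ell2 L \<Longrightarrow> T \<xi> \<in> ell2 L"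
  unfolding bounded_op_def by blast

lemma bounded_op_ell2': "bounded_op L T \<Longrightarrow> T \<xi> \<in> ell2 L"
  by (cases "\<xi> \<in> ell2 L") (simp_all add: bounded_op_outside bounded_op_ell2)

lemma bounded_op_linear:
  "bounded_op L T \<Longrightarrow> \<xi> \<in> ell2 L \<Longrightarrow> \<eta> \<in> ell2 L \<Longrightarrow>
    T (\<lambda>g. \<xi> g + c * \<eta> g) = (\<lambda>g. T \<xi> g + c * T \<eta> g)"
  unfolding bounded_op_def by blast

lemma bounded_op_zero:
  assumes "bounded_op L T"
  shows "T (\<lambda>_. 0) = (\<lambda>_. 0)"
proof
  fix g
  show "T (\<lambda>_. 0) g = 0"
    using fun_cong[OF bounded_op_linear[OF assms ell2_zero ell2_zero, of 1], of g] by simp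
qed

lemma bounded_op_scale:
  assumes "bounded_op L T" "\<xi> \<in> ell2 L"
  shows "T (\<lambda>g. c * \<xi> g) = (\<lambda>g. c * T \<xi> g)"
  using bounded_op_linear[OF assms(1) ell2_zero assms(2), of c] bounded_op_zero[OF assms(1)] by simp

lemma bounded_op_diff:
  assumes "bounded_op L T" "\<xi> \<in> ell2 L" "\<eta> \<in> ell2 L"
  shows "T (\<lambda>g. \<xi> g - \<eta> g) = (\<lambda>g. T \<xi> g - T \<eta> g)"
  using bounded_op_linear[OF assms, of "-1"] by simp

lemma ell2_diff: "\<xi> \<in> ell2 L \<Longrightarrow> \<eta> \<in> ell2 L \<Longrightarrow> (\<lambda>g. \<xi> g - \<eta> g) \<in> ell2 L"
  using ell2_lincomb[of \<xi> L \<eta> "-1"] by simp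

lemma ell2_sq: "\<xi> \<in> ell2 L \<Longrightarrow> sq_summable \<xi>"
  unfolding ell2_iff by blast

lemma bounded_op_le_opnorm:
  assumes T: "bounded_op L T" and \<xi>: "\<xi> \<in> ell2 L"
  shows "l2norm (T \<xi>) \<le> opnorm L T * l2norm \<xi>"
proof (cases "l2norm \<xi> = 0")
  case True
  then have "\<xi> = (\<lambda>_. 0)"
    using l2norm_eq_0D ell2_sq[OF \<xi>] by blast
  then show ?thesis
    by (simp add: bounded_op_zero[OF T])
next
  case False
  then have pos: "l2norm \<xi> > 0"
    using l2norm_nonneg[of \<xi>] by linarith
  define \<eta> where "\<eta> = (\<lambda>g. complex_of_real (1 / l2norm \<xi>) * \<xi> g)"
  have \<eta>: "\<eta> \<in> ell2 L" "l2norm \<eta> = 1"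
    unfolding \<eta>_def l2norm_scale using pos by (simp_all add: ell2_scale[OF \<xi>] norm_divide del: of_real_divide)
  have bd: "bdd_above {l2norm (T \<xi>) | \<xi>. \<xi> \<in> ell2 L \<and> l2norm \<xi> \<le> 1}"
    using T unfolding bounded_op_def by (elim conjE)
  have "l2norm (T \<eta>) \<le> opnorm L T"
    unfolding opnorm_def by (rule cSup_upper[OF _ bd]) (use \<eta> in auto)
  moreover have "l2norm (T \<eta>) = l2norm (T \<xi>) / l2norm \<xi>"
    unfolding \<eta>_def bounded_op_scale[OF T \<xi>] l2norm_scale using pos by (simp add: norm_divide)
  ultimately show ?thesis
    using pos by (simp add: field_simps)
qed

lemma opnorm_le:
  assumes "C \<ge> 0" "\<And>\<xi>. \<xi> \<in> ell2 L \<Longrightarrow> l2norm (T \<xi>) \<le> C * l2norm \<xi>"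
  shows "opnorm L T \<le> C" "bdd_above {l2norm (T \<xi>) | \<xi>. \<xi> \<in> ell2 L \<and> l2norm \<xi> \<le> 1}"
proof -
  have le: "l2norm (T \<xi>) \<le> C" if "\<xi> \<in> ell2 L" "l2norm \<xi> \<le> 1" for \<xi>
    using assms(2)[OF that(1)] mult_left_mono[OF that(2) assms(1)] by linarith
  \<comment> \<open>The supremum is over a nonempty set because it contains the value at the zero
    vector.\<close>
  show "opnorm L T \<le> C"
    unfolding opnorm_def
    by (rule cSup_least) (use le ell2_zero[of L] l2norm_zero in \<open>auto intro!: exI[of _ "\<lambda>_. 0"]\<close>)
  show "bdd_above {l2norm (T \<xi>) | \<xi>. \<xi> \<in> ell2 L \<and> l2norm \<xi> \<le> 1}"
    by (rule bdd_aboveI[of _ C]) (use le in auto)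
qed

lemma opnorm_nonneg:
  assumes T: "bounded_op L T"
  shows "0 \<le> opnorm L T"
proof -
  have bd: "bdd_above {l2norm (T \<xi>) | \<xi>. \<xi> \<in> ell2 L \<and> l2norm \<xi> \<le> 1}"
    using T unfolding bounded_op_def by (elim conjE)
  have "l2norm (T (\<lambda>_. 0)) \<le> opnorm L T"
    unfolding opnorm_def
    by (rule cSup_upper[OF _ bd]) (use ell2_zero[of L] l2norm_zero in \<open>auto intro!: exI[of _ "\<lambda>_. 0"]\<close>)
  then show ?thesis
    using l2norm_nonneg order_trans by blast
qed

lemma bounded_opI:
  assumes "\<And>\<xi>. \<xi> \<notin> ell2 L \<Longrightarrow> T \<xi> = (\<lambda>_. 0)" "\<And>\<xi>. \<xi> \<in> ell2 L \<Longrightarrow> T \<xi> \<in> ell2 L"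
    "\<And>\<xi> \<eta> c. \<xi> \<in> ell2 L \<Longrightarrow> \<eta> \<in> ell2 L \<Longrightarrow> T (\<lambda>g. \<xi> g + c * \<eta> g) = (\<lambda>g. T \<xi> g + c * T \<eta> g)"
    "C \<ge> 0" "\<And>\<xi>. \<xi> \<in> ell2 L \<Longrightarrow> l2norm (T \<xi>) \<le> C * l2norm \<xi>"
  shows "bounded_op L T"
  unfolding bounded_op_def by (intro conjI allI impI ballI assms(1-3) opnorm_le(2)[OF assms(4,5)])

lemma bounded_op_op_add:
  assumes "bounded_op L S" "bounded_op L T"
  shows "bounded_op L (op_add S T)" "opnorm L (op_add S T) \<le> opnorm L S + opnorm L T"
proof -
  have le: "l2norm (op_add S T \<xi>) \<le> (opnorm L S + opnorm L T) * l2norm \<xi>" if "\<xi> \<in> ell2 L" for \<xi>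
    using sq_summable_add(2)[OF ell2_sq ell2_sq, OF bounded_op_ell2[OF assms(1) that] bounded_op_ell2[OF assms(2) that]]
      bounded_op_le_opnorm[OF assms(1) that] bounded_op_le_opnorm[OF assms(2) that]
    by (simp add: op_add_def algebra_simps)
  have nn: "opnorm L S + opnorm L T \<ge> 0"
    by (intro add_nonneg_nonneg opnorm_nonneg assms)
  show "opnorm L (op_add S T) \<le> opnorm L S + opnorm L T"
    using opnorm_le(1)[OF nn le] by blast
  show "bounded_op L (op_add S T)"
  proof (rule bounded_opI[OF _ _ _ nn le])
    fix \<xi> assume "\<xi> \<notin> ell2 L" then show "op_add S T \<xi> = (\<lambda>_. 0)"
      using assms by (simp add: op_add_def bounded_op_outside)
  next
    fix \<xi> assume "\<xi> \<in> ell2 L" then show "op_add S T \<xi> \<in> ell2 L"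
      using ell2_lincomb[OF bounded_op_ell2[OF assms(1)] bounded_op_ell2[OF assms(2)], of \<xi> \<xi> 1]
      by (simp add: op_add_def)
  next
    fix \<xi> \<eta> c assume "\<xi> \<in> ell2 L" "\<eta> \<in> ell2 L"
    then show "op_add S T (\<lambda>g. \<xi> g + c * \<eta> g) = (\<lambda>g. op_add S T \<xi> g + c * op_add S T \<eta> g)"
      by (simp add: op_add_def bounded_op_linear[OF assms(1)] bounded_op_linear[OF assms(2)] algebra_simps)
  qed
qed

lemma bounded_op_op_scale:
  assumes "bounded_op L T"
  shows "bounded_op L (op_scale c T)" "opnorm L (op_scale c T) \<le> cmod c * opnorm L T"
proof -
  have le: "l2norm (op_scale c T \<xi>) \<le> (cmod c * opnorm L T) * l2norm \<xi>" if "\<xi> \<in> ell2 L" for \<xi>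
    using bounded_op_le_opnorm[OF assms that] by (simp add: op_scale_def l2norm_scale mult.assoc mult_left_mono)
  have nn: "cmod c * opnorm L T \<ge> 0"
    by (intro mult_nonneg_nonneg opnorm_nonneg assms norm_ge_zero)
  show "opnorm L (op_scale c T) \<le> cmod c * opnorm L T"
    using opnorm_le(1)[OF nn le] by blast
  show "bounded_op L (op_scale c T)"
    by (rule bounded_opI[OF _ _ _ nn le])
      (use assms in \<open>simp_all add: op_scale_def bounded_op_outside bounded_op_ell2 ell2_scale bounded_op_linear algebra_simps\<close>)
qed

lemma op_diff_eq: "op_diff S T = op_add S (op_scale (-1) T)"
  by (simp add: op_diff_def op_add_def op_scale_def)

lemma bounded_op_op_diff:
  assumes "bounded_op L S" "bounded_op L T"
  shows "bounded_op L (op_diff S T)"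
  unfolding op_diff_eq by (intro bounded_op_op_add bounded_op_op_scale assms)

lemma bounded_op_comp:
  assumes S: "bounded_op L S" and T: "bounded_op L T"
  shows "bounded_op L (S \<circ> T)" "opnorm L (S \<circ> T) \<le> opnorm L S * opnorm L T"
proof -
  have le: "l2norm ((S \<circ> T) \<xi>) \<le> (opnorm L S * opnorm L T) * l2norm \<xi>" if "\<xi> \<in> ell2 L" for \<xi>
    using bounded_op_le_opnorm[OF S bounded_op_ell2[OF T that]]
      mult_left_mono[OF bounded_op_le_opnorm[OF T that] opnorm_nonneg[OF S]]
    by (simp add: mult.assoc)
  have nn: "opnorm L S * opnorm L T \<ge> 0"
    by (intro mult_nonneg_nonneg opnorm_nonneg assms norm_ge_zero)
  show "opnorm L (S \<circ> T) \<le> opnorm L S * opnorm L T"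
    using opnorm_le(1)[OF nn le] by blast
  show "bounded_op L (S \<circ> T)"
    by (rule bounded_opI[OF _ _ _ nn le])
      (simp_all add: bounded_op_outside[OF T] bounded_op_zero[OF S] bounded_op_ell2[OF T] bounded_op_ell2[OF S]
         bounded_op_linear[OF T] bounded_op_linear[OF S])
qed

lemma bounded_op_trunc:
  assumes T: "bounded_op L T" and \<xi>: "\<xi> \<in> ell2 L" and "finite F"
  shows "T (trunc F \<xi>) = (\<lambda>g. \<Sum>b\<in>F. \<xi> b * T (delta b) g)"
  using assms(3)
proof induction
  case empty
  then show ?case by (simp add: trunc_def bounded_op_zero[OF T])
next
  case (insert b F)
  show ?case
  proof (cases "b \<in> GL L")
    case True
    have "trunc (insert b F) \<xi> = (\<lambda>g. trunc F \<xi> g + \<xi> b * delta b g)"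
      using insert.hyps by (auto simp: trunc_def delta_def)
    then show ?thesis
      using insert by (simp add: bounded_op_linear[OF T ell2_trunc[OF \<xi>] ell2_delta[OF True]] add.commute)
  next
    case False
    then have "\<xi> b = 0"
      by (rule ell2_outside[OF \<xi>])
    then have "trunc (insert b F) \<xi> = trunc F \<xi>" "\<xi> b = 0"
      by (auto simp: trunc_def)
    then show ?thesis
      using insert by simp
  qed
qed

text \<open>Boundedness lets the expansion of \<xi> in the basis \<open>delta b\<close> pass through
  T: the error is at most \<open>opnorm L T\<close> times a tail norm. Hence an operator is its
  matrix.\<close>

lemma bounded_op_has_sum:
  assumes T: "bounded_op L T" and \<xi>: "\<xi> \<in> ell2 L"
  shows "((\<lambda>b. \<xi> b * T (delta b) g) has_sum T \<xi> g) UNIV"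
proof -
  have "((\<lambda>F. (\<Sum>b\<in>F. \<xi> b * T (delta b) g) - T \<xi> g) \<longlongrightarrow> 0) (finite_subsets_at_top UNIV)"
  proof (rule Lim_null_comparison)
    have "norm ((\<Sum>b\<in>F. \<xi> b * T (delta b) g) - T \<xi> g) \<le> opnorm L T * l2norm (\<lambda>g. \<xi> g - trunc F \<xi> g)"
      if F: "finite F" for F
    proof -
      have d: "(\<lambda>g. \<xi> g - trunc F \<xi> g) \<in> ell2 L"
        by (rule ell2_diff[OF \<xi> ell2_trunc[OF \<xi>]])
      have "(\<Sum>b\<in>F. \<xi> b * T (delta b) g) - T \<xi> g = - T (\<lambda>g. \<xi> g - trunc F \<xi> g) g"
        by (simp add: bounded_op_diff[OF T \<xi> ell2_trunc[OF \<xi>]] bounded_op_trunc[OF T \<xi> F])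
      then have "norm ((\<Sum>b\<in>F. \<xi> b * T (delta b) g) - T \<xi> g) \<le> l2norm (T (\<lambda>g. \<xi> g - trunc F \<xi> g))"
        using cmod_le_l2norm[OF ell2_sq[OF bounded_op_ell2[OF T d]], of g] by simp
      then show ?thesis
        using bounded_op_le_opnorm[OF T d] by linarith
    qed
    then show "\<forall>\<^sub>F F in finite_subsets_at_top UNIV.
        norm ((\<Sum>b\<in>F. \<xi> b * T (delta b) g) - T \<xi> g) \<le> opnorm L T * l2norm (\<lambda>g. \<xi> g - trunc F \<xi> g)"
      by (intro eventually_finite_subsets_at_top_weakI) auto
    show "((\<lambda>F. opnorm L T * l2norm (\<lambda>g. \<xi> g - trunc F \<xi> g)) \<longlongrightarrow> 0) (finite_subsets_at_top UNIV)"
      using tendsto_mult_left[OF trunc_tendsto[OF ell2_sq[OF \<xi>]], of "opnorm L T"] by simp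
  qed
  then show ?thesis
    unfolding has_sum_def by (rule LIM_zero_cancel)
qed

text \<open>Operators are total functions with value 0 outside \<open>ell2 L\<close>, so agreement
  of matrix entries, which forces agreement on \<open>ell2 L\<close>, gives equality as functions.
  Many operator identities below are checked on matrix entries in this way.\<close>

lemma bounded_op_eqI:
  assumes S: "bounded_op L S" and T: "bounded_op L T"
    and eq: "\<And>b g. b \<in> GL L \<Longrightarrow> g \<in> GL L \<Longrightarrow> S (delta b) g = T (delta b) g"
  shows "S = T"
proof
  fix \<xi>
  show "S \<xi> = T \<xi>"
  proof (cases "\<xi> \<in> ell2 L")
    case True
    have "\<xi> b * S (delta b) g = \<xi> b * T (delta b) g" for b g
    proof (cases "b \<in> GL L \<and> g \<in> GL L")
      case True then show ?thesis using eq by simp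
    next
      case False
      then show ?thesis
        using ell2_outside[OF \<open>\<xi> \<in> ell2 L\<close>, of b] ell2_outside[OF bounded_op_ell2[OF S ell2_delta], of b g]
          ell2_outside[OF bounded_op_ell2[OF T ell2_delta], of b g] by (cases "b \<in> GL L") auto
    qed
    then have "((\<lambda>b. \<xi> b * T (delta b) g) has_sum S \<xi> g) UNIV" for g
      using bounded_op_has_sum[OF S True, of g] by (simp only:)
    then show ?thesis
      using bounded_op_has_sum[OF T True] by (intro ext) (rule has_sum_unique)
  next
    case False
    then show ?thesis
      using S T by (simp add: bounded_op_outside)
  qed
qed

lemma has_sum_finite_sum:
  fixes f :: "'b \<Rightarrow> 'g \<Rightarrow> complex"
  assumes "finite F" "\<And>b. b \<in> F \<Longrightarrow> (f b has_sum s b) A"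
  shows "((\<lambda>g. \<Sum>b\<in>F. f b g) has_sum (\<Sum>b\<in>F. s b)) A"
  using assms by (induction rule: finite_induct) (simp_all add: has_sum_add)

section \<open>Adjoints\<close>

lemma l2inner_diff_left:
  assumes "sq_summable \<xi>" "sq_summable \<xi>'" "sq_summable \<eta>"
  shows "l2inner (\<lambda>g. \<xi> g - \<xi>' g) \<eta> = l2inner \<xi> \<eta> - l2inner \<xi>' \<eta>"
  using has_sum_add[OF has_sum_infsum[OF l2inner_bound(1)[OF assms(1,3)]]
      has_sum_uminusI[OF has_sum_infsum[OF l2inner_bound(1)[OF assms(2,3)]]]]
  unfolding l2inner_def by (intro infsumI) (simp add: left_diff_distrib)

text \<open>The candidate \<zeta> is read off by testing the defining identity on basis vectors.
  That it is square summable replaces the Riesz representation theorem and comes from testing T on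
  truncations of \<zeta> itself.\<close>

lemma adjoint_exists:
  assumes T: "bounded_op L T" and \<eta>: "\<eta> \<in> ell2 L"
  defines "\<zeta> \<equiv> \<lambda>g. cnj (l2inner (T (delta g)) \<eta>)"
  shows "\<zeta> \<in> ell2 L" "l2norm \<zeta> \<le> opnorm L T * l2norm \<eta>"
    "\<xi> \<in> ell2 L \<Longrightarrow> l2inner (T \<xi>) \<eta> = l2inner \<xi> \<zeta>"
proof -
  have inner_trunc: "l2inner (T (trunc F \<xi>)) \<eta> = (\<Sum>b\<in>F. \<xi> b * cnj (\<zeta> b))"
    if F: "finite F" and \<xi>: "\<xi> \<in> ell2 L" for F \<xi>
  proof -
    have "((\<lambda>g. \<Sum>b\<in>F. \<xi> b * (T (delta b) g * cnj (\<eta> g))) has_sum (\<Sum>b\<in>F. \<xi> b * cnj (\<zeta> b))) UNIV"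
    proof (rule has_sum_finite_sum[OF F])
      fix b assume "b \<in> F"
      have "((\<lambda>g. T (delta b) g * cnj (\<eta> g)) has_sum cnj (\<zeta> b)) UNIV"
        unfolding \<zeta>_def complex_cnj_cnj l2inner_def
        by (intro has_sum_infsum l2inner_bound ell2_sq[OF \<eta>] ell2_sq[OF bounded_op_ell2'[OF T]])
      then show "((\<lambda>g. \<xi> b * (T (delta b) g * cnj (\<eta> g))) has_sum \<xi> b * cnj (\<zeta> b)) UNIV"
        by (rule has_sum_cmult_right)
    qed
    then show ?thesis
      unfolding l2inner_def bounded_op_trunc[OF T \<xi> F] sum_distrib_right mult.assoc by (rule infsumI)
  qed
  have \<zeta>0: "\<zeta> g = 0" if "g \<notin> GL L" for g
  proof -
    have "delta g \<notin> ell2 L"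
      using ell2_outside[of "delta g" L g] that by (auto simp: delta_def)
    then show ?thesis
      by (simp add: \<zeta>_def bounded_op_outside[OF T] l2inner_def)
  qed
  have le: "L2_set (\<lambda>g. cmod (\<zeta> g)) F \<le> opnorm L T * l2norm \<eta>" if F: "finite F" for F
  proof -
    \<comment> \<open>Testing T on this truncation gives the square of its norm as an inner product,
      bounded by \<open>opnorm L T\<close> times that norm times \<open>l2norm \<eta>\<close>;
      cancelling one factor leaves the claim.\<close>
    define \<xi> where "\<xi> = trunc F \<zeta>"
    have sqF: "(\<Sum>b\<in>F'. (cmod (\<xi> b))\<^sup>2) \<le> (L2_set (\<lambda>g. cmod (\<zeta> g)) F)\<^sup>2" if "finite F'" for F'
    proof -
      have "(\<Sum>b\<in>F'. (cmod (\<xi> b))\<^sup>2) = (\<Sum>b\<in>F' \<inter> F. (cmod (\<zeta> b))\<^sup>2)"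
        unfolding \<xi>_def trunc_def using that
        by (intro sum.mono_neutral_cong_right) auto
      also have "\<dots> \<le> (\<Sum>b\<in>F. (cmod (\<zeta> b))\<^sup>2)"
        using F by (intro sum_mono2) auto
      finally show ?thesis by (simp add: L2_set_def sum_nonneg)
    qed
    have \<xi>le: "L2_set (\<lambda>g. cmod (\<xi> g)) F' \<le> L2_set (\<lambda>g. cmod (\<zeta> g)) F" if "finite F'" for F'
      using sqF[OF that] by (simp add: L2_set_def real_le_lsqrt sum_nonneg)
    have \<xi>s: "sq_summable \<xi>" "l2norm \<xi> \<le> L2_set (\<lambda>g. cmod (\<zeta> g)) F"
      by (rule sq_summable_bounded[OF L2_set_nonneg \<xi>le]; assumption)+
    have \<xi>: "\<xi> \<in> ell2 L"
      unfolding ell2_iff using \<xi>s(1) \<zeta>0 by (auto simp: \<xi>_def trunc_def)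
    have "trunc F \<xi> = \<xi>"
      by (auto simp: \<xi>_def trunc_def)
    then have "l2inner (T \<xi>) \<eta> = (\<Sum>b\<in>F. \<xi> b * cnj (\<zeta> b))"
      using inner_trunc[OF F \<xi>] by simp
    also have "\<dots> = of_real ((L2_set (\<lambda>g. cmod (\<zeta> g)) F)\<^sup>2)"
    proof -
      have "\<xi> b * cnj (\<zeta> b) = of_real ((cmod (\<zeta> b))\<^sup>2)" if "b \<in> F" for b
        unfolding complex_norm_square using that by (simp add: \<xi>_def trunc_def)
      then show ?thesis
        by (simp add: L2_set_def sum_nonneg)
    qed
    finally have "(L2_set (\<lambda>g. cmod (\<zeta> g)) F)\<^sup>2 \<le> l2norm (T \<xi>) * l2norm \<eta>"
      using l2inner_bound(2)[OF ell2_sq[OF bounded_op_ell2[OF T \<xi>]] ell2_sq[OF \<eta>]]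
      by (simp add: norm_power)
    also have "\<dots> \<le> (opnorm L T * l2norm \<xi>) * l2norm \<eta>"
      by (intro mult_right_mono bounded_op_le_opnorm T \<xi>) simp
    also have "\<dots> \<le> (opnorm L T * L2_set (\<lambda>g. cmod (\<zeta> g)) F) * l2norm \<eta>"
      by (intro mult_right_mono mult_left_mono \<xi>s opnorm_nonneg T) simp
    finally have "L2_set (\<lambda>g. cmod (\<zeta> g)) F * L2_set (\<lambda>g. cmod (\<zeta> g)) F
        \<le> (opnorm L T * l2norm \<eta>) * L2_set (\<lambda>g. cmod (\<zeta> g)) F"
      by (simp add: power2_eq_square mult_ac)
    moreover have "opnorm L T * l2norm \<eta> \<ge> 0"
      using opnorm_nonneg[OF T] by simp
    ultimately show ?thesis
      by (cases "L2_set (\<lambda>g. cmod (\<zeta> g)) F = 0")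
         (auto dest!: mult_right_le_imp_le simp: less_le)
  qed
  have nn: "opnorm L T * l2norm \<eta> \<ge> 0"
    using opnorm_nonneg[OF T] by simp
  show "l2norm \<zeta> \<le> opnorm L T * l2norm \<eta>"
    using sq_summable_bounded(2)[OF nn le] by blast
  show "\<zeta> \<in> ell2 L"
    unfolding ell2_iff using sq_summable_bounded(1)[OF nn le] \<zeta>0 by blast
  show "l2inner (T \<xi>) \<eta> = l2inner \<xi> \<zeta>" if \<xi>: "\<xi> \<in> ell2 L"
  proof -
    have "((\<lambda>F. (\<Sum>b\<in>F. \<xi> b * cnj (\<zeta> b)) - l2inner (T \<xi>) \<eta>) \<longlongrightarrow> 0) (finite_subsets_at_top UNIV)"
    proof (rule Lim_null_comparison)
      have "norm ((\<Sum>b\<in>F. \<xi> b * cnj (\<zeta> b)) - l2inner (T \<xi>) \<eta>)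
          \<le> opnorm L T * l2norm (\<lambda>g. \<xi> g - trunc F \<xi> g) * l2norm \<eta>" if F: "finite F" for F
      proof -
        have d: "(\<lambda>g. \<xi> g - trunc F \<xi> g) \<in> ell2 L"
          by (rule ell2_diff[OF \<xi> ell2_trunc[OF \<xi>]])
        have "l2inner (T (\<lambda>g. \<xi> g - trunc F \<xi> g)) \<eta> = l2inner (T \<xi>) \<eta> - l2inner (T (trunc F \<xi>)) \<eta>"
          unfolding bounded_op_diff[OF T \<xi> ell2_trunc[OF \<xi>]]
          by (intro l2inner_diff_left ell2_sq[OF \<eta>] ell2_sq[OF bounded_op_ell2'[OF T]])
        then have "norm ((\<Sum>b\<in>F. \<xi> b * cnj (\<zeta> b)) - l2inner (T \<xi>) \<eta>)
            = norm (l2inner (T (\<lambda>g. \<xi> g - trunc F \<xi> g)) \<eta>)"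
          using inner_trunc[OF F \<xi>] by (simp add: norm_minus_commute)
        also have "\<dots> \<le> l2norm (T (\<lambda>g. \<xi> g - trunc F \<xi> g)) * l2norm \<eta>"
          by (intro l2inner_bound ell2_sq[OF \<eta>] ell2_sq[OF bounded_op_ell2[OF T d]])
        also have "\<dots> \<le> opnorm L T * l2norm (\<lambda>g. \<xi> g - trunc F \<xi> g) * l2norm \<eta>"
          by (intro mult_right_mono bounded_op_le_opnorm T d) simp
        finally show ?thesis .
      qed
      then show "\<forall>\<^sub>F F in finite_subsets_at_top UNIV. norm ((\<Sum>b\<in>F. \<xi> b * cnj (\<zeta> b)) - l2inner (T \<xi>) \<eta>)
          \<le> opnorm L T * l2norm (\<lambda>g. \<xi> g - trunc F \<xi> g) * l2norm \<eta>"
        by (intro eventually_finite_subsets_at_top_weakI) auto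
      show "((\<lambda>F. opnorm L T * l2norm (\<lambda>g. \<xi> g - trunc F \<xi> g) * l2norm \<eta>) \<longlongrightarrow> 0) (finite_subsets_at_top UNIV)"
        using tendsto_mult_right[OF tendsto_mult_left[OF trunc_tendsto[OF ell2_sq[OF \<xi>]], of "opnorm L T"], of "l2norm \<eta>"]
        by simp
    qed
    then have "((\<lambda>b. \<xi> b * cnj (\<zeta> b)) has_sum l2inner (T \<xi>) \<eta>) UNIV"
      unfolding has_sum_def by (rule LIM_zero_cancel)
    then show ?thesis
      by (simp add: l2inner_def infsumI)
  qed
qed

text \<open>Discharges the definite description: any two candidates agree because pairing with
  \<open>delta g\<close> reads off their values.\<close>

lemma op_adj_eq:
  assumes T: "bounded_op L T" and \<eta>: "\<eta> \<in> ell2 L"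
  shows "op_adj L T \<eta> = (\<lambda>g. cnj (l2inner (T (delta g)) \<eta>))"
proof -
  let ?\<zeta> = "\<lambda>g. cnj (l2inner (T (delta g)) \<eta>)"
  have "(THE \<zeta>. \<zeta> \<in> ell2 L \<and> (\<forall>\<xi>\<in>ell2 L. l2inner (T \<xi>) \<eta> = l2inner \<xi> \<zeta>)) = ?\<zeta>"
  proof (rule the_equality)
    show "?\<zeta> \<in> ell2 L \<and> (\<forall>\<xi>\<in>ell2 L. l2inner (T \<xi>) \<eta> = l2inner \<xi> ?\<zeta>)"
      using adjoint_exists(1,3)[OF T \<eta>] by (intro conjI ballI)
    fix \<zeta> assume \<zeta>: "\<zeta> \<in> ell2 L \<and> (\<forall>\<xi>\<in>ell2 L. l2inner (T \<xi>) \<eta> = l2inner \<xi> \<zeta>)"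
    show "\<zeta> = ?\<zeta>"
    proof
      fix g
      show "\<zeta> g = cnj (l2inner (T (delta g)) \<eta>)"
      proof (cases "g \<in> GL L")
        case True
        then have "l2inner (T (delta g)) \<eta> = l2inner (delta g) \<zeta>"
          using conjunct2[OF \<zeta>] ell2_delta by blast
        then show ?thesis
          by (simp add: l2inner_delta_left)
      next
        case False
        then show ?thesis
          using ell2_outside[OF conjunct1[OF \<zeta>] False] ell2_outside[OF adjoint_exists(1)[OF T \<eta>] False] by simp
      qed
    qed
  qed
  then show ?thesis
    using \<eta> by (simp add: op_adj_def)
qed

lemma l2inner_op_adj:
  assumes "bounded_op L T" "\<xi> \<in> ell2 L" "\<eta> \<in> ell2 L"
  shows "l2inner (T \<xi>) \<eta> = l2inner \<xi> (op_adj L T \<eta>)"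
  using adjoint_exists(3)[OF assms(1,3,2)] op_adj_eq[OF assms(1,3)] by simp

lemma op_adj_delta:
  assumes "bounded_op L T" "g \<in> GL L"
  shows "op_adj L T (delta g) h = cnj (T (delta h) g)"
  by (simp add: op_adj_eq[OF assms(1) ell2_delta[OF assms(2)]] l2inner_delta_right)

lemma bounded_op_op_adj:
  assumes T: "bounded_op L T"
  shows "bounded_op L (op_adj L T)" "opnorm L (op_adj L T) \<le> opnorm L T"
proof -
  have le: "l2norm (op_adj L T \<eta>) \<le> opnorm L T * l2norm \<eta>" if "\<eta> \<in> ell2 L" for \<eta>
    using adjoint_exists(2)[OF T that] op_adj_eq[OF T that] by simp
  show "opnorm L (op_adj L T) \<le> opnorm L T"
    using opnorm_le(1)[OF opnorm_nonneg[OF T] le] by blast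
  show "bounded_op L (op_adj L T)"
  proof (rule bounded_opI[OF _ _ _ opnorm_nonneg[OF T] le])
    fix \<eta> assume "\<eta> \<notin> ell2 L" then show "op_adj L T \<eta> = (\<lambda>_. 0)"
      by (simp add: op_adj_def)
  next
    fix \<eta> assume "\<eta> \<in> ell2 L" then show "op_adj L T \<eta> \<in> ell2 L"
      using adjoint_exists(1)[OF T] op_adj_eq[OF T] by simp
  next
    fix \<xi> \<eta> c assume *: "\<xi> \<in> ell2 L" "\<eta> \<in> ell2 L"
    have "l2inner (T (delta g)) (\<lambda>g. \<xi> g + c * \<eta> g) = l2inner (T (delta g)) \<xi> + cnj c * l2inner (T (delta g)) \<eta>" for g
    proof -
      have s: "sq_summable (T (delta g))"
        by (rule ell2_sq[OF bounded_op_ell2'[OF T]])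
      have "l2inner (T (delta g)) (\<lambda>g. \<xi> g + c * \<eta> g)
          = infsum (\<lambda>h. T (delta g) h * cnj (\<xi> h) + cnj c * (T (delta g) h * cnj (\<eta> h))) UNIV"
        unfolding l2inner_def by (simp add: algebra_simps)
      also have "\<dots> = infsum (\<lambda>h. T (delta g) h * cnj (\<xi> h)) UNIV + infsum (\<lambda>h. cnj c * (T (delta g) h * cnj (\<eta> h))) UNIV"
        by (intro infsum_add summable_on_cmult_right l2inner_bound s ell2_sq[OF *(1)] ell2_sq[OF *(2)])
      finally show ?thesis
        by (simp add: l2inner_def infsum_cmult_right')
    qed
    then show "op_adj L T (\<lambda>g. \<xi> g + c * \<eta> g) = (\<lambda>g. op_adj L T \<xi> g + c * op_adj L T \<eta> g)"
      by (simp add: op_adj_eq[OF T] * ell2_lincomb)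
  qed
qed

lemma op_adj_eqI:
  assumes "bounded_op L T" "bounded_op L S"
    "\<And>g h. g \<in> GL L \<Longrightarrow> h \<in> GL L \<Longrightarrow> S (delta g) h = cnj (T (delta h) g)"
  shows "op_adj L T = S"
  by (rule bounded_op_eqI[OF bounded_op_op_adj(1)[OF assms(1)] assms(2)])
     (use assms(3) in \<open>simp add: op_adj_delta[OF assms(1)]\<close>)

lemma op_adj_op_diff:
  assumes "bounded_op L S" "bounded_op L T"
  shows "op_adj L (op_diff S T) = op_diff (op_adj L S) (op_adj L T)"
proof (rule op_adj_eqI[OF bounded_op_op_diff[OF assms]])
  show "bounded_op L (op_diff (op_adj L S) (op_adj L T))"
    by (intro bounded_op_op_diff bounded_op_op_adj assms)
  fix g h assume "g \<in> GL L" "h \<in> GL L"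
  then show "op_diff (op_adj L S) (op_adj L T) (delta g) h = cnj (op_diff S T (delta h) g)"
    using assms by (simp add: op_diff_def op_adj_delta)
qed

section \<open>The shift space of a left-resolving system\<close>

definition clopenin :: "'a topology \<Rightarrow> 'a set \<Rightarrow> bool" where
  "clopenin X S \<longleftrightarrow> openin X S \<and> closedin X S"

lemma clopenin_Int: "clopenin X S \<Longrightarrow> clopenin X T \<Longrightarrow> clopenin X (S \<inter> T)"
  by (auto simp: clopenin_def)

lemma clopenin_Un: "clopenin X S \<Longrightarrow> clopenin X T \<Longrightarrow> clopenin X (S \<union> T)"
  by (auto simp: clopenin_def)

lemma clopenin_Diff: "clopenin X S \<Longrightarrow> clopenin X T \<Longrightarrow> clopenin X (S - T)"
  by (auto simp: clopenin_def openin_diff closedin_diff)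

lemma clopenin_topspace [simp]: "clopenin X (topspace X)"
  by (simp add: clopenin_def)

lemma clopenin_empty [simp]: "clopenin X {}"
  by (simp add: clopenin_def)

lemma clopenin_UN: "finite I \<Longrightarrow> (\<And>i. i \<in> I \<Longrightarrow> clopenin X (S i)) \<Longrightarrow> clopenin X (\<Union>i\<in>I. S i)"
  by (induction rule: finite_induct) (simp_all add: clopenin_Un)

lemma clopenin_subset: "clopenin X S \<Longrightarrow> S \<subseteq> topspace X"
  by (simp add: clopenin_def openin_subset)

lemma clopenin_preimage:
  "continuous_map X Y f \<Longrightarrow> clopenin Y S \<Longrightarrow> clopenin X {x \<in> topspace X. f x \<in> S}"
  by (simp add: clopenin_def openin_continuous_map_preimage closedin_continuous_map_preimage)

lemma clopenin_discrete_eq: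
  assumes f: "continuous_map X (discrete_topology A) f"
  shows "clopenin X {x \<in> topspace X. f x = c}"
proof -
  have "f x \<in> A" if "x \<in> topspace X" for x
    using continuous_map_image_subset_topspace[OF f] that by auto
  then have "{x \<in> topspace X. f x = c} = {x \<in> topspace X. f x \<in> A \<inter> {c}}"
    by blast
  then show ?thesis
    using clopenin_preimage[OF f, of "A \<inter> {c}"] by (simp add: clopenin_def)
qed

definition clopen_separated :: "'a topology \<Rightarrow> bool" where
  "clopen_separated X \<longleftrightarrow>
     (\<forall>x\<in>topspace X. \<forall>y\<in>topspace X. x \<noteq> y \<longrightarrow> (\<exists>C. clopenin X C \<and> x \<in> C \<and> y \<notin> C))"

text \<open>Finitely many clopen sets that miss x cover the compact complement of U, and the
  complement of their union is the neighbourhood. So clopen sets form a base in such spaces.\<close>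

lemma clopen_neighbourhood:
  assumes "compact_space X" "clopen_separated X" "openin X U" "x \<in> U"
  obtains C where "clopenin X C" "x \<in> C" "C \<subseteq> U"
proof -
  have x: "x \<in> topspace X"
    using assms(3,4) openin_subset by blast
  have "\<exists>C. clopenin X C \<and> x \<notin> C \<and> y \<in> C" if "y \<in> topspace X - U" for y
  proof -
    have "y \<noteq> x" "y \<in> topspace X"
      using that assms(4) by auto
    then show ?thesis
      using assms(2) x unfolding clopen_separated_def by metis
  qed
  then obtain D where D: "\<And>y. y \<in> topspace X - U \<Longrightarrow> clopenin X (D y) \<and> x \<notin> D y \<and> y \<in> D y"
    by metis
  have "compactin X (topspace X - U)"
    using assms(1,3) by (simp add: closedin_compact_space openin_closedin_eq)
  moreover have "\<forall>S\<in>D ` (topspace X - U). openin X S"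
    using D by (auto simp: clopenin_def)
  ultimately obtain F where F: "finite F" "F \<subseteq> D ` (topspace X - U)" "topspace X - U \<subseteq> \<Union>F"
    using D unfolding compactin_def by (metis (no_types, lifting) UN_I subsetI)
  have "clopenin X (topspace X - \<Union>F)"
  proof (rule clopenin_Diff[OF clopenin_topspace])
    show "clopenin X (\<Union>F)"
      using clopenin_UN[of F X id] F D by force
  qed
  moreover have "x \<in> topspace X - \<Union>F" "topspace X - \<Union>F \<subseteq> U"
    using F D x by auto
  ultimately show ?thesis
    using that by blast
qed

section \<open>Compactness of the shift space\<close>

locale lgsys =
  fixes L :: "('v, 'e, 'a) lgs"
  assumes lgs: "is_lgs L" and left_res: "left_resolving L"
begin

lemma finite_Sig: "finite (lSig L)"
  and finite_V: "finite (lV L l)"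
  and finite_E: "finite (lE L l)"
  using lgs unfolding is_lgs_def by (elim conjE, simp)+

lemma edge_src: "e \<in> lE L l \<Longrightarrow> lsrc L e \<in> lV L l"
  and edge_trg: "e \<in> lE L l \<Longrightarrow> ltrg L e \<in> lV L (Suc l)"
  and edge_lab: "e \<in> lE L l \<Longrightarrow> llab L e \<in> lSig L"
  using lgs unfolding is_lgs_def by (elim conjE, blast)+

lemma iota_V: "v \<in> lV L (Suc l) \<Longrightarrow> liota L v \<in> lV L l"
  using lgs unfolding is_lgs_def by (elim conjE, blast)

lemma edge_unique:
  "e \<in> lE L l \<Longrightarrow> f \<in> lE L m \<Longrightarrow> ltrg L e = ltrg L f \<Longrightarrow> llab L e = llab L f \<Longrightarrow> e = f"
  using left_res unfolding left_resolving_def by blast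

text \<open>The local property indexed from level 0, so that no truncated subtraction occurs
  later.\<close>

lemma local_bij:
  assumes "u \<in> lV L l" "v \<in> lV L (Suc (Suc l))"
  shows "\<exists>b. bij_betw b {e\<in>lE L (Suc l). liota L (lsrc L e) = u \<and> ltrg L e = v}
                        {e\<in>lE L l. lsrc L e = u \<and> ltrg L e = liota L v}
            \<and> (\<forall>e\<in>{e\<in>lE L (Suc l). liota L (lsrc L e) = u \<and> ltrg L e = v}. llab L (b e) = llab L e)"
proof -
  have "\<forall>l\<ge>1. \<forall>u\<in>lV L (l - 1). \<forall>v\<in>lV L (Suc l).
        \<exists>b. bij_betw b {e\<in>lE L l. liota L (lsrc L e) = u \<and> ltrg L e = v}
                        {e\<in>lE L (l - 1). lsrc L e = u \<and> ltrg L e = liota L v}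
            \<and> (\<forall>e\<in>{e\<in>lE L l. liota L (lsrc L e) = u \<and> ltrg L e = v}. llab L (b e) = llab L e)"
    using lgs unfolding is_lgs_def by (elim conjE)
  from this[rule_format, of "Suc l" u v] assms show ?thesis
    by simp
qed

lemma edge_down:
  assumes e: "e \<in> lE L (Suc l)"
  obtains e' where "e' \<in> lE L l" "lsrc L e' = liota L (lsrc L e)" "ltrg L e' = liota L (ltrg L e)"
    "llab L e' = llab L e"
proof -
  let ?A = "{e'\<in>lE L (Suc l). liota L (lsrc L e') = liota L (lsrc L e) \<and> ltrg L e' = ltrg L e}"
  obtain b where b: "bij_betw b ?A {e'\<in>lE L l. lsrc L e' = liota L (lsrc L e) \<and> ltrg L e' = liota L (ltrg L e)}"
    "\<forall>e'\<in>?A. llab L (b e') = llab L e'"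
    using local_bij[OF iota_V[OF edge_src[OF e]] edge_trg[OF e]] by (elim exE conjE)
  have "e \<in> ?A"
    using e by simp
  then show ?thesis
    using that[of "b e"] b(2) bij_betw_apply[OF b(1), of e] by simp
qed

text \<open>Surjectivity of the local bijection lifts an edge; \<open>edge_down\<close> applies the
  bijection itself.\<close>

lemma edge_up:
  assumes e: "e \<in> lE L l" and v: "v \<in> lV L (Suc (Suc l))" and "ltrg L e = liota L v"
  obtains e' where "e' \<in> lE L (Suc l)" "ltrg L e' = v" "llab L e' = llab L e"
proof -
  let ?A = "{e'\<in>lE L (Suc l). liota L (lsrc L e') = lsrc L e \<and> ltrg L e' = v}"
  obtain b where b: "bij_betw b ?A {e'\<in>lE L l. lsrc L e' = lsrc L e \<and> ltrg L e' = liota L v}"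
    "\<forall>e'\<in>?A. llab L (b e') = llab L e'"
    using local_bij[OF edge_src[OF e] v] by (elim exE conjE)
  have "e \<in> b ` ?A"
    using bij_betw_imp_surj_on[OF b(1)] assms by simp
  then obtain e' where "e' \<in> ?A" "b e' = e" by blast
  then show ?thesis
    using that[of e'] b(2) by auto
qed

lemma EL_D:
  assumes "(u, \<alpha>, w) \<in> EL L"
  shows "u \<in> Omega L" "w \<in> Omega L" "\<exists>e\<in>lE L l. lsrc L e = u l \<and> ltrg L e = w (Suc l) \<and> llab L e = \<alpha>"
  using assms by (auto simp: EL_def)

text \<open>The local property propagates an edge at level 0 to all levels, so this condition is clopen.\<close>
lemma EL_source_exists_iff:
  assumes w: "w \<in> Omega L"
  shows "(\<exists>u. (u, \<alpha>, w) \<in> EL L) \<longleftrightarrow> (\<exists>e\<in>lE L 0. ltrg L e = w 1 \<and> llab L e = \<alpha>)"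
proof
  assume "\<exists>u. (u, \<alpha>, w) \<in> EL L"
  then show "\<exists>e\<in>lE L 0. ltrg L e = w 1 \<and> llab L e = \<alpha>"
    using EL_D(3)[of _ \<alpha> w 0] by fastforce
next
  assume base: "\<exists>e\<in>lE L 0. ltrg L e = w 1 \<and> llab L e = \<alpha>"
  have wl: "w l \<in> lV L l" "liota L (w (Suc l)) = w l" for l
    using w by (auto simp: Omega_def)
  have "\<exists>e\<in>lE L l. ltrg L e = w (Suc l) \<and> llab L e = \<alpha>" for l
  proof (induction l)
    case 0 then show ?case using base by simp
  next
    case (Suc l)
    then obtain e where "e \<in> lE L l" "ltrg L e = liota L (w (Suc (Suc l)))" "llab L e = \<alpha>"
      using wl by auto
    then show ?case
      using edge_up[of e l "w (Suc (Suc l))"] wl by metis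
  qed
  then obtain e where e: "\<And>l. e l \<in> lE L l \<and> ltrg L (e l) = w (Suc l) \<and> llab L (e l) = \<alpha>"
    by metis
  \<comment> \<open>The edge above, pushed down by the local property, has the terminal and the
    label of the edge below; left-resolving makes them equal, so the sources form a thread.\<close>
  have "liota L (lsrc L (e (Suc l))) = lsrc L (e l)" for l
  proof -
    obtain e' where e': "e' \<in> lE L l" "lsrc L e' = liota L (lsrc L (e (Suc l)))"
      "ltrg L e' = liota L (ltrg L (e (Suc l)))" "llab L e' = llab L (e (Suc l))"
      using edge_down e by blast
    have "e' = e l"
      by (rule edge_unique[of _ l _ l]) (use e e' wl in auto)
    then show ?thesis
      using e' by simp
  qed
  then have "(\<lambda>l. lsrc L (e l)) \<in> Omega L"
    using e edge_src by (auto simp: Omega_def)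
  then have "(\<lambda>l. lsrc L (e l), \<alpha>, w) \<in> EL L"
    using w e by (auto simp: EL_def)
  then show "\<exists>u. (u, \<alpha>, w) \<in> EL L" by blast
qed

text \<open>A left-resolving edge is known from its terminal and its label, at every level. This is
  what makes the shift injective on each label cylinder.\<close>

lemma EL_source_unique:
  assumes "(u, \<alpha>, w) \<in> EL L" "(u', \<alpha>, w) \<in> EL L"
  shows "u = u'"
proof
  fix l
  show "u l = u' l"
    using EL_D(3)[OF assms(1), of l] EL_D(3)[OF assms(2), of l] edge_unique by metis
qed

lemma topspace_Omega [simp]: "topspace (Omega_top L) = Omega L"
  by (auto simp: Omega_top_def Omega_def topspace_product_topology)

text \<open>Each compatibility condition involves two coordinates with finitely many values and is
  therefore clopen.\<close>

lemma closedin_Omega: "closedin (product_topology (\<lambda>l. discrete_topology (lV L l)) UNIV) (Omega L)"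
proof -
  let ?P = "product_topology (\<lambda>l. discrete_topology (lV L l)) UNIV"
  have c: "continuous_map ?P (discrete_topology (lV L l)) (\<lambda>u. u l)" for l
    by (rule continuous_map_product_projection) simp
  have "clopenin ?P {u \<in> topspace ?P. liota L (u (Suc l)) = u l}" for l
  proof -
    have "{u \<in> topspace ?P. liota L (u (Suc l)) = u l} =
        (\<Union>v\<in>lV L (Suc l). {u \<in> topspace ?P. u (Suc l) = v} \<inter> {u \<in> topspace ?P. u l = liota L v})"
      by (auto simp: topspace_product_topology dest: PiE_mem[OF _ UNIV_I])
    then show ?thesis
      by (simp only:) (intro clopenin_UN finite_V clopenin_Int clopenin_discrete_eq[OF c])
  qed
  then have "closedin ?P (\<Inter>l. {u \<in> topspace ?P. liota L (u (Suc l)) = u l})"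
    by (intro closedin_Inter) (auto simp: clopenin_def)
  moreover have "(\<Inter>l. {u \<in> topspace ?P. liota L (u (Suc l)) = u l}) = Omega L"
    by (auto simp: Omega_def topspace_product_topology)
  ultimately show ?thesis by simp
qed

lemma compact_Omega: "compact_space (Omega_top L)"
  unfolding Omega_top_def
  by (rule compact_space_subtopology, rule closedin_compact_space[OF _ closedin_Omega])
     (simp add: compact_space_product_topology compact_space_discrete_topology finite_V)

lemma Hausdorff_Omega: "Hausdorff_space (Omega_top L)"
  unfolding Omega_top_def
  by (intro Hausdorff_space_subtopology) (simp add: Hausdorff_space_product_topology)

definition Y_top :: "(nat \<Rightarrow> 'a \<times> (nat \<Rightarrow> 'v)) topology" where
  "Y_top = product_topology (\<lambda>i. prod_topology (discrete_topology (lSig L)) (Omega_top L)) UNIV"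

lemma topspace_Y: "x \<in> topspace Y_top \<longleftrightarrow> (\<forall>i. fst (x i) \<in> lSig L \<and> snd (x i) \<in> Omega L)"
  by (auto simp: Y_top_def topspace_product_topology PiE_iff mem_Times_iff)

lemma continuous_Y_label: "continuous_map Y_top (discrete_topology (lSig L)) (\<lambda>x. fst (x i))"
  unfolding Y_top_def
  by (rule continuous_map_compose[OF continuous_map_product_projection[of i] continuous_map_fst, unfolded comp_def]) simp

lemma continuous_Y_vertex: "continuous_map Y_top (discrete_topology (lV L l)) (\<lambda>x. snd (x i) l)"
proof -
  have "continuous_map Y_top (Omega_top L) (\<lambda>x. snd (x i))"
    unfolding Y_top_def
    by (rule continuous_map_compose[OF continuous_map_product_projection[of i] continuous_map_snd, unfolded comp_def]) simp
  moreover have "continuous_map (Omega_top L) (discrete_topology (lV L l)) (\<lambda>u. u l)"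
    unfolding Omega_top_def by (intro continuous_map_from_subtopology continuous_map_product_projection) simp
  ultimately show ?thesis
    by (rule continuous_map_compose[unfolded comp_def])
qed

text \<open>Membership becomes a family of conditions on finitely many coordinates each: the unknown
  predecessor u0 is replaced by an edge at level 0 through the local property. Each condition on
  edges is clopen, so \<open>XL L\<close> is closed in a compact product.\<close>

lemma XL_iff:
  "x \<in> XL L \<longleftrightarrow> x \<in> topspace Y_top
     \<and> (\<forall>i l. \<exists>e\<in>lE L l. lsrc L e = snd (x i) l \<and> ltrg L e = snd (x (Suc i)) (Suc l) \<and> llab L e = fst (x (Suc i)))
     \<and> (\<exists>e\<in>lE L 0. ltrg L e = snd (x 0) 1 \<and> llab L e = fst (x 0))" (is "?l \<longleftrightarrow> ?r")
proof
  assume x: ?l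
  then have E: "(snd (x i), fst (x (Suc i)), snd (x (Suc i))) \<in> EL L" for i
    by (simp add: XL_def)
  have \<Omega>: "snd (x i) \<in> Omega L" for i
    using EL_D(1)[OF E] .
  have lab0: "\<exists>e\<in>lE L 0. ltrg L e = snd (x 0) 1 \<and> llab L e = fst (x 0)"
    using x EL_source_exists_iff[OF \<Omega>[of 0], of "fst (x 0)"] by (simp add: XL_def)
  have "fst (x i) \<in> lSig L" for i
    using lab0 EL_D(3)[OF E[of "i - 1"], of 0] edge_lab by (cases i) fastforce+
  then show ?r
    using \<Omega> lab0 EL_D(3)[OF E] by (simp add: topspace_Y)
next
  assume r: ?r
  then have \<Omega>: "snd (x i) \<in> Omega L" for i
    by (simp add: topspace_Y)
  have "(snd (x i), fst (x (Suc i)), snd (x (Suc i))) \<in> EL L" for i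
    unfolding EL_def mem_Collect_eq prod.case using \<Omega> r by blast
  moreover have "\<exists>u0. (u0, fst (x 0), snd (x 0)) \<in> EL L"
    unfolding EL_source_exists_iff[OF \<Omega>] using r by blast
  ultimately show ?l
    by (simp add: XL_def)
qed

lemma closedin_XL: "closedin Y_top (XL L)"
proof -
  let ?A = "\<lambda>i l. {x \<in> topspace Y_top. \<exists>e\<in>lE L l. lsrc L e = snd (x i) l \<and>
      ltrg L e = snd (x (Suc i)) (Suc l) \<and> llab L e = fst (x (Suc i))}"
  let ?B = "{x \<in> topspace Y_top. \<exists>e\<in>lE L 0. ltrg L e = snd (x 0) 1 \<and> llab L e = fst (x 0)}"
  have "clopenin Y_top (?A i l)" for i l
  proof -
    have "?A i l = (\<Union>e\<in>lE L l. {x \<in> topspace Y_top. snd (x i) l = lsrc L e} \<inter>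
        {x \<in> topspace Y_top. snd (x (Suc i)) (Suc l) = ltrg L e} \<inter> {x \<in> topspace Y_top. fst (x (Suc i)) = llab L e})"
      by auto
    then show ?thesis
      by (simp only:) (intro clopenin_UN finite_E clopenin_Int clopenin_discrete_eq[OF continuous_Y_label]
          clopenin_discrete_eq[OF continuous_Y_vertex])
  qed
  moreover have "clopenin Y_top ?B"
  proof -
    have "?B = (\<Union>e\<in>lE L 0. {x \<in> topspace Y_top. snd (x 0) 1 = ltrg L e} \<inter> {x \<in> topspace Y_top. fst (x 0) = llab L e})"
      by auto
    then show ?thesis
      by (simp only:) (intro clopenin_UN finite_E clopenin_Int clopenin_discrete_eq[OF continuous_Y_label]
          clopenin_discrete_eq[OF continuous_Y_vertex])
  qed
  ultimately have "closedin Y_top ((\<Inter>(i, l)\<in>UNIV. ?A i l) \<inter> ?B)"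
    by (intro closedin_Int closedin_Inter) (auto simp: clopenin_def)
  moreover have "(\<Inter>(i, l)\<in>UNIV. ?A i l) \<inter> ?B = XL L"
    by (rule set_eqI) (simp add: XL_iff, blast)
  ultimately show ?thesis by simp
qed

lemma X_top_Y: "X_top L = subtopology Y_top (XL L)"
  by (simp add: X_top_def Y_top_def)

lemma topspace_X [simp]: "topspace (X_top L) = XL L"
  using XL_iff by (auto simp: X_top_Y)

lemma compact_X: "compact_space (X_top L)"
  unfolding X_top_Y
  by (rule compact_space_subtopology, rule closedin_compact_space[OF _ closedin_XL])
     (simp add: Y_top_def compact_space_product_topology compact_space_prod_topology
        compact_space_discrete_topology finite_Sig compact_Omega)

lemma Hausdorff_X: "Hausdorff_space (X_top L)"
  unfolding X_top_Y
  by (intro Hausdorff_space_subtopology)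
     (simp add: Y_top_def Hausdorff_space_product_topology Hausdorff_space_prod_topology Hausdorff_Omega)

lemma clopen_label: "clopenin (X_top L) {x \<in> XL L. fst (x i) = a}"
  using clopenin_discrete_eq[OF continuous_map_from_subtopology[OF continuous_Y_label], of "XL L" i a]
  by (simp flip: X_top_Y)

lemma clopen_vertex: "clopenin (X_top L) {x \<in> XL L. snd (x i) l = v}"
  using clopenin_discrete_eq[OF continuous_map_from_subtopology[OF continuous_Y_vertex], of "XL L" i l v]
  by (simp flip: X_top_Y)

lemma X_clopen_separated: "clopen_separated (X_top L)"
  unfolding clopen_separated_def
proof (intro ballI impI)
  fix x y assume xy: "x \<in> topspace (X_top L)" "y \<in> topspace (X_top L)" "x \<noteq> y"
  then obtain i where "x i \<noteq> y i" by blast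
  then consider "fst (x i) \<noteq> fst (y i)" | l where "snd (x i) l \<noteq> snd (y i) l"
    by (metis ext prod_eqI)
  then show "\<exists>C. clopenin (X_top L) C \<and> x \<in> C \<and> y \<notin> C"
  proof cases
    case 1
    then show ?thesis
      using clopen_label[of i "fst (x i)"] xy by (intro exI[of _ "{z \<in> XL L. fst (z i) = fst (x i)}"]) auto
  next
    case (2 l)
    then show ?thesis
      using clopen_vertex[of i l "snd (x i) l"] xy by (intro exI[of _ "{z \<in> XL L. snd (z i) l = snd (x i) l}"]) auto
  qed
qed

lemma clopen_nbhd:
  assumes "openin (X_top L) U" "x \<in> U"
  obtains C where "clopenin (X_top L) C" "x \<in> C" "C \<subseteq> U"
  using clopen_neighbourhood[OF compact_X X_clopen_separated assms] .

section \<open>The shift as a local homeomorphism\<close>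

lemma shift_XL: "x \<in> XL L \<Longrightarrow> shift x \<in> XL L"
  by (auto simp: XL_def shift_def)

lemma continuous_shift: "continuous_map (X_top L) (X_top L) shift"
proof -
  have "continuous_map Y_top Y_top shift"
    unfolding Y_top_def shift_def continuous_map_componentwise_UNIV
    by (intro allI continuous_map_product_projection) simp
  then show ?thesis
    unfolding X_top_Y using shift_XL
    by (auto simp: continuous_map_in_subtopology intro: continuous_map_from_subtopology)
qed

lemma shift_inj_on_label: "inj_on shift {x \<in> XL L. fst (x 0) = a}"
proof (rule inj_onI)
  fix x y assume x: "x \<in> {x \<in> XL L. fst (x 0) = a}" and y: "y \<in> {x \<in> XL L. fst (x 0) = a}" and "shift x = shift y"
  then have S: "x (Suc i) = y (Suc i)" for i
    by (simp add: shift_def fun_eq_iff)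
  have "(snd (x 0), fst (x 1), snd (x 1)) \<in> EL L" "(snd (y 0), fst (y 1), snd (y 1)) \<in> EL L"
    using x y by (auto simp: XL_def)
  then have "snd (x 0) = snd (y 0)"
    using S[of 0] EL_source_unique by (metis One_nat_def)
  then have "x 0 = y 0"
    using x y by (simp add: prod_eq_iff)
  then show "x = y"
    using S by (metis ext not0_implies_Suc)
qed

text \<open>The predecessor u of y is determined by y, and whether the label a can be put in front
  of u depends only on its vertex at level 1. A path of two edges at levels 0 and 1 records this;
  the condition involves finitely many coordinates of y, hence is clopen.\<close>

lemma shift_image_label:
  "shift ` {x \<in> XL L. fst (x 0) = a} = {y \<in> XL L. \<exists>e\<in>lE L 0. \<exists>e'\<in>lE L 1. llab L e = a \<and> ltrg L e = lsrc L e' \<and>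
      ltrg L e' = snd (y 0) 2 \<and> llab L e' = fst (y 0)}" (is "?l = ?r")
proof (intro set_eqI iffI)
  fix y assume "y \<in> ?l"
  then obtain x where x: "x \<in> XL L" "fst (x 0) = a" "y = shift x" by blast
  obtain e where "e \<in> lE L 0" "ltrg L e = snd (x 0) 1" "llab L e = a"
    using x XL_iff by blast
  moreover obtain e' where "e' \<in> lE L 1" "lsrc L e' = snd (x 0) 1" "ltrg L e' = snd (x (Suc 0)) (Suc 1)"
      "llab L e' = fst (x (Suc 0))"
    using x XL_iff by blast
  moreover have "y \<in> XL L" "fst (y 0) = fst (x (Suc 0))" "snd (y 0) 2 = snd (x (Suc 0)) (Suc 1)"
    using shift_XL[OF x(1)] by (simp_all add: x(3) shift_def numeral_2_eq_2)
  ultimately show "y \<in> ?r"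
    by (metis (mono_tags, lifting) mem_Collect_eq)
next
  fix y assume "y \<in> ?r"
  then obtain e e' where y: "y \<in> XL L" and e: "e \<in> lE L 0" "llab L e = a" "ltrg L e = lsrc L e'"
    and e': "e' \<in> lE L 1" "ltrg L e' = snd (y 0) 2" "llab L e' = fst (y 0)" by blast
  obtain u where u: "(u, fst (y 0), snd (y 0)) \<in> EL L"
    using y by (auto simp: XL_def)
  obtain f where "f \<in> lE L 1" "lsrc L f = u 1" "ltrg L f = snd (y 0) 2" "llab L f = fst (y 0)"
    using EL_D(3)[OF u, of 1] by (auto simp: numeral_2_eq_2)
  \<comment> \<open>Left-resolving identifies e' with the level 1 edge from the predecessor u, so e
    ends at \<open>u 1\<close>.\<close>
  then have "lsrc L e' = u 1"
    using edge_unique e' by metis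
  then obtain u0 where u0: "(u0, a, u) \<in> EL L"
    using EL_source_exists_iff[OF EL_D(1)[OF u], of a] e by auto
  define x where "x = (\<lambda>i. case i of 0 \<Rightarrow> (a, u) | Suc j \<Rightarrow> y j)"
  have "x \<in> XL L"
    using y u u0 by (auto simp: XL_def x_def split: nat.split)
  moreover have "y = shift x" "fst (x 0) = a"
    by (auto simp: shift_def x_def)
  ultimately show "y \<in> ?l" by blast
qed

lemma clopen_shift_image_label: "clopenin (X_top L) (shift ` {x \<in> XL L. fst (x 0) = a})"
proof -
  have "shift ` {x \<in> XL L. fst (x 0) = a} = (\<Union>e\<in>{e \<in> lE L 0. llab L e = a}. \<Union>e'\<in>{e'\<in>lE L 1. ltrg L e = lsrc L e'}.
      {y \<in> XL L. snd (y 0) 2 = ltrg L e'} \<inter> {y \<in> XL L. fst (y 0) = llab L e'})"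
    unfolding shift_image_label by (rule set_eqI) (simp, metis)
  then show ?thesis
    by (simp only:) (intro clopenin_UN clopenin_Int clopen_label clopen_vertex; simp add: finite_E)
qed

text \<open>On a label cylinder the shift is injective and, by compactness, closed; so the image of
  an open part is the clopen image of the cylinder minus a closed set. The cylinders cover
  U.\<close>

lemma openin_shift_image:
  assumes U: "openin (X_top L) U"
  shows "openin (X_top L) (shift ` U)"
proof -
  let ?C = "\<lambda>a. {x \<in> XL L. fst (x 0) = a}"
  have "openin (X_top L) (shift ` (?C a \<inter> U))" for a
  proof -
    have "closedin (X_top L) (?C a - U)"
      using clopen_label[of 0 a] U by (auto simp: clopenin_def closedin_diff)
    then have "closedin (X_top L) (shift ` (?C a - U))"
      using continuous_imp_closed_map[OF continuous_shift compact_X Hausdorff_X]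
      by (simp add: closed_map_def)
    moreover have "shift ` (?C a \<inter> U) = shift ` ?C a - shift ` (?C a - U)"
      using inj_on_image_set_diff[OF shift_inj_on_label[of a], of "?C a" "?C a - U"] by (auto simp: Diff_Diff_Int)
    ultimately show ?thesis
      using clopen_shift_image_label[of a] by (simp add: clopenin_def openin_diff)
  qed
  moreover have "shift ` U = (\<Union>a. shift ` (?C a \<inter> U))"
    using openin_subset[OF U] by auto
  ultimately show ?thesis
    by (simp only:) (intro openin_Union, auto)
qed

lemma shifts_XL: "x \<in> XL L \<Longrightarrow> shifts k x \<in> XL L"
  by (induction k) (simp_all add: shifts_def shift_XL)

lemma continuous_shifts: "continuous_map (X_top L) (X_top L) (shifts k)"
proof (induction k)
  case 0
  then show ?case by (simp add: shifts_def)
next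
  case (Suc k)
  then show ?case
    using continuous_map_compose[OF Suc continuous_shift] by (simp add: shifts_def comp_def)
qed

lemma openin_shifts_image: "openin (X_top L) U \<Longrightarrow> openin (X_top L) (shifts k ` U)"
proof (induction k)
  case (Suc k)
  then show ?case
    using openin_shift_image[of "shifts k ` U"] by (simp add: shifts_def image_image)
qed (simp add: shifts_def)

lemma shifts_locally_inj:
  assumes "x \<in> XL L"
  obtains C where "clopenin (X_top L) C" "x \<in> C" "inj_on (shifts k) C"
proof -
  have "\<exists>C. clopenin (X_top L) C \<and> x \<in> C \<and> inj_on (shifts k) C"
  proof (induction k)
    case 0
    then show ?case using assms clopenin_topspace[of "X_top L"] by (intro exI[of _ "XL L"]) (auto simp: shifts_def inj_on_def)
  next
    case (Suc k)
    then obtain C where C: "clopenin (X_top L) C" "x \<in> C" "inj_on (shifts k) C" by blast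
    let ?D = "{y \<in> XL L. fst (y 0) = fst (shifts k x 0)}"
    let ?C' = "C \<inter> {y \<in> topspace (X_top L). shifts k y \<in> ?D}"
    have "clopenin (X_top L) ?C'"
      by (intro clopenin_Int C clopenin_preimage[OF continuous_shifts] clopen_label)
    moreover have "inj_on (shifts (Suc k)) ?C'"
    proof -
      have "inj_on (shift \<circ> shifts k) ?C'"
        by (rule comp_inj_on) (auto intro: inj_on_subset[OF C(3)] inj_on_subset[OF shift_inj_on_label])
      then show ?thesis by (simp add: shifts_def)
    qed
    moreover have "x \<in> ?C'"
      using C(2) assms shifts_XL by auto
    ultimately show ?case by blast
  qed
  then show ?thesis using that by blast
qed

end

lemma shifts_add: "shifts (k + l) x = shifts k (shifts l x)"
  by (simp add: shifts_def funpow_add)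

lemma shifts_0 [simp]: "shifts 0 x = x"
  by (simp add: shifts_def)

section \<open>The groupoid topology\<close>

abbreviation rg :: "('v, 'a) gel \<Rightarrow> (nat \<Rightarrow> 'a \<times> (nat \<Rightarrow> 'v))" where "rg g \<equiv> fst g"
abbreviation dg :: "('v, 'a) gel \<Rightarrow> int" where "dg g \<equiv> fst (snd g)"
abbreviation sc :: "('v, 'a) gel \<Rightarrow> (nat \<Rightarrow> 'a \<times> (nat \<Rightarrow> 'v))" where "sc g \<equiv> snd (snd g)"

definition gunit :: "(nat \<Rightarrow> 'a \<times> (nat \<Rightarrow> 'v)) \<Rightarrow> ('v, 'a) gel" where
  "gunit x = (x, 0, x)"

definition ginv :: "('v, 'a) gel \<Rightarrow> ('v, 'a) gel" where
  "ginv g = (sc g, - dg g, rg g)"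

text \<open>\<open>gquot g b\<close> is the product of \<open>g\<close> with the inverse of \<open>b\<close>; it is meaningful for \<open>sc g = sc b\<close>.\<close>
definition gquot :: "('v, 'a) gel \<Rightarrow> ('v, 'a) gel \<Rightarrow> ('v, 'a) gel" where
  "gquot g b = (rg g, dg g - dg b, rg b)"

lemma GL_iff: "(x, n, z) \<in> GL L \<longleftrightarrow> x \<in> XL L \<and> z \<in> XL L \<and> (\<exists>k l. shifts k x = shifts l z \<and> n = int k - int l)"
  by (simp add: GL_def)

lemma GL_iff': "g \<in> GL L \<longleftrightarrow> rg g \<in> XL L \<and> sc g \<in> XL L \<and> (\<exists>k l. shifts k (rg g) = shifts l (sc g) \<and> dg g = int k - int l)"
  by (cases g) (simp add: GL_iff)

lemma GL_rg: "g \<in> GL L \<Longrightarrow> rg g \<in> XL L" and GL_sc: "g \<in> GL L \<Longrightarrow> sc g \<in> XL L"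
  by (simp_all add: GL_iff')

lemma GL_unit [simp]: "gunit x \<in> GL L \<longleftrightarrow> x \<in> XL L"
  by (auto simp: gunit_def GL_iff intro: exI[of _ 0])

lemma GL_inv [simp]: "ginv g \<in> GL L \<longleftrightarrow> g \<in> GL L"
proof -
  have "ginv g \<in> GL L" if g: "g \<in> GL L" for g
  proof -
    obtain k l where "shifts k (rg g) = shifts l (sc g)" "dg g = int k - int l"
      using g by (auto simp: GL_iff')
    then show ?thesis
      using GL_rg[OF g] GL_sc[OF g] unfolding ginv_def GL_iff
      by (intro conjI exI[of _ l] exI[of _ k]) auto
  qed
  from this[of g] this[of "ginv g"] show ?thesis
    by (auto simp: ginv_def)
qed

lemma ginv_inv [simp]: "ginv (ginv g) = g"
  by (simp add: ginv_def)

lemma ginv_simps [simp]: "rg (ginv g) = sc g" "sc (ginv g) = rg g" "dg (ginv g) = - dg g"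
  by (simp_all add: ginv_def)

lemma GL_mult:
  assumes "g \<in> GL L" "h \<in> GL L" "sc g = rg h"
  shows "gmult g h \<in> GL L"
proof -
  obtain k l where kl: "shifts k (rg g) = shifts l (sc g)" "dg g = int k - int l"
    using assms(1) by (auto simp: GL_iff')
  obtain p q where pq: "shifts p (rg h) = shifts q (sc h)" "dg h = int p - int q"
    using assms(2) by (auto simp: GL_iff')
  \<comment> \<open>Both sides equal \<open>shifts (p + l)\<close> applied to the common point
    \<open>sc g\<close>.\<close>
  have "shifts (p + k) (rg g) = shifts (l + q) (sc h)"
    using kl pq assms(3) by (metis add.commute shifts_add)
  then show ?thesis
    using kl pq GL_rg[OF assms(1)] GL_sc[OF assms(2)] unfolding gmult_def GL_iff
    by (intro conjI exI[of _ "p + k"] exI[of _ "l + q"]) auto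
qed

lemma gquot_eq: "gquot g b = gmult g (ginv b)"
  by (simp add: gquot_def gmult_def ginv_def)

lemma GL_quot: "g \<in> GL L \<Longrightarrow> b \<in> GL L \<Longrightarrow> sc g = sc b \<Longrightarrow> gquot g b \<in> GL L"
  unfolding gquot_eq by (rule GL_mult) simp_all

section \<open>Compact open bisections\<close>

definition bis :: "('v, 'e, 'a) lgs \<Rightarrow> (nat \<Rightarrow> 'a \<times> (nat \<Rightarrow> 'v)) set \<Rightarrow> nat \<Rightarrow> nat
     \<Rightarrow> (nat \<Rightarrow> 'a \<times> (nat \<Rightarrow> 'v)) set \<Rightarrow> bool" where
  "bis L U k l V \<longleftrightarrow> clopenin (X_top L) U \<and> clopenin (X_top L) V \<and>
     inj_on (shifts k) U \<and> inj_on (shifts l) V \<and> shifts k ` U = shifts l ` V"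

text \<open>With \<open>bis\<close> data both shift powers are injective and have the same image, so
  \<open>Zset U k l V\<close> is the graph of this bijection from U to V, carrying a constant
  degree.\<close>

definition partner :: "nat \<Rightarrow> nat \<Rightarrow> (nat \<Rightarrow> 'b) set \<Rightarrow> (nat \<Rightarrow> 'b) \<Rightarrow> (nat \<Rightarrow> 'b)" where
  "partner k l V x = inv_into V (shifts l) (shifts k x)"

lemma bis_sym: "bis L U k l V \<Longrightarrow> bis L V l k U"
  by (auto simp: bis_def)

lemma
  assumes "bis L U k l V" "x \<in> U"
  shows partner_in: "partner k l V x \<in> V" and shifts_partner: "shifts l (partner k l V x) = shifts k x"
proof -
  have "shifts k x \<in> shifts l ` V"
    using assms by (auto simp: bis_def)
  then show "partner k l V x \<in> V" "shifts l (partner k l V x) = shifts k x"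
    unfolding partner_def by (simp_all add: inv_into_into f_inv_into_f)
qed

lemma partner_eqI:
  assumes "bis L U k l V" "z \<in> V" "shifts l z = shifts k x"
  shows "partner k l V x = z"
proof -
  have "inv_into V (shifts l) (shifts l z) = z"
    by (rule inv_into_f_f) (use assms in \<open>auto simp: bis_def\<close>)
  then show ?thesis
    using assms(3) by (simp add: partner_def)
qed

lemma partner_partner:
  assumes "bis L U k l V" "x \<in> U"
  shows "partner l k U (partner k l V x) = x"
  using partner_eqI[OF bis_sym[OF assms(1)] assms(2)] shifts_partner[OF assms] by simp

lemma Zset_iff:
  "g \<in> Zset U k l V \<longleftrightarrow> rg g \<in> U \<and> sc g \<in> V \<and> dg g = int k - int l \<and> shifts k (rg g) = shifts l (sc g)"
  by (cases g) (auto simp: Zset_def)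

lemma Zset_bis_iff:
  assumes "bis L U k l V"
  shows "g \<in> Zset U k l V \<longleftrightarrow> rg g \<in> U \<and> dg g = int k - int l \<and> sc g = partner k l V (rg g)"
  using partner_in[OF assms] shifts_partner[OF assms] partner_eqI[OF assms] unfolding Zset_iff by metis

lemma bis_subset: "bis L U k l V \<Longrightarrow> U \<subseteq> topspace (X_top L)"
  by (auto simp: bis_def dest: clopenin_subset)

context lgsys begin

lemma bis_subset_XL: "bis L U k l V \<Longrightarrow> U \<subseteq> XL L" "bis L U k l V \<Longrightarrow> V \<subseteq> XL L"
  using bis_subset bis_sym topspace_X by blast+

lemma Zset_subset_GL: "U \<subseteq> XL L \<Longrightarrow> V \<subseteq> XL L \<Longrightarrow> Zset U k l V \<subseteq> GL L"
  by (auto simp: Zset_def GL_def)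

text \<open>Two representations of the same element by exponents \<open>(k, l)\<close> and \<open>(k', l')\<close> agree nearby, because
  the powers of the shift are locally injective.\<close>
lemma local_exponent_change:
  assumes "x0 \<in> XL L" "z0 \<in> XL L" "shifts k' x0 = shifts l' z0" "int k - int l = int k' - int l'"
  obtains U V where "openin (X_top L) U" "openin (X_top L) V" "x0 \<in> U" "z0 \<in> V"
    "\<And>x z. x \<in> U \<Longrightarrow> z \<in> V \<Longrightarrow> shifts k x = shifts l z \<Longrightarrow> shifts k' x = shifts l' z"
proof (cases "k \<le> k'")
  case True
  define d where "d = k' - k"
  have d: "k' = d + k" "l' = d + l"
    using assms(4) True by (auto simp: d_def)
  show ?thesis
    by (rule that[of "XL L" "XL L"])
       (use assms openin_topspace[of "X_top L"] in \<open>auto simp: d shifts_add\<close>)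
next
  case False
  define d where "d = k - k'"
  have d: "k = d + k'" "l = d + l'"
    using assms(4) False by (auto simp: d_def)
  obtain C where C: "clopenin (X_top L) C" "shifts k' x0 \<in> C" "inj_on (shifts d) C"
    using shifts_locally_inj[OF shifts_XL[OF assms(1)]] by blast
  show ?thesis
  proof (rule that[of "{x \<in> topspace (X_top L). shifts k' x \<in> C}" "{z \<in> topspace (X_top L). shifts l' z \<in> C}"])
    show "openin (X_top L) {x \<in> topspace (X_top L). shifts k' x \<in> C}"
      "openin (X_top L) {x \<in> topspace (X_top L). shifts l' x \<in> C}"
      using C(1) by (auto simp: clopenin_def simp del: topspace_X intro!: openin_continuous_map_preimage[OF continuous_shifts])
    fix x z assume "x \<in> {x \<in> topspace (X_top L). shifts k' x \<in> C}" "z \<in> {z \<in> topspace (X_top L). shifts l' z \<in> C}"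
      "shifts k x = shifts l z"
    then show "shifts k' x = shifts l' z"
      using C(3) by (auto simp: d shifts_add dest: inj_onD)
  qed (use assms C in auto)
qed

lemma small_bis:
  assumes "openin (X_top L) U0" "openin (X_top L) V0" "x0 \<in> U0" "z0 \<in> V0" "shifts k x0 = shifts l z0"
  obtains U V where "bis L U k l V" "x0 \<in> U" "z0 \<in> V" "U \<subseteq> U0" "V \<subseteq> V0"
proof -
  have x0: "x0 \<in> XL L" and z0: "z0 \<in> XL L"
    using assms openin_subset topspace_X by blast+
  obtain C where C: "clopenin (X_top L) C" "x0 \<in> C" "inj_on (shifts k) C"
    using shifts_locally_inj[OF x0] .
  obtain D where D: "clopenin (X_top L) D" "z0 \<in> D" "inj_on (shifts l) D"
    using shifts_locally_inj[OF z0] .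
  obtain C' where C': "clopenin (X_top L) C'" "x0 \<in> C'" "C' \<subseteq> U0"
    using clopen_nbhd[OF assms(1,3)] .
  obtain D' where D': "clopenin (X_top L) D'" "z0 \<in> D'" "D' \<subseteq> V0"
    using clopen_nbhd[OF assms(2,4)] .
  have clop: "clopenin (X_top L) (shifts j ` S)" if "clopenin (X_top L) S" for S j
    using that openin_shifts_image[of S j] continuous_imp_closed_map[OF continuous_shifts[of j] compact_X Hausdorff_X]
    by (auto simp: clopenin_def closed_map_def)
  \<comment> \<open>Cutting the two domains down to the preimages of this common part of the images
    forces their images to coincide.\<close>
  define W where "W = shifts k ` (C \<inter> C') \<inter> shifts l ` (D \<inter> D')"
  define U where "U = (C \<inter> C') \<inter> {x \<in> topspace (X_top L). shifts k x \<in> W}"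
  define V where "V = (D \<inter> D') \<inter> {x \<in> topspace (X_top L). shifts l x \<in> W}"
  have W: "clopenin (X_top L) W"
    unfolding W_def by (intro clopenin_Int clop C C' D D')
  have top: "C \<subseteq> topspace (X_top L)" "D \<subseteq> topspace (X_top L)"
    using C(1) D(1) by (simp_all only: clopenin_subset)
  have "clopenin (X_top L) U" "clopenin (X_top L) V"
    unfolding U_def V_def by (intro clopenin_Int C C' D D' clopenin_preimage[OF continuous_shifts W])+
  moreover have "shifts k ` U = W"
  proof
    show "W \<subseteq> shifts k ` U"
    proof
      fix y assume y: "y \<in> W"
      then obtain x where "x \<in> C \<inter> C'" "y = shifts k x" by (auto simp: W_def)
      then show "y \<in> shifts k ` U"
        using y top unfolding U_def by blast
    qed
  qed (auto simp: U_def)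
  moreover have "shifts l ` V = W"
  proof
    show "W \<subseteq> shifts l ` V"
    proof
      fix y assume y: "y \<in> W"
      then obtain x where "x \<in> D \<inter> D'" "y = shifts l x" by (auto simp: W_def)
      then show "y \<in> shifts l ` V"
        using y top unfolding V_def by blast
    qed
  qed (auto simp: V_def)
  ultimately have "bis L U k l V"
    using C(3) D(3) by (auto simp: bis_def U_def V_def intro: inj_on_subset)
  moreover have "shifts k x0 \<in> W"
    unfolding W_def using C(2) C'(2) D(2) D'(2) assms(5) by (metis IntI imageI)
  then have "x0 \<in> U" "z0 \<in> V"
    using C(2) C'(2) D(2) D'(2) assms(5) x0 z0 by (auto simp: U_def V_def)
  ultimately show ?thesis
    using that C'(3) D'(3) by (auto simp: U_def V_def)
qed

lemma homeomorphic_shifts: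
  assumes "clopenin (X_top L) U" "inj_on (shifts k) U"
  shows "homeomorphic_map (subtopology (X_top L) U) (subtopology (X_top L) (shifts k ` U)) (shifts k)"
proof (rule bijective_open_imp_homeomorphic_map)
  have sub: "U \<subseteq> XL L"
    using clopenin_subset[OF assms(1)] by simp
  have top: "topspace (subtopology (X_top L) U) = U" "topspace (subtopology (X_top L) (shifts k ` U)) = shifts k ` U"
    using sub shifts_XL by auto
  show "continuous_map (subtopology (X_top L) U) (subtopology (X_top L) (shifts k ` U)) (shifts k)"
    using top by (simp add: continuous_map_in_subtopology continuous_map_from_subtopology continuous_shifts)
  show "open_map (subtopology (X_top L) U) (subtopology (X_top L) (shifts k ` U)) (shifts k)"
    unfolding open_map_def
  proof (intro allI impI)
    fix S assume "openin (subtopology (X_top L) U) S"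
    then have "openin (X_top L) S" "S \<subseteq> U"
      using assms(1) by (auto simp: clopenin_def openin_open_subtopology)
    then show "openin (subtopology (X_top L) (shifts k ` U)) (shifts k ` S)"
      using openin_shifts_image[of S k] by (intro subset_openin_subtopology) auto
  qed
  show "shifts k ` topspace (subtopology (X_top L) U) = topspace (subtopology (X_top L) (shifts k ` U))"
    using top by simp
  show "inj_on (shifts k) (topspace (subtopology (X_top L) U))"
    using top assms(2) by simp
qed

lemma bis_Zadm:
  assumes "bis L U k l V"
  shows "Zadm L U k l V"
proof -
  have b: "clopenin (X_top L) U" "clopenin (X_top L) V" "inj_on (shifts k) U" "inj_on (shifts l) V" "shifts k ` U = shifts l ` V"
    using assms by (auto simp: bis_def)
  have "openin (X_top L) (shifts k ` U)"
    using b(1) by (intro openin_shifts_image) (simp add: clopenin_def)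
  then show ?thesis
    unfolding Zadm_def using b homeomorphic_shifts[OF b(1,3)] homeomorphic_shifts[OF b(2,4)]
    by (auto simp: clopenin_def)
qed

text \<open>The point comes with a fixed pair of exponents, so the neighbourhoods found for
  different open sets use the same pair and can be intersected. Basis sets with other exponents are
  handled by \<open>local_exponent_change\<close>.\<close>

lemma openin_G_imp:
  assumes "openin (G_top L) O'" "(x0, int k - int l, z0) \<in> O'" "shifts k x0 = shifts l z0"
  shows "\<exists>U V. openin (X_top L) U \<and> openin (X_top L) V \<and> x0 \<in> U \<and> z0 \<in> V \<and> Zset U k l V \<subseteq> O'"
proof -
  have "generate_topology_on {Zset U k l V | U k l V. Zadm L U k l V} O'"
    using assms(1) unfolding G_top_def by (rule openin_topology_generated_by)
  then show ?thesis
    using assms(2)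
  proof induction
    case (Int A B)
    then obtain U V U' V' where *: "openin (X_top L) U" "openin (X_top L) V" "x0 \<in> U" "z0 \<in> V" "Zset U k l V \<subseteq> A"
      "openin (X_top L) U'" "openin (X_top L) V'" "x0 \<in> U'" "z0 \<in> V'" "Zset U' k l V' \<subseteq> B"
      by auto
    show ?case
      by (rule exI[of _ "U \<inter> U'"], rule exI[of _ "V \<inter> V'"])
         (use * in \<open>fastforce simp: openin_Int Zset_def\<close>)
  next
    case (UN K)
    then obtain A where "A \<in> K" "(x0, int k - int l, z0) \<in> A" by blast
    with UN.IH[of A] show ?case by blast
  next
    case (Basis S)
    then obtain U' k' l' V' where S: "S = Zset U' k' l' V'" "Zadm L U' k' l' V'" by blast
    have *: "x0 \<in> U'" "z0 \<in> V'" "int k - int l = int k' - int l'" "shifts k' x0 = shifts l' z0"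
      using Basis.prems unfolding S Zset_iff by auto
    have o: "openin (X_top L) U'" "openin (X_top L) V'"
      using S(2) by (auto simp: Zadm_def)
    have "x0 \<in> XL L" "z0 \<in> XL L"
      using o * openin_subset topspace_X by blast+
    then obtain U V where UV: "openin (X_top L) U" "openin (X_top L) V" "x0 \<in> U" "z0 \<in> V"
      "\<And>x z. x \<in> U \<Longrightarrow> z \<in> V \<Longrightarrow> shifts k x = shifts l z \<Longrightarrow> shifts k' x = shifts l' z"
      using local_exponent_change[OF _ _ *(4,3)] by metis
    have "Zset (U \<inter> U') k l (V \<inter> V') \<subseteq> S"
      unfolding S using UV(5) *(3) by (auto simp: Zset_def)
    then show ?case
      using UV o * by (intro exI[of _ "U \<inter> U'"] exI[of _ "V \<inter> V'"]) (auto simp: openin_Int)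
  qed auto
qed

text \<open>Arbitrary open U0 and V0 are allowed here: around each of its points the set contains a
  bisection of \<open>bis\<close> type, which is admissible.\<close>

lemma openin_Zset:
  assumes "openin (X_top L) U0" "openin (X_top L) V0"
  shows "openin (G_top L) (Zset U0 k l V0)"
proof (subst openin_subopen, intro ballI)
  fix g assume "g \<in> Zset U0 k l V0"
  then obtain x z where g: "g = (x, int k - int l, z)" "x \<in> U0" "z \<in> V0" "shifts k x = shifts l z"
    by (auto simp: Zset_def)
  obtain U V where UV: "bis L U k l V" "x \<in> U" "z \<in> V" "U \<subseteq> U0" "V \<subseteq> V0"
    using small_bis[OF assms g(2-4)] .
  have "openin (G_top L) (Zset U k l V)"
    unfolding G_top_def using bis_Zadm[OF UV(1)] by (intro topology_generated_by_Basis) blast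
  moreover have "g \<in> Zset U k l V" "Zset U k l V \<subseteq> Zset U0 k l V0"
    using g UV by (auto simp: Zset_def)
  ultimately show "\<exists>T. openin (G_top L) T \<and> g \<in> T \<and> T \<subseteq> Zset U0 k l V0"
    by blast
qed

lemma openin_GI:
  assumes "\<And>x k l z. shifts k x = shifts l z \<Longrightarrow> (x, int k - int l, z) \<in> O' \<Longrightarrow>
      \<exists>U V. openin (X_top L) U \<and> openin (X_top L) V \<and> x \<in> U \<and> z \<in> V \<and> Zset U k l V \<subseteq> O'"
    and "O' \<subseteq> GL L"
  shows "openin (G_top L) O'"
proof (subst openin_subopen, intro ballI)
  fix g assume g: "g \<in> O'"
  then obtain x k l z where "g = (x, int k - int l, z)" "shifts k x = shifts l z"
    using subsetD[OF assms(2) g] by (cases g) (auto simp: GL_iff)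
  then obtain U V where "openin (X_top L) U" "openin (X_top L) V" "g \<in> Zset U k l V" "Zset U k l V \<subseteq> O'"
    using assms(1)[of k x l z] g by (auto simp: Zset_def)
  then show "\<exists>T. openin (G_top L) T \<and> g \<in> T \<and> T \<subseteq> O'"
    by (intro exI[of _ "Zset U k l V"] conjI openin_Zset)
qed

lemma topspace_G [simp]: "topspace (G_top L) = GL L"
proof
  have "Zset U k l V \<subseteq> GL L" if "Zadm L U k l V" for U k l V
    using that openin_subset[of "X_top L"] by (intro Zset_subset_GL) (auto simp: Zadm_def)
  then show "topspace (G_top L) \<subseteq> GL L"
    unfolding G_top_def topology_generated_by_topspace by blast
  have "openin (G_top L) (GL L)"
  proof (rule openin_GI)
    fix x k l z assume "(x, int k - int l, z) \<in> GL L"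
    then show "\<exists>U V. openin (X_top L) U \<and> openin (X_top L) V \<and> x \<in> U \<and> z \<in> V \<and> Zset U k l V \<subseteq> GL L"
      using openin_topspace[of "X_top L"] Zset_subset_GL[of "XL L" "XL L"]
      by (intro exI[of _ "XL L"]) (auto simp: GL_iff)
  qed simp
  then show "GL L \<subseteq> topspace (G_top L)"
    by (rule openin_subset)
qed

lemma openin_G_bis:
  assumes "openin (G_top L) O'" "g \<in> O'"
  obtains U k l V where "bis L U k l V" "g \<in> Zset U k l V" "Zset U k l V \<subseteq> O'"
proof -
  have "g \<in> GL L"
    using assms openin_subset topspace_G by blast
  then obtain x k l z where g: "g = (x, int k - int l, z)" "shifts k x = shifts l z"
    by (cases g) (auto simp: GL_iff)
  then obtain U0 V0 where *: "openin (X_top L) U0" "openin (X_top L) V0" "x \<in> U0" "z \<in> V0" "Zset U0 k l V0 \<subseteq> O'"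
    using openin_G_imp[OF assms(1), of x k l z] assms(2) by auto
  obtain U V where UV: "bis L U k l V" "x \<in> U" "z \<in> V" "U \<subseteq> U0" "V \<subseteq> V0"
    using small_bis[OF *(1-4) g(2)] .
  have "g \<in> Zset U k l V" "Zset U k l V \<subseteq> Zset U0 k l V0"
    using g UV by (auto simp: Zset_def)
  with *(5) that[OF UV(1)] show ?thesis
    by (meson order_trans)
qed

lemma bis_open: "bis L U k l V \<Longrightarrow> openin (X_top L) U" "bis L U k l V \<Longrightarrow> openin (X_top L) V"
  by (auto simp: bis_def clopenin_def)

lemma openin_Zset_bis: "bis L U k l V \<Longrightarrow> openin (G_top L) (Zset U k l V)"
  by (intro openin_Zset bis_open)

lemma Zset_bis_subset: "bis L U k l V \<Longrightarrow> Zset U k l V \<subseteq> GL L"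
  by (intro Zset_subset_GL bis_subset_XL)

lemma openin_G_rg:
  assumes "openin (X_top L) U"
  shows "openin (G_top L) {g \<in> GL L. rg g \<in> U}"
proof (rule openin_GI)
  fix x k l z assume "shifts k x = shifts l z" "(x, int k - int l, z) \<in> {g \<in> GL L. rg g \<in> U}"
  then show "\<exists>U' V. openin (X_top L) U' \<and> openin (X_top L) V \<and> x \<in> U' \<and> z \<in> V \<and> Zset U' k l V \<subseteq> {g \<in> GL L. rg g \<in> U}"
    using assms openin_topspace[of "X_top L"] Zset_subset_GL[of U "XL L"] openin_subset[OF assms]
    by (intro exI[of _ U] exI[of _ "XL L"]) (auto simp: GL_iff Zset_iff)
qed auto

lemma openin_G_sc:
  assumes "openin (X_top L) U"
  shows "openin (G_top L) {g \<in> GL L. sc g \<in> U}"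
proof (rule openin_GI)
  fix x k l z assume "shifts k x = shifts l z" "(x, int k - int l, z) \<in> {g \<in> GL L. sc g \<in> U}"
  then show "\<exists>U' V. openin (X_top L) U' \<and> openin (X_top L) V \<and> x \<in> U' \<and> z \<in> V \<and> Zset U' k l V \<subseteq> {g \<in> GL L. sc g \<in> U}"
    using assms openin_topspace[of "X_top L"] Zset_subset_GL[of "XL L" U] openin_subset[OF assms]
    by (intro exI[of _ "XL L"] exI[of _ U]) (auto simp: GL_iff Zset_iff)
qed auto

lemma continuous_rg: "continuous_map (G_top L) (X_top L) (\<lambda>g. rg g)"
  unfolding continuous_map using openin_G_rg GL_rg by auto

lemma continuous_sc: "continuous_map (G_top L) (X_top L) (\<lambda>g. sc g)"
  unfolding continuous_map using openin_G_sc GL_sc by auto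

lemma continuous_dg: "continuous_map (G_top L) (discrete_topology UNIV) (\<lambda>g. dg g)"
proof -
  have "openin (G_top L) {g \<in> GL L. dg g \<in> N}" for N
  proof (rule openin_GI)
    fix x k l z assume "shifts k x = shifts l z" "(x, int k - int l, z) \<in> {g \<in> GL L. dg g \<in> N}"
    then show "\<exists>U' V. openin (X_top L) U' \<and> openin (X_top L) V \<and> x \<in> U' \<and> z \<in> V \<and> Zset U' k l V \<subseteq> {g \<in> GL L. dg g \<in> N}"
      using openin_topspace[of "X_top L"] Zset_subset_GL[of "XL L" "XL L"]
      by (intro exI[of _ "XL L"]) (auto simp: GL_iff Zset_iff)
  qed auto
  then show ?thesis
    unfolding continuous_map by auto
qed

lemma clopenin_rg: "clopenin (X_top L) U \<Longrightarrow> clopenin (G_top L) {g \<in> GL L. rg g \<in> U}"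
  using clopenin_preimage[OF continuous_rg] by simp

lemma clopenin_Zset:
  assumes "clopenin (X_top L) U" "clopenin (X_top L) V"
  shows "clopenin (G_top L) (Zset U k l V)"
proof -
  \<comment> \<open>Clopen separation of the two shifted points makes the inequality an open
    condition; the other conditions that define \<open>Zset\<close> are clopen.\<close>
  have "openin (G_top L) {g \<in> GL L. shifts k (rg g) \<noteq> shifts l (sc g)}"
  proof (subst openin_subopen, intro ballI)
    fix g assume g: "g \<in> {g \<in> GL L. shifts k (rg g) \<noteq> shifts l (sc g)}"
    then obtain C where C: "clopenin (X_top L) C" "shifts k (rg g) \<in> C" "shifts l (sc g) \<notin> C"
      using X_clopen_separated shifts_XL[OF GL_rg] shifts_XL[OF GL_sc] unfolding clopen_separated_def
      by (metis (mono_tags, lifting) mem_Collect_eq topspace_X)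
    let ?T = "{g \<in> topspace (G_top L). (shifts k \<circ> (\<lambda>g. rg g)) g \<in> C} \<inter>
        (topspace (G_top L) - {g \<in> topspace (G_top L). (shifts l \<circ> (\<lambda>g. sc g)) g \<in> C})"
    have "clopenin (G_top L) ?T"
      by (intro clopenin_Int clopenin_Diff clopenin_topspace clopenin_preimage[OF _ C(1)]
          continuous_map_compose[OF continuous_rg] continuous_map_compose[OF continuous_sc] continuous_shifts)
    moreover have "g \<in> ?T" "?T \<subseteq> {g \<in> GL L. shifts k (rg g) \<noteq> shifts l (sc g)}"
      using g C by auto
    ultimately show "\<exists>T. openin (G_top L) T \<and> g \<in> T \<and> T \<subseteq> {g \<in> GL L. shifts k (rg g) \<noteq> shifts l (sc g)}"
      unfolding clopenin_def by blast
  qed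
  then have "closedin (G_top L) (topspace (G_top L) - {g \<in> GL L. shifts k (rg g) \<noteq> shifts l (sc g)})"
    by blast
  then have "closedin (G_top L) ((topspace (G_top L) - {g \<in> GL L. shifts k (rg g) \<noteq> shifts l (sc g)})
      \<inter> {g \<in> topspace (G_top L). rg g \<in> U} \<inter> {g \<in> topspace (G_top L). sc g \<in> V} \<inter> {g \<in> topspace (G_top L). dg g = int k - int l})"
    using clopenin_preimage[OF continuous_rg assms(1)] clopenin_preimage[OF continuous_sc assms(2)]
      clopenin_discrete_eq[OF continuous_dg, of "int k - int l"]
    by (intro closedin_Int) (auto simp: clopenin_def)
  moreover have "(topspace (G_top L) - {g \<in> GL L. shifts k (rg g) \<noteq> shifts l (sc g)})
      \<inter> {g \<in> topspace (G_top L). rg g \<in> U} \<inter> {g \<in> topspace (G_top L). sc g \<in> V} \<inter> {g \<in> topspace (G_top L). dg g = int k - int l}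
      = Zset U k l V"
    using Zset_subset_GL[of U V k l] clopenin_subset[OF assms(1)] clopenin_subset[OF assms(2)]
    by (auto simp: Zset_iff subset_iff)
  ultimately show ?thesis
    using openin_Zset[of U V k l] assms by (simp add: clopenin_def)
qed

lemma clopenin_Zset_bis: "bis L U k l V \<Longrightarrow> clopenin (G_top L) (Zset U k l V)"
  by (intro clopenin_Zset) (auto simp: bis_def)

text \<open>On U the map \<open>partner k l V\<close> is continuous, being a continuous power of the
  shift followed by the inverse of an open map that is injective on V.\<close>

lemma openin_partner_preimage:
  assumes "bis L U k l V" "openin (X_top L) V0"
  shows "openin (X_top L) {x \<in> U. partner k l V x \<in> V0}"
proof -
  have "{x \<in> U. partner k l V x \<in> V0} = U \<inter> {x \<in> topspace (X_top L). shifts k x \<in> shifts l ` (V \<inter> V0)}"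
  proof (intro set_eqI iffI)
    fix x assume x: "x \<in> {x \<in> U. partner k l V x \<in> V0}"
    have "shifts k x = shifts l (partner k l V x)" "partner k l V x \<in> V"
      using shifts_partner[OF assms(1)] partner_in[OF assms(1)] x by auto
    then have "shifts k x \<in> shifts l ` (V \<inter> V0)"
      using x by blast
    then show "x \<in> U \<inter> {x \<in> topspace (X_top L). shifts k x \<in> shifts l ` (V \<inter> V0)}"
      using x bis_subset[OF assms(1)] by blast
  next
    fix x assume x: "x \<in> U \<inter> {x \<in> topspace (X_top L). shifts k x \<in> shifts l ` (V \<inter> V0)}"
    then obtain z where "z \<in> V" "z \<in> V0" "shifts k x = shifts l z" by blast
    then show "x \<in> {x \<in> U. partner k l V x \<in> V0}"
      using partner_eqI[OF assms(1), of z x] x by simp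
  qed
  moreover have "openin (X_top L) (shifts l ` (V \<inter> V0))"
    by (intro openin_shifts_image openin_Int bis_open[OF assms(1)] assms(2))
  ultimately show ?thesis
    using openin_continuous_map_preimage[OF continuous_shifts[of k]] bis_open[OF assms(1)]
    by (simp add: openin_Int)
qed

lemma clopenin_partner_preimage:
  assumes "bis L U k l V" "clopenin (X_top L) C"
  shows "clopenin (X_top L) {x \<in> U. partner k l V x \<in> C}"
proof -
  have "openin (X_top L) {x \<in> U. partner k l V x \<in> topspace (X_top L) - C}"
    by (rule openin_partner_preimage[OF assms(1)]) (use assms(2) in \<open>simp add: clopenin_def openin_diff del: topspace_X\<close>)
  moreover have "{x \<in> U. partner k l V x \<in> C} = U - {x \<in> U. partner k l V x \<in> topspace (X_top L) - C}"
    using partner_in[OF assms(1)] bis_subset[OF bis_sym[OF assms(1)]] by auto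
  moreover have "closedin (X_top L) U"
    using assms(1) by (simp add: bis_def clopenin_def)
  ultimately have "closedin (X_top L) {x \<in> U. partner k l V x \<in> C}"
    by (simp only: closedin_diff)
  then show ?thesis
    using openin_partner_preimage[OF assms(1), of C] assms(2) by (auto simp: clopenin_def)
qed

lemma continuous_section:
  assumes "bis L U k l V"
  shows "continuous_map (subtopology (X_top L) U) (G_top L) (\<lambda>x. (x, int k - int l, partner k l V x))"
proof -
  have U: "openin (X_top L) U" "topspace (subtopology (X_top L) U) = U"
    using bis_open[OF assms] bis_subset_XL[OF assms] by auto
  have in_Z: "(x, int k - int l, partner k l V x) \<in> Zset U k l V" if "x \<in> U" for x
    using that by (simp add: Zset_bis_iff[OF assms])
  have "openin (subtopology (X_top L) U) {x \<in> U. (x, int k - int l, partner k l V x) \<in> O'}" if O': "openin (G_top L) O'" for O'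
  proof -
    have "openin (X_top L) {x \<in> U. (x, int k - int l, partner k l V x) \<in> O'}"
    proof (subst openin_subopen, intro ballI)
      fix x assume x: "x \<in> {x \<in> U. (x, int k - int l, partner k l V x) \<in> O'}"
      then obtain U0 V0 where *: "openin (X_top L) U0" "openin (X_top L) V0" "x \<in> U0" "partner k l V x \<in> V0" "Zset U0 k l V0 \<subseteq> O'"
        using openin_G_imp[OF O', of x k l "partner k l V x"] shifts_partner[OF assms] by auto
      let ?T = "U0 \<inter> {x \<in> U. partner k l V x \<in> V0}"
      have "?T \<subseteq> {x \<in> U. (x, int k - int l, partner k l V x) \<in> O'}"
        using *(5) shifts_partner[OF assms] by (auto simp: Zset_def)
      moreover have "openin (X_top L) ?T"
        by (intro openin_Int * openin_partner_preimage[OF assms])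
      ultimately show "\<exists>T. openin (X_top L) T \<and> x \<in> T \<and> T \<subseteq> {x \<in> U. (x, int k - int l, partner k l V x) \<in> O'}"
        using x * by (intro exI[of _ ?T]) auto
    qed
    then show ?thesis
      using U(1) by (auto simp: openin_open_subtopology)
  qed
  then show ?thesis
    unfolding continuous_map using U in_Z Zset_bis_subset[OF assms] by auto
qed

lemma compactin_Zset:
  assumes "bis L U k l V"
  shows "compactin (G_top L) (Zset U k l V)"
proof -
  have U: "closedin (X_top L) U"
    using assms by (simp add: bis_def clopenin_def)
  have "compactin (subtopology (X_top L) U) U"
    using closedin_compact_space[OF compact_X U] by (simp add: compactin_subtopology)
  from image_compactin[OF this continuous_section[OF assms]]
  have "compactin (G_top L) ((\<lambda>x. (x, int k - int l, partner k l V x)) ` U)" .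
  moreover have "(\<lambda>x. (x, int k - int l, partner k l V x)) ` U = Zset U k l V"
    by (force simp: Zset_bis_iff[OF assms])
  ultimately show ?thesis by simp
qed

lemma openin_G_inv:
  assumes "openin (G_top L) O'"
  shows "openin (G_top L) {g \<in> GL L. ginv g \<in> O'}"
proof (rule openin_GI)
  fix x k l z assume *: "shifts k x = shifts l z" "(x, int k - int l, z) \<in> {g \<in> GL L. ginv g \<in> O'}"
  then have "(z, int l - int k, x) \<in> O'" "x \<in> XL L" "z \<in> XL L"
    by (auto simp: ginv_def GL_iff)
  then obtain U V where UV: "openin (X_top L) U" "openin (X_top L) V" "z \<in> U" "x \<in> V" "Zset U l k V \<subseteq> O'"
    using openin_G_imp[OF assms, of z l k x] *(1) by auto
  have "ginv g \<in> Zset U l k V" if "g \<in> Zset V k l U" for g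
    using that by (auto simp: Zset_iff ginv_def)
  then have "Zset V k l U \<subseteq> {g \<in> GL L. ginv g \<in> O'}"
    using UV(5) Zset_subset_GL[of V U k l] openin_subset[OF UV(1)] openin_subset[OF UV(2)] by auto
  then show "\<exists>U V. openin (X_top L) U \<and> openin (X_top L) V \<and> x \<in> U \<and> z \<in> V \<and> Zset U k l V \<subseteq> {g \<in> GL L. ginv g \<in> O'}"
    using UV by blast
qed auto

lemma continuous_ginv: "continuous_map (G_top L) (G_top L) ginv"
  unfolding continuous_map using openin_G_inv by (auto simp del: split_paired_All)

end

text \<open>\<open>gtrans k l V g\<close> is the product of the inverse of the unique element of the bisection with range
  \<open>rg g\<close>, and \<open>g\<close>.\<close>
definition gtrans :: "nat \<Rightarrow> nat \<Rightarrow> (nat \<Rightarrow> 'a \<times> (nat \<Rightarrow> 'v)) set \<Rightarrow> ('v, 'a) gel \<Rightarrow> ('v, 'a) gel" where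
  "gtrans k l V g = (partner k l V (rg g), dg g - (int k - int l), sc g)"

context lgsys begin

lemma GL_gtrans:
  assumes "bis L U k l V" "g \<in> GL L" "rg g \<in> U"
  shows "gtrans k l V g \<in> GL L"
proof -
  let ?b = "(rg g, int k - int l, partner k l V (rg g))"
  have "?b \<in> GL L"
    using Zset_bis_subset[OF assms(1)] assms(3) by (auto simp: Zset_bis_iff[OF assms(1)])
  then have "gmult (ginv ?b) g \<in> GL L"
    using assms(2) by (intro GL_mult) simp_all
  then show ?thesis
    by (simp add: gmult_def ginv_def gtrans_def algebra_simps)
qed

lemma gtrans_gtrans:
  assumes "bis L U k l V" "rg g \<in> U"
  shows "gtrans l k U (gtrans k l V g) = g"
  by (cases g) (use partner_partner[OF assms] in \<open>simp add: gtrans_def\<close>)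

lemma inj_gtrans: "bis L U k l V \<Longrightarrow> inj_on (gtrans k l V) {g. rg g \<in> U}"
  by (rule inj_on_inverseI[where g = "gtrans l k U"]) (simp add: gtrans_gtrans)

lemma openin_gtrans:
  assumes b: "bis L U k l V" and O': "openin (G_top L) O'"
  shows "openin (G_top L) {g \<in> GL L. rg g \<in> U \<and> gtrans k l V g \<in> O'}"
proof (rule openin_GI)
  fix x p q w assume *: "shifts p x = shifts q w" "(x, int p - int q, w) \<in> {g \<in> GL L. rg g \<in> U \<and> gtrans k l V g \<in> O'}"
  \<comment> \<open>The degree of the translate is written with the natural exponents p + l and q +
    k; the relation \<open>eq\<close> below shows that this pair represents the element.\<close>
  then have x: "x \<in> U" "x \<in> XL L" "w \<in> XL L" "(partner k l V x, int (p + l) - int (q + k), w) \<in> O'"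
    by (auto simp: gtrans_def GL_iff algebra_simps)
  have eq: "shifts (p + l) (partner k l V y) = shifts (q + k) w'" if "y \<in> U" "shifts p y = shifts q w'" for y w'
  proof -
    have "shifts (p + l) (partner k l V y) = shifts (p + k) y"
      using shifts_partner[OF b that(1)] by (simp add: shifts_add)
    then show ?thesis
      using that(2) by (metis add.commute shifts_add)
  qed
  obtain U0 V0 where UV: "openin (X_top L) U0" "openin (X_top L) V0" "partner k l V x \<in> U0" "w \<in> V0" "Zset U0 (p + l) (q + k) V0 \<subseteq> O'"
    using openin_G_imp[OF O' x(4) eq[OF x(1) *(1)]] by blast
  have "Zset {x \<in> U. partner k l V x \<in> U0} p q V0 \<subseteq> {g \<in> GL L. rg g \<in> U \<and> gtrans k l V g \<in> O'}"
  proof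
    fix g assume g: "g \<in> Zset {x \<in> U. partner k l V x \<in> U0} p q V0"
    then have "gtrans k l V g \<in> Zset U0 (p + l) (q + k) V0"
      using eq by (auto simp: Zset_iff gtrans_def)
    moreover have "g \<in> GL L"
      using Zset_subset_GL[of "{x \<in> U. partner k l V x \<in> U0}" V0] g bis_subset_XL[OF b] openin_subset[OF UV(2)] by auto
    ultimately show "g \<in> {g \<in> GL L. rg g \<in> U \<and> gtrans k l V g \<in> O'}"
      using g UV(5) by (auto simp: Zset_iff)
  qed
  moreover have "openin (X_top L) {x \<in> U. partner k l V x \<in> U0}"
    by (rule openin_partner_preimage[OF b UV(1)])
  ultimately show "\<exists>U' V'. openin (X_top L) U' \<and> openin (X_top L) V' \<and> x \<in> U' \<and> w \<in> V' \<and>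
      Zset U' p q V' \<subseteq> {g \<in> GL L. rg g \<in> U \<and> gtrans k l V g \<in> O'}"
    using UV x(1) by blast
qed auto

lemma continuous_gtrans:
  assumes "bis L U k l V"
  shows "continuous_map (subtopology (G_top L) {g \<in> GL L. rg g \<in> U}) (G_top L) (gtrans k l V)"
proof -
  let ?W = "{g \<in> GL L. rg g \<in> U}"
  have W: "openin (G_top L) ?W"
    by (rule openin_G_rg[OF bis_open(1)[OF assms]])
  have top: "topspace (subtopology (G_top L) ?W) = ?W" by auto
  have "openin (subtopology (G_top L) ?W) {g \<in> ?W. gtrans k l V g \<in> O'}" if "openin (G_top L) O'" for O'
    using openin_gtrans[OF assms that] W by (auto simp: openin_open_subtopology)
  then show ?thesis
    unfolding continuous_map top using GL_gtrans[OF assms] by auto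
qed

end

section \<open>Convolution operators\<close>

lemma continuous_map_euclidean_tendsto:
  "continuous_map Y euclidean f \<longleftrightarrow> (\<forall>x\<in>topspace Y. (f \<longlongrightarrow> f x) (atin Y x))"
  by (simp add: continuous_map_atin)

lemma continuous_map_complex_mult:
  fixes f g :: "'b \<Rightarrow> complex"
  shows "continuous_map Y euclidean f \<Longrightarrow> continuous_map Y euclidean g \<Longrightarrow> continuous_map Y euclidean (\<lambda>x. f x * g x)"
  by (simp add: continuous_map_euclidean_tendsto tendsto_mult)

lemma continuous_map_complex_add:
  fixes f g :: "'b \<Rightarrow> complex"
  shows "continuous_map Y euclidean f \<Longrightarrow> continuous_map Y euclidean g \<Longrightarrow> continuous_map Y euclidean (\<lambda>x. f x + g x)"
  by (simp add: continuous_map_euclidean_tendsto tendsto_add)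

lemma continuous_map_complex_cnj:
  "continuous_map Y euclidean f \<Longrightarrow> continuous_map Y euclidean (\<lambda>x. cnj (f x))"
  by (simp add: continuous_map_euclidean_tendsto tendsto_cnj)

text \<open>Functions are cut off along clopen sets, which keeps them continuous and takes the place
  of partitions of unity.\<close>

lemma continuous_map_clopen_extension:
  fixes f :: "'b \<Rightarrow> complex"
  assumes W: "clopenin Y W" and f: "continuous_map (subtopology Y W) euclidean f"
  shows "continuous_map Y euclidean (\<lambda>x. if x \<in> W then f x else 0)"
  unfolding continuous_map
proof (intro conjI allI impI)
  fix S :: "complex set" assume S: "openin euclidean S"
  have "openin (subtopology Y W) {x \<in> topspace (subtopology Y W). f x \<in> S}"
    by (rule openin_continuous_map_preimage[OF f S])
  then have "openin Y {x \<in> topspace (subtopology Y W). f x \<in> S}"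
    using W by (simp add: clopenin_def openin_open_subtopology)
  moreover have "openin Y (if 0 \<in> S then topspace Y - W else {})"
    using W by (auto simp: clopenin_def openin_diff)
  ultimately have "openin Y ({x \<in> topspace (subtopology Y W). f x \<in> S} \<union> (if 0 \<in> S then topspace Y - W else {}))"
    by (rule openin_Un)
  moreover have "{x \<in> topspace (subtopology Y W). f x \<in> S} \<union> (if 0 \<in> S then topspace Y - W else {})
      = {x \<in> topspace Y. (if x \<in> W then f x else 0) \<in> S}"
    by auto
  ultimately show "openin Y {x \<in> topspace Y. (if x \<in> W then f x else 0) \<in> S}" by simp
qed simp

definition bisfun :: "((nat \<Rightarrow> 'a \<times> (nat \<Rightarrow> 'v)) \<Rightarrow> complex) \<Rightarrow> (nat \<Rightarrow> 'a \<times> (nat \<Rightarrow> 'v)) set \<Rightarrow> nat \<Rightarrow> nat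
     \<Rightarrow> (nat \<Rightarrow> 'a \<times> (nat \<Rightarrow> 'v)) set \<Rightarrow> ('v, 'a) gel \<Rightarrow> complex" where
  "bisfun h U k l V = (\<lambda>g. if g \<in> Zset U k l V then h (rg g) else 0)"

definition bisets :: "('v, 'e, 'a) lgs \<Rightarrow> ('v, 'a) gel set set" where
  "bisets L = {Zset U k l V | U k l V. bis L U k l V}"

definition dfun :: "((nat \<Rightarrow> 'a \<times> (nat \<Rightarrow> 'v)) \<Rightarrow> complex) \<Rightarrow> ('v, 'a) gel \<Rightarrow> complex" where
  "dfun h = (\<lambda>g. if dg g = 0 \<and> rg g = sc g then h (rg g) else 0)"

text \<open>Renault's coefficient function j of an element of the reduced algebra. It inverts
  \<open>lam L\<close> on \<open>Cc L\<close>, by \<open>lam_delta_unit\<close>, and determines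
  every matrix entry of T in \<open>OL L\<close>, by \<open>OL_delta\<close>.\<close>

definition jfun :: "('v, 'a) gop \<Rightarrow> ('v, 'a) gel \<Rightarrow> complex" where
  "jfun T g = T (delta (gunit (sc g))) g"

lemma infsum_single:
  assumes "\<And>b. b \<in> A \<Longrightarrow> b \<noteq> b0 \<Longrightarrow> f b = 0" "b0 \<in> A"
  shows "infsum f A = (f b0 :: complex)"
proof -
  have "(f has_sum f b0) A"
    by (rule has_sum_finite_neutralI[of "{b0}"]) (use assms in auto)
  then show ?thesis by (rule infsumI)
qed

lemma lam_outside: "\<xi> \<notin> ell2 L \<Longrightarrow> lam L a \<xi> = (\<lambda>_. 0)"
  by (simp add: lam_def)

lemma lam_gquot:
  "\<xi> \<in> ell2 L \<Longrightarrow> g \<in> GL L \<Longrightarrow> lam L a \<xi> g = infsum (\<lambda>b. a (gquot g b) * \<xi> b) {b \<in> GL L. sc b = sc g}"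
  by (simp add: lam_def gquot_def)

lemma lam_outside_GL: "g \<notin> GL L \<Longrightarrow> lam L a \<xi> g = 0"
  by (simp add: lam_def)

lemma lam_delta:
  assumes "b \<in> GL L" "g \<in> GL L"
  shows "lam L a (delta b) g = (if sc g = sc b then a (gquot g b) else 0)"
proof (cases "sc g = sc b")
  case True
  have "infsum (\<lambda>c. a (gquot g c) * delta b c) {c \<in> GL L. sc c = sc g} = a (gquot g b) * delta b b"
    by (rule infsum_single) (use True assms in \<open>auto simp: delta_def\<close>)
  then show ?thesis
    using True assms by (simp add: lam_gquot) (simp add: delta_def)
next
  case False
  have "infsum (\<lambda>c. a (gquot g c) * delta b c) {c \<in> GL L. sc c = sc g} = 0"
    by (rule infsum_0) (use False in \<open>auto simp: delta_def\<close>)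
  then show ?thesis
    using False assms by (simp add: lam_gquot)
qed

lemma lam_dfun:
  assumes "\<xi> \<in> ell2 L"
  shows "lam L (dfun h) \<xi> g = (if g \<in> GL L then h (rg g) * \<xi> g else 0)"
proof (cases "g \<in> GL L")
  case True
  have "infsum (\<lambda>b. dfun h (gquot g b) * \<xi> b) {b \<in> GL L. sc b = sc g} = dfun h (gquot g g) * \<xi> g"
    by (rule infsum_single) (use True in \<open>auto simp: dfun_def gquot_def prod_eq_iff\<close>)
  then show ?thesis
    using True assms by (simp add: lam_gquot) (simp add: dfun_def gquot_def)
qed (simp add: lam_outside_GL)

lemma DL_eq: "DL L = {lam L (dfun h) | h. continuous_map (X_top L) euclidean h}"
  by (simp add: DL_def dfun_def)

lemma op_diff_self: "opnorm L (op_diff T T) \<le> 0"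
  by (rule opnorm_le) (simp_all add: op_diff_def)

context lgsys begin

text \<open>Only one factorisation of g has its first factor in the bisection, namely the one with
  second factor \<open>gtrans k l V g\<close>, so the convolution sum has at most one nonzero
  term.\<close>

lemma lam_bisfun:
  assumes b: "bis L U k l V" and \<xi>: "\<xi> \<in> ell2 L"
  shows "lam L (bisfun h U k l V) \<xi> g = (if g \<in> GL L \<and> rg g \<in> U then h (rg g) * \<xi> (gtrans k l V g) else 0)"
proof (cases "g \<in> GL L \<and> rg g \<in> U")
  case True
  have "infsum (\<lambda>c. bisfun h U k l V (gquot g c) * \<xi> c) {c \<in> GL L. sc c = sc g}
      = bisfun h U k l V (gquot g (gtrans k l V g)) * \<xi> (gtrans k l V g)"
  proof (rule infsum_single)
    show "gtrans k l V g \<in> {c \<in> GL L. sc c = sc g}"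
      using GL_gtrans[OF b] True by (simp add: gtrans_def)
    fix c assume c: "c \<in> {c \<in> GL L. sc c = sc g}" "c \<noteq> gtrans k l V g"
    then have "gquot g c \<notin> Zset U k l V"
      unfolding Zset_bis_iff[OF b] by (cases c) (auto simp: gquot_def gtrans_def)
    then show "bisfun h U k l V (gquot g c) * \<xi> c = 0"
      by (simp add: bisfun_def)
  qed
  moreover have "gquot g (gtrans k l V g) \<in> Zset U k l V" "rg (gquot g (gtrans k l V g)) = rg g"
    unfolding Zset_bis_iff[OF b] using True by (simp_all add: gquot_def gtrans_def)
  ultimately show ?thesis
    using True \<xi> by (simp add: lam_gquot) (simp add: bisfun_def)
next
  case False
  have "lam L (bisfun h U k l V) \<xi> g = 0" if "g \<in> GL L" "rg g \<notin> U"
    unfolding lam_gquot[OF \<xi> that(1)]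
    by (rule infsum_0) (use that(2) in \<open>auto simp: bisfun_def Zset_iff gquot_def\<close>)
  with False lam_outside_GL[of g L] show ?thesis
    by auto
qed

lemma clopenin_bisets: "B \<in> bisets L \<Longrightarrow> clopenin (G_top L) B"
  by (auto simp: bisets_def clopenin_Zset_bis)

lemma compactin_bisets: "B \<in> bisets L \<Longrightarrow> compactin (G_top L) B"
  by (auto simp: bisets_def compactin_Zset)

lemma CcI:
  assumes "continuous_map (G_top L) euclidean a" "\<And>g. g \<notin> GL L \<Longrightarrow> a g = 0"
    and K: "compactin (G_top L) K" "closedin (G_top L) K" "\<And>g. a g \<noteq> 0 \<Longrightarrow> g \<in> K"
  shows "a \<in> Cc L"
proof -
  have "G_top L closure_of {g. a g \<noteq> 0} \<subseteq> K"
    by (rule closure_of_minimal[OF _ K(2)]) (use K(3) in auto)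
  then have "compactin (G_top L) (G_top L closure_of {g. a g \<noteq> 0})"
    by (intro closed_compactin[OF K(1)]) auto
  with assms(1,2) show ?thesis
    unfolding Cc_def by blast
qed

lemma CcI_bisets:
  assumes "continuous_map (G_top L) euclidean a" "\<And>g. g \<notin> GL L \<Longrightarrow> a g = 0"
    and B: "finite \<B>" "\<B> \<subseteq> bisets L" "{g. a g \<noteq> 0} \<subseteq> \<Union>\<B>"
  shows "a \<in> Cc L"
proof (rule CcI[OF assms(1,2)])
  show "compactin (G_top L) (\<Union>\<B>)"
    using B compactin_bisets by (intro compactin_Union) auto
  show "closedin (G_top L) (\<Union>\<B>)"
    using B clopenin_bisets by (intro closedin_Union) (auto simp: clopenin_def)
qed (use B(3) in auto)

lemma Cc_D:
  assumes "a \<in> Cc L"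
  shows "continuous_map (G_top L) euclidean a" "g \<notin> GL L \<Longrightarrow> a g = 0"
  using assms unfolding Cc_def by blast+

lemma Cc_bisets:
  assumes "a \<in> Cc L"
  obtains \<B> where "finite \<B>" "\<B> \<subseteq> bisets L" "{g. a g \<noteq> 0} \<subseteq> \<Union>\<B>"
proof -
  have c: "compactin (G_top L) (G_top L closure_of {g. a g \<noteq> 0})"
    using assms unfolding Cc_def by blast
  have sub: "{g. a g \<noteq> 0} \<subseteq> G_top L closure_of {g. a g \<noteq> 0}"
    using Cc_D(2)[OF assms] by (intro closure_of_subset) auto
  have "G_top L closure_of {g. a g \<noteq> 0} \<subseteq> \<Union>(bisets L)"
  proof
    fix g assume "g \<in> G_top L closure_of {g. a g \<noteq> 0}"
    then have "g \<in> topspace (G_top L)"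
      using closure_of_subset_topspace[of "G_top L"] by blast
    from openin_G_bis[OF openin_topspace this]
    obtain U k l V where "bis L U k l V" "g \<in> Zset U k l V" .
    then show "g \<in> \<Union>(bisets L)"
      unfolding bisets_def by blast
  qed
  moreover have "\<forall>B\<in>bisets L. openin (G_top L) B"
    using clopenin_bisets by (simp add: clopenin_def)
  ultimately obtain \<B> where "finite \<B>" "\<B> \<subseteq> bisets L" "G_top L closure_of {g. a g \<noteq> 0} \<subseteq> \<Union>\<B>"
    using c unfolding compactin_def by meson
  with sub show ?thesis
    by (intro that[of \<B>]) auto
qed

lemma bisfun_Cc:
  assumes b: "bis L U k l V" and h: "continuous_map (X_top L) euclidean h"
  shows "bisfun h U k l V \<in> Cc L"
proof (rule CcI_bisets[of _ "{Zset U k l V}"])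
  show "continuous_map (G_top L) euclidean (bisfun h U k l V)"
    unfolding bisfun_def
    using continuous_map_compose[OF continuous_rg h]
    by (intro continuous_map_clopen_extension clopenin_Zset_bis[OF b] continuous_map_from_subtopology)
       (simp add: comp_def)
  show "bisfun h U k l V g = 0" if "g \<notin> GL L" for g
    using that Zset_bis_subset[OF b] by (auto simp: bisfun_def)
  show "{Zset U k l V} \<subseteq> bisets L"
    using b by (auto simp: bisets_def)
  show "{g. bisfun h U k l V g \<noteq> 0} \<subseteq> \<Union>{Zset U k l V}"
    by (auto simp: bisfun_def)
qed simp

lemma zero_Cc: "(\<lambda>_. 0) \<in> Cc L"
  by (rule CcI_bisets[of _ "{}"]) auto

lemma add_Cc:
  assumes "a \<in> Cc L" "c \<in> Cc L"
  shows "(\<lambda>g. a g + c g) \<in> Cc L"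
proof -
  obtain \<B> where B: "finite \<B>" "\<B> \<subseteq> bisets L" "{g. a g \<noteq> 0} \<subseteq> \<Union>\<B>"
    using Cc_bisets[OF assms(1)] .
  obtain \<B>' where B': "finite \<B>'" "\<B>' \<subseteq> bisets L" "{g. c g \<noteq> 0} \<subseteq> \<Union>\<B>'"
    using Cc_bisets[OF assms(2)] .
  show ?thesis
  proof (rule CcI_bisets[of _ "\<B> \<union> \<B>'"])
    show "continuous_map (G_top L) euclidean (\<lambda>g. a g + c g)"
      by (intro continuous_map_complex_add Cc_D assms)
    show "a g + c g = 0" if "g \<notin> GL L" for g
      using Cc_D(2)[OF assms(1) that] Cc_D(2)[OF assms(2) that] by simp
    show "{g. a g + c g \<noteq> 0} \<subseteq> \<Union>(\<B> \<union> \<B>')"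
    proof
      fix g assume "g \<in> {g. a g + c g \<noteq> 0}"
      then have "a g \<noteq> 0 \<or> c g \<noteq> 0" by auto
      then show "g \<in> \<Union>(\<B> \<union> \<B>')"
        using subsetD[OF B(3), of g] subsetD[OF B'(3), of g] by auto
    qed
  qed (use B B' in auto)
qed

text \<open>The finitely many bisections covering the support are removed one at a time. They are
  clopen, so the restrictions of a to B and to its complement are continuous; on B an element is
  determined by its range, which gives the restriction the form \<open>bisfun\<close>.\<close>

lemma Cc_induct [consumes 1, case_names zero add]:
  assumes a: "a \<in> Cc L" and P0: "P (\<lambda>_. 0)"
    and P_add: "\<And>a h U k l V. a \<in> Cc L \<Longrightarrow> P a \<Longrightarrow> bis L U k l V \<Longrightarrow> continuous_map (X_top L) euclidean h \<Longrightarrow>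
        P (\<lambda>g. a g + bisfun h U k l V g)"
  shows "P a"
proof -
  obtain \<B> where B: "finite \<B>" "\<B> \<subseteq> bisets L" "{g. a g \<noteq> 0} \<subseteq> \<Union>\<B>"
    using Cc_bisets[OF a] .
  show ?thesis
    using B a
  proof (induction \<B> arbitrary: a rule: finite_induct)
    case empty
    then have "a = (\<lambda>_. 0)" by auto
    then show ?case using P0 by simp
  next
    case (insert B \<B>)
    then obtain U k l V where b: "bis L U k l V" and BZ: "B = Zset U k l V"
      by (auto simp: bisets_def)
    define h where "h = (\<lambda>x. if x \<in> U then a (x, int k - int l, partner k l V x) else 0)"
    define a' where "a' = (\<lambda>g. if g \<in> GL L - B then a g else 0)"
    have cB: "clopenin (G_top L) B"
      unfolding BZ by (rule clopenin_Zset_bis[OF b])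
    have cont_a: "continuous_map (G_top L) euclidean a"
      by (rule Cc_D(1)[OF insert.prems(3)])
    have h: "continuous_map (X_top L) euclidean h"
      unfolding h_def using continuous_map_compose[OF continuous_section[OF b] cont_a] b
      by (intro continuous_map_clopen_extension) (simp_all add: bis_def comp_def)
    have supp: "{g. a' g \<noteq> 0} \<subseteq> \<Union>\<B>"
      using insert.prems(2) by (auto simp: a'_def)
    have "clopenin (G_top L) (GL L - B)"
      using clopenin_Diff[OF clopenin_topspace cB] by simp
    then have "continuous_map (G_top L) euclidean a'"
      unfolding a'_def by (intro continuous_map_clopen_extension continuous_map_from_subtopology cont_a)
    then have a': "a' \<in> Cc L"
      using insert.hyps(1) insert.prems(1) supp by (intro CcI_bisets[of _ \<B>]) (auto simp: a'_def)
    have "a g = a' g + bisfun h U k l V g" for g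
    proof (cases "g \<in> GL L")
      case True
      then show ?thesis
        by (cases g) (auto simp: a'_def bisfun_def BZ h_def Zset_bis_iff[OF b])
    next
      case False
      then show ?thesis
        using Cc_D(2)[OF insert.prems(3) False] Cc_D(2)[OF bisfun_Cc[OF b h] False] by (simp add: a'_def)
    qed
    then have "a = (\<lambda>g. a' g + bisfun h U k l V g)" by blast
    moreover have "P a'"
      using insert.IH[of a'] insert.prems(1) supp a' by simp
    ultimately show ?case
      using P_add[OF a' _ b h] by simp
  qed
qed

text \<open>Each bisection of the cover admits only the candidate \<open>gtrans k l V g\<close>.
  Finiteness makes the convolution sums additive in a.\<close>

lemma Cc_fibre_finite:
  assumes "a \<in> Cc L" "g \<in> GL L"
  shows "finite {b \<in> GL L. sc b = sc g \<and> a (gquot g b) \<noteq> 0}"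
proof -
  obtain \<B> where B: "finite \<B>" "\<B> \<subseteq> bisets L" "{g. a g \<noteq> 0} \<subseteq> \<Union>\<B>"
    using Cc_bisets[OF assms(1)] .
  have "finite {b. sc b = sc g \<and> gquot g b \<in> B}" if "B \<in> \<B>" for B
  proof -
    obtain U k l V where b: "bis L U k l V" and BZ: "B = Zset U k l V"
      using B(2) \<open>B \<in> \<B>\<close> by (auto simp: bisets_def)
    have "{b. sc b = sc g \<and> gquot g b \<in> B} \<subseteq> {gtrans k l V g}"
      by (auto simp: BZ Zset_bis_iff[OF b] gquot_def gtrans_def)
    then show ?thesis
      by (rule finite_subset) simp
  qed
  then have "finite (\<Union>B\<in>\<B>. {b. sc b = sc g \<and> gquot g b \<in> B})"
    using B(1) by blast
  moreover have "b \<in> (\<Union>B\<in>\<B>. {b. sc b = sc g \<and> gquot g b \<in> B})"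
    if "b \<in> {b \<in> GL L. sc b = sc g \<and> a (gquot g b) \<noteq> 0}" for b
    using that subsetD[OF B(3), of "gquot g b"] by auto
  ultimately show ?thesis
    by (meson finite_subset subsetI)
qed

lemma lam_add:
  assumes "a \<in> Cc L" "c \<in> Cc L"
  shows "lam L (\<lambda>g. a g + c g) = op_add (lam L a) (lam L c)"
proof (intro ext)
  fix \<xi> g
  have s: "(\<lambda>b. a (gquot g b) * \<xi> b) summable_on {b \<in> GL L. sc b = sc g}" if "a \<in> Cc L" "g \<in> GL L" for a
    by (rule finite_nonzero_values_imp_summable_on, rule finite_subset[OF _ Cc_fibre_finite[OF that]]) auto
  show "lam L (\<lambda>g. a g + c g) \<xi> g = op_add (lam L a) (lam L c) \<xi> g"
  proof (cases "\<xi> \<in> ell2 L \<and> g \<in> GL L")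
    case True
    then have "lam L (\<lambda>g. a g + c g) \<xi> g = infsum (\<lambda>b. a (gquot g b) * \<xi> b + c (gquot g b) * \<xi> b) {b \<in> GL L. sc b = sc g}"
      by (simp add: lam_gquot distrib_right)
    also have "\<dots> = infsum (\<lambda>b. a (gquot g b) * \<xi> b) {b \<in> GL L. sc b = sc g} + infsum (\<lambda>b. c (gquot g b) * \<xi> b) {b \<in> GL L. sc b = sc g}"
      using True by (intro infsum_add s assms) auto
    finally show ?thesis
      using True by (simp add: op_add_def lam_gquot)
  next
    case False
    then show ?thesis
      by (auto simp: op_add_def lam_outside lam_outside_GL)
  qed
qed

lemma continuous_bounded:
  assumes "continuous_map (X_top L) euclidean (h :: _ \<Rightarrow> complex)"
  obtains M where "M \<ge> 0" "\<And>x. x \<in> XL L \<Longrightarrow> cmod (h x) \<le> M"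
proof -
  have "compactin euclidean (h ` topspace (X_top L))"
    using image_compactin[OF _ assms] compact_X by (simp add: compact_space_def)
  then have "bounded (h ` XL L)"
    by (simp add: compact_imp_bounded)
  then obtain M where M: "\<And>x. x \<in> XL L \<Longrightarrow> cmod (h x) \<le> M"
    by (auto simp: bounded_iff)
  show ?thesis
    by (rule that[of "max M 0"]) (use M in \<open>auto intro: max.coboundedI1\<close>)
qed

lemma bounded_op_lam_bisfun:
  assumes b: "bis L U k l V" and h: "continuous_map (X_top L) euclidean h"
  shows "bounded_op L (lam L (bisfun h U k l V))"
proof -
  obtain M where M: "M \<ge> 0" "\<And>x. x \<in> XL L \<Longrightarrow> cmod (h x) \<le> M"
    using continuous_bounded[OF h] by blast
  have *: "sq_summable (lam L (bisfun h U k l V) \<xi>)" "l2norm (lam L (bisfun h U k l V) \<xi>) \<le> M * l2norm \<xi>"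
    if \<xi>: "\<xi> \<in> ell2 L" for \<xi>
  proof -
    have inj: "inj_on (gtrans k l V) {g. lam L (bisfun h U k l V) \<xi> g \<noteq> 0}"
      by (rule inj_on_subset[OF inj_gtrans[OF b]]) (auto simp: lam_bisfun[OF b \<xi>] split: if_splits)
    have le: "cmod (lam L (bisfun h U k l V) \<xi> g) \<le> M * cmod (\<xi> (gtrans k l V g))"
      if "lam L (bisfun h U k l V) \<xi> g \<noteq> 0" for g
      using that bis_subset_XL[OF b] M(2)[of "rg g"]
      by (auto simp: lam_bisfun[OF b \<xi>] norm_mult intro!: mult_right_mono split: if_splits)
    show "sq_summable (lam L (bisfun h U k l V) \<xi>)" "l2norm (lam L (bisfun h U k l V) \<xi>) \<le> M * l2norm \<xi>"
      using sq_summable_reindex[OF ell2_sq[OF \<xi>] inj M(1) le] by blast+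
  qed
  show ?thesis
  proof (rule bounded_opI[OF _ _ _ M(1) *(2)])
    fix \<xi> assume "\<xi> \<in> ell2 L"
    from *(1)[OF this] show "lam L (bisfun h U k l V) \<xi> \<in> ell2 L"
      unfolding ell2_iff using lam_outside_GL by blast
  next
    fix \<xi> \<eta> c assume "\<xi> \<in> ell2 L" "\<eta> \<in> ell2 L"
    then show "lam L (bisfun h U k l V) (\<lambda>g. \<xi> g + c * \<eta> g) =
        (\<lambda>g. lam L (bisfun h U k l V) \<xi> g + c * lam L (bisfun h U k l V) \<eta> g)"
      by (intro ext) (simp add: lam_bisfun[OF b] ell2_lincomb algebra_simps)
  qed (simp_all add: lam_outside)
qed

lemma bounded_op_lam: "a \<in> Cc L \<Longrightarrow> bounded_op L (lam L a)"
proof (induction rule: Cc_induct)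
  case zero
  have "lam L (\<lambda>_. 0) \<xi> = (\<lambda>_. 0)" for \<xi>
    by (intro ext) (simp add: lam_def)
  then show ?case
    by (intro bounded_opI[where C = 0]) simp_all
next
  case (add a h U k l V)
  then show ?case
    by (simp add: lam_add bisfun_Cc bounded_op_op_add bounded_op_lam_bisfun)
qed

section \<open>Elements of the reduced algebra through their coefficients\<close>

lemma lam_OL:
  assumes "a \<in> Cc L"
  shows "lam L a \<in> OL L"
  unfolding OL_def
proof (intro CollectI conjI allI impI)
  fix e :: real assume "e > 0"
  then show "\<exists>c\<in>Cc L. opnorm L (op_diff (lam L a) (lam L c)) < e"
    using assms op_diff_self[of L "lam L a"] by (intro bexI[of _ a]) auto
qed (rule bounded_op_lam[OF assms])

lemma OL_bounded: "T \<in> OL L \<Longrightarrow> bounded_op L T"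
  by (simp add: OL_def)

lemma OL_approx:
  assumes "T \<in> OL L" "e > 0"
  obtains a where "a \<in> Cc L" "opnorm L (op_diff T (lam L a)) < e"
  using assms unfolding OL_def by blast

lemma OL_approx_coeff:
  assumes T: "T \<in> OL L" and "e > 0"
  obtains a where "a \<in> Cc L" "\<And>b g. b \<in> GL L \<Longrightarrow> cmod (T (delta b) g - lam L a (delta b) g) < e"
proof -
  obtain a where a: "a \<in> Cc L" "opnorm L (op_diff T (lam L a)) < e"
    using OL_approx[OF assms] .
  have bd: "bounded_op L (op_diff T (lam L a))"
    by (intro bounded_op_op_diff OL_bounded T bounded_op_lam a)
  have "cmod (T (delta b) g - lam L a (delta b) g) < e" if "b \<in> GL L" for b g
  proof -
    have "cmod (op_diff T (lam L a) (delta b) g) \<le> l2norm (op_diff T (lam L a) (delta b))"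
      by (intro cmod_le_l2norm ell2_sq[OF bounded_op_ell2'[OF bd]])
    also have "\<dots> \<le> opnorm L (op_diff T (lam L a))"
      using bounded_op_le_opnorm[OF bd ell2_delta[OF that]] by (simp add: l2norm_delta)
    finally show ?thesis
      using a(2) by (simp add: op_diff_def)
  qed
  with a(1) show ?thesis
    using that by blast
qed

lemma lam_delta_unit: "g \<in> GL L \<Longrightarrow> lam L a (delta (gunit (sc g))) g = a g"
  by (simp add: lam_delta GL_sc) (simp add: gunit_def gquot_def)

text \<open>Convolution operators are invariant under right translation, so their entries depend on
  \<open>gquot g b\<close> only and vanish for different sources. Both properties survive limits,
  since entries are controlled by the operator norm.\<close>

lemma OL_delta:
  assumes T: "T \<in> OL L" and b: "b \<in> GL L" and g: "g \<in> GL L"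
  shows "T (delta b) g = (if sc g = sc b then jfun T (gquot g b) else 0)" (is "?x = ?y")
proof (rule ccontr)
  assume "?x \<noteq> ?y"
  \<comment> \<open>Half the supposed discrepancy: a single approximant is this close to both sides,
    with the same value \<open>?z\<close>.\<close>
  then have "cmod (?x - ?y) / 2 > 0" by simp
  then obtain a where a: "\<And>b g. b \<in> GL L \<Longrightarrow> cmod (T (delta b) g - lam L a (delta b) g) < cmod (?x - ?y) / 2"
    using OL_approx_coeff[OF T] by blast
  let ?z = "if sc g = sc b then a (gquot g b) else 0"
  have "cmod (?x - ?z) < cmod (?x - ?y) / 2"
    using a[OF b, of g] lam_delta[OF b g] by simp
  moreover have "cmod (?y - ?z) < cmod (?x - ?y) / 2"
  proof (cases "sc g = sc b")
    case True
    have q: "gquot g b \<in> GL L"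
      by (rule GL_quot[OF g b True])
    show ?thesis
      using True a[of "gunit (sc (gquot g b))" "gquot g b"] lam_delta_unit[OF q, of a] GL_sc[OF q]
      by (simp add: jfun_def)
  next
    case False
    then show ?thesis using \<open>cmod (?x - ?y) / 2 > 0\<close> by simp
  qed
  ultimately show False
    using norm_triangle_ineq4[of "?x - ?z" "?y - ?z"] by auto
qed

lemma open_jfun_support:
  assumes T: "T \<in> OL L"
  shows "openin (G_top L) {g \<in> GL L. jfun T g \<noteq> 0}"
proof (subst openin_subopen, intro ballI)
  fix g0 assume g0: "g0 \<in> {g \<in> GL L. jfun T g \<noteq> 0}"
  \<comment> \<open>With this tolerance an approximant a satisfies |a g0| > e, while |a g| > e
    forces \<open>jfun T g\<close> to be nonzero.\<close>
  define e where "e = cmod (jfun T g0) / 2"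
  have e: "e > 0"
    using g0 by (simp add: e_def)
  then obtain a where a: "a \<in> Cc L" "\<And>b g. b \<in> GL L \<Longrightarrow> cmod (T (delta b) g - lam L a (delta b) g) < e"
    using OL_approx_coeff[OF T] by blast
  have close: "cmod (jfun T g - a g) < e" if "g \<in> GL L" for g
    using a(2)[of "gunit (sc g)" g] that lam_delta_unit[OF that, of a] GL_sc[OF that] by (simp add: jfun_def)
  have "openin (G_top L) {g \<in> topspace (G_top L). a g \<in> - cball 0 e}"
    by (rule openin_continuous_map_preimage[OF Cc_D(1)[OF a(1)]]) (simp add: open_Compl)
  moreover have "g0 \<in> {g \<in> topspace (G_top L). a g \<in> - cball 0 e}"
    using g0 close[of g0] norm_triangle_ineq2[of "jfun T g0" "a g0"] by (auto simp: e_def)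
  moreover have "{g \<in> topspace (G_top L). a g \<in> - cball 0 e} \<subseteq> {g \<in> GL L. jfun T g \<noteq> 0}"
    using close by fastforce
  ultimately show "\<exists>S. openin (G_top L) S \<and> g0 \<in> S \<and> S \<subseteq> {g \<in> GL L. jfun T g \<noteq> 0}"
    by blast
qed

text \<open>A function on a bisection, convolved from the left, translates c along the bisection and
  multiplies it by h. The support stays compact because K' is the translate of the part of K with
  range in V, where K is a compact clopen set containing the support of c.\<close>

lemma conv_bisfun_Cc:
  assumes b: "bis L U k l V" and h: "continuous_map (X_top L) euclidean h" and c: "c \<in> Cc L"
  obtains d where "d \<in> Cc L" "lam L (bisfun h U k l V) \<circ> lam L c = lam L d"
proof -
  define W where "W = {g \<in> GL L. rg g \<in> U}"
  define d where "d = (\<lambda>g. if g \<in> W then h (rg g) * c (gtrans k l V g) else 0)"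
  have W: "clopenin (G_top L) W"
    unfolding W_def by (rule clopenin_rg) (use b in \<open>simp add: bis_def\<close>)
  obtain \<B> where B: "finite \<B>" "\<B> \<subseteq> bisets L" "{g. c g \<noteq> 0} \<subseteq> \<Union>\<B>"
    using Cc_bisets[OF c] .
  define K where "K = \<Union>\<B>"
  have K: "compactin (G_top L) K" "clopenin (G_top L) K"
    unfolding K_def using B compactin_bisets clopenin_bisets clopenin_UN[of \<B> "G_top L" id]
    by (auto intro!: compactin_Union)
  define K' where "K' = {g \<in> GL L. rg g \<in> U \<and> gtrans k l V g \<in> K}"
  have dC: "d \<in> Cc L"
  proof (rule CcI)
    have "continuous_map (subtopology (G_top L) W) euclidean (\<lambda>g. h (rg g) * c (gtrans k l V g))"
      using continuous_map_from_subtopology[OF continuous_map_compose[OF continuous_rg h], of W]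
        continuous_map_compose[OF continuous_gtrans[OF b] Cc_D(1)[OF c]]
      unfolding W_def by (intro continuous_map_complex_mult) (simp_all add: comp_def)
    then show "continuous_map (G_top L) euclidean d"
      unfolding d_def by (rule continuous_map_clopen_extension[OF W])
    show "compactin (G_top L) K'"
    proof -
      let ?W' = "{g \<in> GL L. rg g \<in> V}"
      have "closedin (G_top L) ?W'"
        using clopenin_rg[of V] b by (simp add: bis_def clopenin_def)
      then have "compactin (G_top L) (?W' \<inter> K)"
        using K(1) by (rule closed_Int_compactin)
      then have "compactin (subtopology (G_top L) ?W') (?W' \<inter> K)"
        by (simp add: compactin_subtopology)
      from image_compactin[OF this continuous_gtrans[OF bis_sym[OF b]]]
      have "compactin (G_top L) (gtrans l k U ` (?W' \<inter> K))" .
      moreover have "gtrans l k U ` (?W' \<inter> K) = K'"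
      proof (intro set_eqI iffI)
        fix g assume "g \<in> gtrans l k U ` (?W' \<inter> K)"
        then obtain g' where g': "g = gtrans l k U g'" "g' \<in> GL L" "rg g' \<in> V" "g' \<in> K" by blast
        then show "g \<in> K'"
          using GL_gtrans[OF bis_sym[OF b] g'(2,3)] gtrans_gtrans[OF bis_sym[OF b] g'(3)] partner_in[OF bis_sym[OF b] g'(3)]
          by (simp add: K'_def) (simp add: gtrans_def)
      next
        fix g assume g: "g \<in> K'"
        then have "gtrans k l V g \<in> ?W' \<inter> K"
          using GL_gtrans[OF b] partner_in[OF b] by (auto simp: K'_def gtrans_def)
        moreover have "g = gtrans l k U (gtrans k l V g)"
          using gtrans_gtrans[OF b, of g] g by (simp add: K'_def)
        ultimately show "g \<in> gtrans l k U ` (?W' \<inter> K)" by blast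
      qed
      ultimately show ?thesis by simp
    qed
    show "closedin (G_top L) K'"
    proof -
      have "openin (G_top L) {g \<in> GL L. rg g \<in> U \<and> gtrans k l V g \<in> topspace (G_top L) - K}"
        by (rule openin_gtrans[OF b]) (use K(2) in \<open>simp add: clopenin_def openin_diff del: topspace_G\<close>)
      moreover have "K' = W - {g \<in> GL L. rg g \<in> U \<and> gtrans k l V g \<in> topspace (G_top L) - K}"
        using GL_gtrans[OF b] by (auto simp: K'_def W_def)
      ultimately show ?thesis
        using W by (simp only: clopenin_def closedin_diff)
    qed
    show "g \<in> K'" if "d g \<noteq> 0" for g
      using that B(3) by (auto simp: d_def K'_def W_def K_def split: if_splits)
    show "d g = 0" if "g \<notin> GL L" for g
      using that by (simp add: d_def W_def)
  qed
  have "lam L (bisfun h U k l V) \<circ> lam L c = lam L d"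
  proof (rule bounded_op_eqI)
    show "bounded_op L (lam L (bisfun h U k l V) \<circ> lam L c)"
      by (intro bounded_op_comp bounded_op_lam c bisfun_Cc b h)
    show "bounded_op L (lam L d)"
      by (rule bounded_op_lam[OF dC])
    fix b' g assume *: "b' \<in> GL L" "g \<in> GL L"
    have e: "lam L c (delta b') \<in> ell2 L"
      by (rule bounded_op_ell2'[OF bounded_op_lam[OF c]])
    show "(lam L (bisfun h U k l V) \<circ> lam L c) (delta b') g = lam L d (delta b') g"
    proof (cases "sc g = sc b' \<and> rg g \<in> U")
      case True
      have "lam L c (delta b') (gtrans k l V g) = c (gquot (gtrans k l V g) b')"
        using lam_delta[OF *(1) GL_gtrans[OF b *(2)]] True by (simp add: gtrans_def)
      moreover have "gquot (gtrans k l V g) b' = gtrans k l V (gquot g b')"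
        by (simp add: gquot_def gtrans_def)
      moreover have "gquot g b' \<in> W" "rg (gquot g b') = rg g"
        using True GL_quot[OF *(2,1)] by (auto simp: W_def gquot_def)
      ultimately show ?thesis
        using True * by (simp add: lam_bisfun[OF b e] lam_delta) (simp add: d_def)
    next
      case False
      have "lam L c (delta b') (gtrans k l V g) = 0" if "sc g \<noteq> sc b'" "rg g \<in> U"
        using lam_delta[OF *(1) GL_gtrans[OF b *(2) that(2)], of c] that by (simp add: gtrans_def)
      moreover have "gquot g b' \<notin> W" if "rg g \<notin> U"
        using that by (simp add: W_def gquot_def)
      ultimately show ?thesis
        using False * by (auto simp: lam_bisfun[OF b e] lam_delta d_def)
    qed
  qed
  with dC show ?thesis
    using that by blast
qed

lemma conv_Cc:
  assumes "a \<in> Cc L" and c: "c \<in> Cc L"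
  shows "\<exists>d\<in>Cc L. lam L a \<circ> lam L c = lam L d"
  using assms(1)
proof (induction rule: Cc_induct)
  case zero
  have "lam L (\<lambda>_. 0) \<circ> lam L c = lam L (\<lambda>_. 0)"
    by (intro ext) (simp add: lam_def)
  then show ?case
    using zero_Cc by blast
next
  case (add a h U k l V)
  have b: "bis L U k l V" and h: "continuous_map (X_top L) euclidean h" and a: "a \<in> Cc L"
    using add by auto
  from add obtain d where d: "d \<in> Cc L" "lam L a \<circ> lam L c = lam L d" by blast
  obtain d' where d': "d' \<in> Cc L" "lam L (bisfun h U k l V) \<circ> lam L c = lam L d'"
    using conv_bisfun_Cc[OF b h c] .
  have "lam L (\<lambda>g. a g + bisfun h U k l V g) \<circ> lam L c = op_add (lam L a \<circ> lam L c) (lam L (bisfun h U k l V) \<circ> lam L c)"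
    unfolding lam_add[OF a bisfun_Cc[OF b h]] by (simp add: op_add_def comp_def)
  then have "lam L (\<lambda>g. a g + bisfun h U k l V g) \<circ> lam L c = lam L (\<lambda>g. d g + d' g)"
    unfolding d(2) d'(2) lam_add[OF d(1) d'(1)] .
  then show ?case
    using add_Cc[OF d(1) d'(1)] by blast
qed

lemma OL_comp:
  assumes S: "S \<in> OL L" and T: "T \<in> OL L"
  shows "S \<circ> T \<in> OL L"
  unfolding OL_def
proof (intro CollectI conjI allI impI)
  have bS: "bounded_op L S" and bT: "bounded_op L T"
    using S T OL_bounded by auto
  show "bounded_op L (S \<circ> T)"
    by (rule bounded_op_comp(1)[OF bS bT])
  fix e :: real assume e: "e > 0"
  define e1 where "e1 = e / 2 / (opnorm L T + 1)"
  have tT: "opnorm L T + 1 > 0"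
    using opnorm_nonneg[OF bT] by linarith
  then have "e1 > 0"
    using e by (simp add: e1_def)
  then obtain a where a: "a \<in> Cc L" "opnorm L (op_diff S (lam L a)) < e1"
    using OL_approx[OF S] by blast
  define e2 where "e2 = e / 2 / (opnorm L (lam L a) + 1)"
  have ba: "bounded_op L (lam L a)"
    by (rule bounded_op_lam[OF a(1)])
  have ta: "opnorm L (lam L a) + 1 > 0"
    using opnorm_nonneg[OF ba] by linarith
  then have "e2 > 0"
    using e by (simp add: e2_def)
  then obtain c where c: "c \<in> Cc L" "opnorm L (op_diff T (lam L c)) < e2"
    using OL_approx[OF T] by blast
  have bc: "bounded_op L (lam L c)"
    by (rule bounded_op_lam[OF c(1)])
  obtain d where d: "d \<in> Cc L" "lam L a \<circ> lam L c = lam L d"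
    using conv_Cc[OF a(1) c(1)] by blast
  have eq: "op_diff (S \<circ> T) (lam L d) = op_add (op_diff S (lam L a) \<circ> T) (lam L a \<circ> op_diff T (lam L c))"
    unfolding d(2)[symmetric]
    by (intro ext) (simp add: op_diff_def op_add_def bounded_op_diff[OF ba bounded_op_ell2'[OF bT] bounded_op_ell2'[OF bc]])
  have b1: "bounded_op L (op_diff S (lam L a))" and b2: "bounded_op L (op_diff T (lam L c))"
    by (intro bounded_op_op_diff bS bT ba bc)+
  have "opnorm L (op_diff (S \<circ> T) (lam L d)) \<le> opnorm L (op_diff S (lam L a) \<circ> T) + opnorm L (lam L a \<circ> op_diff T (lam L c))"
    unfolding eq by (intro bounded_op_op_add bounded_op_comp b1 b2 bT ba)
  also have "\<dots> \<le> opnorm L (op_diff S (lam L a)) * opnorm L T + opnorm L (lam L a) * opnorm L (op_diff T (lam L c))"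
    by (intro add_mono bounded_op_comp b1 b2 bT ba)
  also have "\<dots> \<le> e1 * opnorm L T + opnorm L (lam L a) * e2"
    using a(2) c(2) opnorm_nonneg[OF bT] opnorm_nonneg[OF ba] by (intro add_mono mult_right_mono mult_left_mono) auto
  also have "\<dots> < e"
  proof -
    have "e1 * opnorm L T < e / 2" "opnorm L (lam L a) * e2 < e / 2"
      using e tT ta opnorm_nonneg[OF bT] opnorm_nonneg[OF ba] by (auto simp: e1_def e2_def field_simps)
    then show ?thesis by linarith
  qed
  finally show "\<exists>a\<in>Cc L. opnorm L (op_diff (S \<circ> T) (lam L a)) < e"
    using d(1) by blast
qed

lemma star_Cc:
  assumes a: "a \<in> Cc L"
  shows "(\<lambda>g. cnj (a (ginv g))) \<in> Cc L"
proof -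
  obtain \<B> where B: "finite \<B>" "\<B> \<subseteq> bisets L" "{g. a g \<noteq> 0} \<subseteq> \<Union>\<B>"
    using Cc_bisets[OF a] .
  show ?thesis
  proof (rule CcI_bisets[of _ "(\<lambda>B. ginv ` B) ` \<B>"])
    show "continuous_map (G_top L) euclidean (\<lambda>g. cnj (a (ginv g)))"
      using continuous_map_compose[OF continuous_ginv Cc_D(1)[OF a]]
      by (intro continuous_map_complex_cnj) (simp add: comp_def)
    show "cnj (a (ginv g)) = 0" if "g \<notin> GL L" for g
      using Cc_D(2)[OF a, of "ginv g"] that by simp
    have inv_Z: "ginv ` Zset U k l V = Zset V l k U" for U :: "(nat \<Rightarrow> 'a \<times> (nat \<Rightarrow> 'v)) set" and k l V
    proof (intro set_eqI iffI)
      fix g assume "g \<in> Zset V l k U"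
      then have "ginv g \<in> Zset U k l V"
        by (auto simp: Zset_iff)
      then show "g \<in> ginv ` Zset U k l V"
        by (rule rev_image_eqI) simp
    qed (auto simp: Zset_iff)
    show "(\<lambda>B. ginv ` B) ` \<B> \<subseteq> bisets L"
    proof (intro image_subsetI)
      fix B' assume "B' \<in> \<B>"
      then obtain U k l V where "B' = Zset U k l V" "bis L U k l V"
        using B(2) by (auto simp: bisets_def)
      then show "ginv ` B' \<in> bisets L"
        using bis_sym inv_Z unfolding bisets_def by blast
    qed
    show "{g. cnj (a (ginv g)) \<noteq> 0} \<subseteq> \<Union>((\<lambda>B. ginv ` B) ` \<B>)"
    proof
      fix g assume "g \<in> {g. cnj (a (ginv g)) \<noteq> 0}"
      then obtain B' where "B' \<in> \<B>" "ginv g \<in> B'"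
        using B(3) by auto
      then show "g \<in> \<Union>((\<lambda>B. ginv ` B) ` \<B>)"
        by (metis UN_I ginv_inv imageI)
    qed
  qed (use B(1) in simp)
qed

lemma ginv_gquot: "ginv (gquot g b) = gquot b g"
  by (simp add: ginv_def gquot_def)

lemma op_adj_lam:
  assumes "a \<in> Cc L"
  shows "op_adj L (lam L a) = lam L (\<lambda>g. cnj (a (ginv g)))"
  by (rule op_adj_eqI[OF bounded_op_lam[OF assms] bounded_op_lam[OF star_Cc[OF assms]]])
     (simp add: lam_delta ginv_gquot)

lemma OL_adj:
  assumes T: "T \<in> OL L"
  shows "op_adj L T \<in> OL L"
  unfolding OL_def
proof (intro CollectI conjI allI impI)
  have bT: "bounded_op L T"
    by (rule OL_bounded[OF T])
  show "bounded_op L (op_adj L T)"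
    by (rule bounded_op_op_adj[OF bT])
  fix e :: real assume "e > 0"
  then obtain a where a: "a \<in> Cc L" "opnorm L (op_diff T (lam L a)) < e"
    using OL_approx[OF T] by blast
  have "op_diff (op_adj L T) (lam L (\<lambda>g. cnj (a (ginv g)))) = op_adj L (op_diff T (lam L a))"
    by (simp add: op_adj_op_diff[OF bT bounded_op_lam[OF a(1)]] op_adj_lam[OF a(1)])
  then have "opnorm L (op_diff (op_adj L T) (lam L (\<lambda>g. cnj (a (ginv g))))) < e"
    using bounded_op_op_adj(2)[OF bounded_op_op_diff[OF bT bounded_op_lam[OF a(1)]]] a(2) by simp
  then show "\<exists>a\<in>Cc L. opnorm L (op_diff (op_adj L T) (lam L a)) < e"
    using star_Cc[OF a(1)] by blast
qed

lemma bis_unit: "bis L (XL L) 0 0 (XL L)"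
  using clopenin_topspace[of "X_top L"] by (auto simp: bis_def inj_on_def)

text \<open>The unit space is the bisection with both exponents 0, so diagonal operators inherit
  boundedness and membership in \<open>OL L\<close> from bisection operators.\<close>

lemma lam_dfun_bisfun: "lam L (dfun h) = lam L (bisfun h (XL L) 0 0 (XL L))"
proof (intro ext)
  fix \<xi> g
  show "lam L (dfun h) \<xi> g = lam L (bisfun h (XL L) 0 0 (XL L)) \<xi> g"
  proof (cases "\<xi> \<in> ell2 L \<and> g \<in> GL L")
    case True
    then have "gtrans 0 0 (XL L) g = g"
      using partner_eqI[OF bis_unit, of "rg g" "rg g"] GL_rg[of g L] by (simp add: gtrans_def)
    then show ?thesis
      using True GL_rg[of g L] by (simp add: lam_dfun lam_bisfun[OF bis_unit])
  next
    case False
    then show ?thesis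
      by (auto simp: lam_outside lam_outside_GL)
  qed
qed

lemma lam_dfun_OL: "continuous_map (X_top L) euclidean h \<Longrightarrow> lam L (dfun h) \<in> OL L"
  unfolding lam_dfun_bisfun by (intro lam_OL bisfun_Cc bis_unit)

lemma DL_subset_OL: "DL L \<subseteq> OL L"
  unfolding DL_eq using lam_dfun_OL by blast

end

section \<open>Conjugation by a groupoid isomorphism\<close>

definition gtr :: "('v, 'e, 'a) lgs \<Rightarrow> (('v, 'a) gel \<Rightarrow> 'b) \<Rightarrow> ('b \<Rightarrow> complex) \<Rightarrow> ('v, 'a) gel \<Rightarrow> complex" where
  "gtr L \<phi> \<xi> = (\<lambda>g. if g \<in> GL L then \<xi> (\<phi> g) else 0)"

text \<open>Conjugation by the unitary that permutes the basis along \<phi>; the two pullbacks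
  \<open>gtr\<close> are this unitary and its inverse.\<close>

definition conj_op :: "('v1, 'e1, 'a1) lgs \<Rightarrow> ('v2, 'e2, 'a2) lgs \<Rightarrow> (('v1, 'a1) gel \<Rightarrow> ('v2, 'a2) gel)
     \<Rightarrow> (('v2, 'a2) gel \<Rightarrow> ('v1, 'a1) gel) \<Rightarrow> ('v1, 'a1) gop \<Rightarrow> ('v2, 'a2) gop" where
  "conj_op L1 L2 \<phi> \<psi> T = (\<lambda>\<eta>. if \<eta> \<in> ell2 L2 then gtr L2 \<psi> (T (gtr L1 \<phi> \<eta>)) else (\<lambda>_. 0))"

locale gpair = A: lgsys L1 + B: lgsys L2
  for L1 :: "('v1, 'e1, 'a1) lgs" and L2 :: "('v2, 'e2, 'a2) lgs" +
  fixes \<phi> :: "('v1, 'a1) gel \<Rightarrow> ('v2, 'a2) gel" and \<psi> :: "('v2, 'a2) gel \<Rightarrow> ('v1, 'a1) gel"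
  assumes iso: "groupoid_iso L1 L2 \<phi>" and iso': "groupoid_iso L2 L1 \<psi>"
    and \<psi>\<phi>: "\<And>g. g \<in> GL L1 \<Longrightarrow> \<psi> (\<phi> g) = g" and \<phi>\<psi>: "\<And>g. g \<in> GL L2 \<Longrightarrow> \<phi> (\<psi> g) = g"

text \<open>The inverse is again an isomorphism, so the locale is symmetric and each fact about
  \<phi> is available for \<psi> through \<open>sym\<close>.\<close>

lemma groupoid_iso_gpair:
  assumes "lgsys L1" "lgsys L2" and iso: "groupoid_iso L1 L2 \<phi>"
  shows "gpair L1 L2 \<phi> (inv_into (GL L1) \<phi>)"
proof -
  interpret A: lgsys L1 by fact
  interpret B: lgsys L2 by fact
  define \<psi> where "\<psi> = inv_into (GL L1) \<phi>"
  have bij: "bij_betw \<phi> (GL L1) (GL L2)" and hom: "homeomorphic_map (G_top L1) (G_top L2) \<phi>"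
    and mult: "\<And>g h. g \<in> GL L1 \<Longrightarrow> h \<in> GL L1 \<Longrightarrow> (gcomp g h \<longleftrightarrow> gcomp (\<phi> g) (\<phi> h)) \<and>
        (gcomp g h \<longrightarrow> \<phi> (gmult g h) = gmult (\<phi> g) (\<phi> h))"
    using iso unfolding groupoid_iso_def by blast+
  have \<psi>\<phi>: "\<psi> (\<phi> g) = g" if "g \<in> GL L1" for g
    using bij that by (simp add: \<psi>_def bij_betw_inv_into_left)
  have \<phi>\<psi>: "\<phi> (\<psi> g) = g" if "g \<in> GL L2" for g
    using bij that by (simp add: \<psi>_def bij_betw_inv_into_right)
  have \<psi>_GL: "\<psi> g \<in> GL L1" if "g \<in> GL L2" for g
    using bij_betw_inv_into[OF bij] that unfolding \<psi>_def by (rule bij_betw_apply)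
  have "homeomorphic_map (G_top L2) (G_top L1) \<psi>"
  proof -
    \<comment> \<open>The continuous inverse supplied by the homeomorphism is identified with the
      set-theoretic inverse on the topological space.\<close>
    obtain \<psi>' where \<psi>': "homeomorphic_maps (G_top L1) (G_top L2) \<phi> \<psi>'"
      using hom unfolding homeomorphic_map_maps by blast
    then have "homeomorphic_map (G_top L2) (G_top L1) \<psi>'"
      using homeomorphic_maps_map by blast
    moreover have "\<psi>' g = \<psi> g" if "g \<in> topspace (G_top L2)" for g
      using \<psi>' that \<psi>_GL[of g] \<phi>\<psi>[of g] unfolding homeomorphic_maps_def B.topspace_G A.topspace_G by metis
    ultimately show ?thesis
      by (rule homeomorphic_map_eq)
  qed
  moreover have "(gcomp g h \<longleftrightarrow> gcomp (\<psi> g) (\<psi> h)) \<and> (gcomp g h \<longrightarrow> \<psi> (gmult g h) = gmult (\<psi> g) (\<psi> h))"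
    if g: "g \<in> GL L2" and h: "h \<in> GL L2" for g h
  proof -
    have c: "gcomp g h \<longleftrightarrow> gcomp (\<psi> g) (\<psi> h)"
      using mult[OF \<psi>_GL[OF g] \<psi>_GL[OF h]] by (simp add: \<phi>\<psi> g h)
    moreover have "\<psi> (gmult g h) = gmult (\<psi> g) (\<psi> h)" if gh: "gcomp g h"
    proof -
      have "gmult (\<psi> g) (\<psi> h) \<in> GL L1"
        using gh c by (intro GL_mult \<psi>_GL g h) (simp add: gcomp_def)
      moreover have "\<phi> (gmult (\<psi> g) (\<psi> h)) = gmult g h"
        using mult[OF \<psi>_GL[OF g] \<psi>_GL[OF h]] gh c by (simp add: \<phi>\<psi> g h)
      ultimately show ?thesis
        using \<psi>\<phi> by metis
    qed
    ultimately show ?thesis by blast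
  qed
  ultimately have "groupoid_iso L2 L1 \<psi>"
    using bij_betw_inv_into[OF bij] unfolding groupoid_iso_def \<psi>_def by (intro conjI ballI) auto
  then show ?thesis
    unfolding \<psi>_def[symmetric] using iso \<psi>\<phi> \<phi>\<psi>
    by unfold_locales auto
qed

context gpair begin

lemma sym: "gpair L2 L1 \<psi> \<phi>"
  by unfold_locales (fact iso iso' \<psi>\<phi> \<phi>\<psi>)+

lemma \<phi>_GL: "g \<in> GL L1 \<Longrightarrow> \<phi> g \<in> GL L2"
  using iso unfolding groupoid_iso_def by (meson bij_betw_apply)

lemma \<psi>_GL: "g \<in> GL L2 \<Longrightarrow> \<psi> g \<in> GL L1"
  using iso' unfolding groupoid_iso_def by (meson bij_betw_apply)

lemma inj_\<phi>: "inj_on \<phi> (GL L1)"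
  by (rule inj_on_inverseI) (rule \<psi>\<phi>)

lemma \<phi>_mult:
  assumes "g \<in> GL L1" "h \<in> GL L1" "sc g = rg h"
  shows "sc (\<phi> g) = rg (\<phi> h)" "\<phi> (gmult g h) = gmult (\<phi> g) (\<phi> h)"
  using iso assms unfolding groupoid_iso_def gcomp_def by blast+

text \<open>The notion of isomorphism speaks of products. Applying it to g, written as the product
  of \<open>gquot g b\<close> and b, yields quotients and shows that equality of sources is
  preserved.\<close>

lemma \<phi>_quot:
  assumes "g \<in> GL L1" "b \<in> GL L1" "sc g = sc b"
  shows "\<phi> (gquot g b) = gquot (\<phi> g) (\<phi> b)" "sc (\<phi> g) = sc (\<phi> b)"
proof -
  have c: "gquot g b \<in> GL L1"
    by (rule GL_quot[OF assms])
  have "gmult (gquot g b) b = g"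
    using assms(3) by (simp add: gmult_def gquot_def prod_eq_iff)
  then have "\<phi> g = gmult (\<phi> (gquot g b)) (\<phi> b)" "sc (\<phi> (gquot g b)) = rg (\<phi> b)"
    using \<phi>_mult[OF c assms(2)] by (simp_all add: gquot_def)
  then show "\<phi> (gquot g b) = gquot (\<phi> g) (\<phi> b)" "sc (\<phi> g) = sc (\<phi> b)"
    by (simp_all add: gmult_def gquot_def prod_eq_iff)
qed

lemma \<phi>_sc_iff:
  assumes "g \<in> GL L1" "b \<in> GL L1"
  shows "sc (\<phi> g) = sc (\<phi> b) \<longleftrightarrow> sc g = sc b"
  using \<phi>_quot(2)[OF assms] gpair.\<phi>_quot(2)[OF sym \<phi>_GL[OF assms(1)] \<phi>_GL[OF assms(2)]]
    \<psi>\<phi>[OF assms(1)] \<psi>\<phi>[OF assms(2)] by metis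

lemma \<phi>_unit_rg:
  assumes "g \<in> GL L1"
  shows "\<phi> (gunit (rg g)) = gunit (rg (\<phi> g))"
  using \<phi>_quot(1)[OF assms assms] by (simp add: gquot_def gunit_def)

lemma gtr_gtr: "\<eta> \<in> ell2 L2 \<Longrightarrow> gtr L2 \<psi> (gtr L1 \<phi> \<eta>) = \<eta>"
  using \<phi>\<psi> \<psi>_GL ell2_outside[of \<eta> L2] by (auto simp: gtr_def fun_eq_iff simp del: split_paired_All)

lemma gtr_ell2:
  assumes \<eta>: "\<eta> \<in> ell2 L2"
  shows "gtr L1 \<phi> \<eta> \<in> ell2 L1" "l2norm (gtr L1 \<phi> \<eta>) \<le> l2norm \<eta>"
proof -
  have "inj_on \<phi> {g. gtr L1 \<phi> \<eta> g \<noteq> 0}"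
    by (rule inj_on_subset[OF inj_\<phi>]) (auto simp: gtr_def split: if_splits)
  note * = sq_summable_reindex[OF ell2_sq[OF \<eta>] this, of 1]
  have "sq_summable (gtr L1 \<phi> \<eta>)"
    by (rule *(1)) (simp_all add: gtr_def)
  then show "gtr L1 \<phi> \<eta> \<in> ell2 L1"
    by (simp add: ell2_iff) (simp add: gtr_def)
  have "l2norm (gtr L1 \<phi> \<eta>) \<le> 1 * l2norm \<eta>"
    by (rule *(2)) (simp_all add: gtr_def)
  then show "l2norm (gtr L1 \<phi> \<eta>) \<le> l2norm \<eta>" by simp
qed

lemma gtr_delta:
  assumes "b \<in> GL L2"
  shows "gtr L1 \<phi> (delta b) = delta (\<psi> b)"
  using assms \<psi>_GL \<psi>\<phi> \<phi>\<psi> by (auto simp: gtr_def delta_def fun_eq_iff simp del: split_paired_All)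

abbreviation "\<Phi> \<equiv> conj_op L1 L2 \<phi> \<psi>"

lemma conj_delta:
  assumes "b \<in> GL L2" "g \<in> GL L2"
  shows "\<Phi> T (delta b) g = T (delta (\<psi> b)) (\<psi> g)"
  using assms by (simp add: conj_op_def gtr_delta) (simp add: gtr_def)

lemma conj_bounded:
  assumes T: "bounded_op L1 T"
  shows "bounded_op L2 (\<Phi> T)" "opnorm L2 (\<Phi> T) \<le> opnorm L1 T"
proof -
  have in_ell2: "\<Phi> T \<eta> \<in> ell2 L2" if "\<eta> \<in> ell2 L2" for \<eta>
    using gpair.gtr_ell2(1)[OF sym bounded_op_ell2'[OF T]] that by (simp add: conj_op_def)
  have le: "l2norm (\<Phi> T \<eta>) \<le> opnorm L1 T * l2norm \<eta>" if \<eta>: "\<eta> \<in> ell2 L2" for \<eta>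
  proof -
    have "l2norm (\<Phi> T \<eta>) \<le> l2norm (T (gtr L1 \<phi> \<eta>))"
      using gpair.gtr_ell2(2)[OF sym bounded_op_ell2'[OF T]] \<eta> by (simp add: conj_op_def)
    also have "\<dots> \<le> opnorm L1 T * l2norm (gtr L1 \<phi> \<eta>)"
      by (rule bounded_op_le_opnorm[OF T gtr_ell2(1)[OF \<eta>]])
    also have "\<dots> \<le> opnorm L1 T * l2norm \<eta>"
      by (intro mult_left_mono gtr_ell2 \<eta> opnorm_nonneg T)
    finally show ?thesis .
  qed
  show "opnorm L2 (\<Phi> T) \<le> opnorm L1 T"
    using opnorm_le(1)[OF opnorm_nonneg[OF T] le] by blast
  show "bounded_op L2 (\<Phi> T)"
  proof (rule bounded_opI[OF _ in_ell2 _ opnorm_nonneg[OF T] le])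
    fix \<xi> \<eta> c assume *: "\<xi> \<in> ell2 L2" "\<eta> \<in> ell2 L2"
    have "gtr L1 \<phi> (\<lambda>g. \<xi> g + c * \<eta> g) = (\<lambda>g. gtr L1 \<phi> \<xi> g + c * gtr L1 \<phi> \<eta> g)"
      by (auto simp: gtr_def)
    then show "\<Phi> T (\<lambda>g. \<xi> g + c * \<eta> g) = (\<lambda>g. \<Phi> T \<xi> g + c * \<Phi> T \<eta> g)"
      using * by (simp add: conj_op_def ell2_lincomb bounded_op_linear[OF T gtr_ell2(1) gtr_ell2(1)])
         (auto simp: gtr_def)
  qed (simp_all add: conj_op_def)
qed

lemma conj_op_diff: "\<Phi> (op_diff S T) = op_diff (\<Phi> S) (\<Phi> T)"
  by (intro ext) (simp add: conj_op_def op_diff_def gtr_def)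

lemma conj_op_add: "\<Phi> (op_add S T) = op_add (\<Phi> S) (\<Phi> T)"
  by (intro ext) (simp add: conj_op_def op_add_def gtr_def)

lemma conj_op_scale: "\<Phi> (op_scale c T) = op_scale c (\<Phi> T)"
  by (intro ext) (simp add: conj_op_def op_scale_def gtr_def)

lemma conj_comp:
  assumes S: "bounded_op L1 S" and T: "bounded_op L1 T"
  shows "\<Phi> (S \<circ> T) = \<Phi> S \<circ> \<Phi> T"
proof (rule ext)
  fix \<eta>
  show "\<Phi> (S \<circ> T) \<eta> = (\<Phi> S \<circ> \<Phi> T) \<eta>"
  proof (cases "\<eta> \<in> ell2 L2")
    case True
    have e: "T (gtr L1 \<phi> \<eta>) \<in> ell2 L1"
      by (rule bounded_op_ell2'[OF T])
    then show ?thesis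
      using True gpair.gtr_ell2(1)[OF sym e] gpair.gtr_gtr[OF sym e] by (simp add: conj_op_def)
  next
    case False
    then show ?thesis
      using bounded_op_zero[OF conj_bounded(1)[OF S]] by (simp add: conj_op_def)
  qed
qed

lemma conj_adj:
  assumes T: "bounded_op L1 T"
  shows "\<Phi> (op_adj L1 T) = op_adj L2 (\<Phi> T)"
  by (rule op_adj_eqI[symmetric]; (intro conj_bounded bounded_op_op_adj T)?)
     (simp add: conj_delta op_adj_delta[OF T] \<psi>_GL)

lemma conj_conj:
  assumes T: "bounded_op L1 T"
  shows "conj_op L2 L1 \<psi> \<phi> (\<Phi> T) = T"
proof (rule bounded_op_eqI[OF gpair.conj_bounded(1)[OF sym conj_bounded(1)[OF T]] T])
  fix b g assume "b \<in> GL L1" "g \<in> GL L1"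
  then show "conj_op L2 L1 \<psi> \<phi> (\<Phi> T) (delta b) g = T (delta b) g"
    by (simp add: gpair.conj_delta[OF sym] conj_delta \<phi>_GL \<psi>\<phi>)
qed

lemma gtr_Cc:
  assumes a: "a \<in> Cc L1"
  shows "gtr L2 \<psi> a \<in> Cc L2"
proof (rule B.CcI)
  have c\<psi>: "continuous_map (G_top L2) (G_top L1) \<psi>" and c\<phi>: "continuous_map (G_top L1) (G_top L2) \<phi>"
    using iso iso' unfolding groupoid_iso_def by (simp_all add: homeomorphic_imp_continuous_map)
  let ?K = "G_top L1 closure_of {g. a g \<noteq> 0}"
  have supp: "{g. a g \<noteq> 0} \<subseteq> topspace (G_top L1)"
    using A.Cc_D(2)[OF a] by auto
  have K: "compactin (G_top L1) ?K" "?K \<subseteq> GL L1" "{g. a g \<noteq> 0} \<subseteq> ?K"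
    using a closure_of_subset_topspace[of "G_top L1" "{g. a g \<noteq> 0}"] closure_of_subset[OF supp]
    by (simp_all add: Cc_def)
  show "continuous_map (G_top L2) euclidean (gtr L2 \<psi> a)"
    using continuous_map_compose[OF c\<psi> A.Cc_D(1)[OF a]]
    by (rule continuous_map_eq) (simp add: gtr_def)
  show "compactin (G_top L2) (\<phi> ` ?K)"
    by (rule image_compactin[OF K(1) c\<phi>])
  have "\<phi> ` ?K = {g \<in> topspace (G_top L2). \<psi> g \<in> ?K}"
  proof (intro set_eqI iffI)
    fix d assume "d \<in> \<phi> ` ?K"
    then obtain g where g: "g \<in> ?K" "d = \<phi> g" by blast
    then have "g \<in> GL L1"
      using K(2) by blast
    then show "d \<in> {g \<in> topspace (G_top L2). \<psi> g \<in> ?K}"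
      using g \<phi>_GL \<psi>\<phi> by simp
  next
    fix d assume "d \<in> {g \<in> topspace (G_top L2). \<psi> g \<in> ?K}"
    then have "d = \<phi> (\<psi> d)" "\<psi> d \<in> ?K"
      using \<phi>\<psi> by simp_all
    then show "d \<in> \<phi> ` ?K"
      by (rule image_eqI)
  qed
  then show "closedin (G_top L2) (\<phi> ` ?K)"
    using closedin_continuous_map_preimage[OF c\<psi> closedin_closure_of] by simp
  show "g \<in> \<phi> ` ?K" if "gtr L2 \<psi> a g \<noteq> 0" for g
  proof -
    have "g \<in> GL L2" "a (\<psi> g) \<noteq> 0"
      using that by (auto simp: gtr_def split: if_splits)
    then have "g = \<phi> (\<psi> g)" "\<psi> g \<in> ?K"
      using \<phi>\<psi> subsetD[OF K(3)] by simp_all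
    then show ?thesis
      by (rule image_eqI)
  qed
  show "gtr L2 \<psi> a g = 0" if "g \<notin> GL L2" for g
    using that by (simp add: gtr_def)
qed

lemma conj_lam:
  assumes a: "a \<in> Cc L1"
  shows "\<Phi> (lam L1 a) = lam L2 (gtr L2 \<psi> a)"
proof (rule bounded_op_eqI[OF conj_bounded(1)[OF A.bounded_op_lam[OF a]] B.bounded_op_lam[OF gtr_Cc[OF a]]])
  fix b g assume *: "b \<in> GL L2" "g \<in> GL L2"
  show "\<Phi> (lam L1 a) (delta b) g = lam L2 (gtr L2 \<psi> a) (delta b) g"
  proof (cases "sc g = sc b")
    case True
    then show ?thesis
      using * gpair.\<phi>_quot[OF sym *(2,1)] GL_quot[OF *(2,1)]
      by (simp add: conj_delta lam_delta \<psi>_GL) (simp add: gtr_def)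
  next
    case False
    then show ?thesis
      using * gpair.\<phi>_sc_iff[OF sym *(2,1)] by (simp add: conj_delta lam_delta \<psi>_GL)
  qed
qed

lemma conj_OL:
  assumes T: "T \<in> OL L1"
  shows "\<Phi> T \<in> OL L2"
  unfolding OL_def
proof (intro CollectI conjI allI impI)
  have bT: "bounded_op L1 T"
    by (rule A.OL_bounded[OF T])
  show "bounded_op L2 (\<Phi> T)"
    by (rule conj_bounded[OF bT])
  fix e :: real assume "e > 0"
  then obtain a where a: "a \<in> Cc L1" "opnorm L1 (op_diff T (lam L1 a)) < e"
    using A.OL_approx[OF T] by blast
  have "opnorm L2 (op_diff (\<Phi> T) (lam L2 (gtr L2 \<psi> a))) < e"
    using conj_bounded(2)[OF bounded_op_op_diff[OF bT A.bounded_op_lam[OF a(1)]]] a(2)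
    by (simp add: conj_op_diff conj_lam[OF a(1)])
  then show "\<exists>a\<in>Cc L2. opnorm L2 (op_diff (\<Phi> T) (lam L2 a)) < e"
    using gtr_Cc[OF a(1)] by blast
qed

lemma conj_DL:
  assumes "T \<in> DL L1"
  shows "\<Phi> T \<in> DL L2"
proof -
  obtain h where T: "T = lam L1 (dfun h)" and h: "continuous_map (X_top L1) euclidean h"
    using assms unfolding DL_eq by blast
  \<comment> \<open>The diagonal function transported along the action of \<psi> on units.\<close>
  define h' where "h' = (\<lambda>x. h (rg (\<psi> (gunit x))))"
  have c\<psi>: "continuous_map (G_top L2) (G_top L1) \<psi>"
    using iso' unfolding groupoid_iso_def by (simp add: homeomorphic_imp_continuous_map)
  have "continuous_map (X_top L2) (G_top L2) gunit"
  proof -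
    have "continuous_map (subtopology (X_top L2) (XL L2)) (G_top L2) (\<lambda>x. (x, int 0 - int 0, partner 0 0 (XL L2) x))"
      by (rule B.continuous_section[OF B.bis_unit])
    then have "continuous_map (X_top L2) (G_top L2) (\<lambda>x. (x, int 0 - int 0, partner 0 0 (XL L2) x))"
      using subtopology_topspace[of "X_top L2"] by simp
    then show ?thesis
      by (rule continuous_map_eq) (simp add: gunit_def partner_eqI[OF B.bis_unit])
  qed
  from continuous_map_compose[OF continuous_map_compose[OF continuous_map_compose[OF this c\<psi>] A.continuous_rg] h]
  have h': "continuous_map (X_top L2) euclidean h'"
    by (simp add: h'_def comp_def)
  have "\<Phi> T = lam L2 (dfun h')"
  proof (rule bounded_op_eqI)
    show "bounded_op L2 (\<Phi> T)" "bounded_op L2 (lam L2 (dfun h'))"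
      unfolding T by (intro conj_bounded A.OL_bounded B.OL_bounded A.lam_dfun_OL B.lam_dfun_OL h h')+
    fix b g assume *: "b \<in> GL L2" "g \<in> GL L2"
    have "rg (\<psi> g) = rg (\<psi> (gunit (rg g)))"
      using gpair.\<phi>_unit_rg[OF sym *(2)] by (simp add: gunit_def)
    moreover have "delta (\<psi> b) (\<psi> g) = delta b g"
      using * \<phi>\<psi> unfolding delta_def by metis
    ultimately show "\<Phi> T (delta b) g = lam L2 (dfun h') (delta b) g"
      using * by (simp add: T conj_delta lam_dfun \<psi>_GL h'_def)
  qed
  then show ?thesis
    using h' unfolding DL_eq by blast
qed

lemma conj_gauge:
  assumes T: "bounded_op L1 T" and f: "\<And>g. g \<in> GL L1 \<Longrightarrow> f1 g = f2 (\<phi> g)"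
  shows "\<Phi> (gen_gauge L1 f1 t T) = gen_gauge L2 f2 t (\<Phi> T)"
proof (intro ext)
  fix \<eta> g
  show "\<Phi> (gen_gauge L1 f1 t T) \<eta> g = gen_gauge L2 f2 t (\<Phi> T) \<eta> g"
  proof (cases "\<eta> \<in> ell2 L2")
    case True
    let ?\<eta> = "\<lambda>g'. cis (- (2 * pi * t * of_int (f2 g'))) * \<eta> g'"
    have "sq_summable ?\<eta>"
      by (rule sq_summable_mult_bounded(1)[OF ell2_sq[OF True], of 1]) (simp_all add: norm_mult)
    then have e: "?\<eta> \<in> ell2 L2"
      using ell2_outside[OF True] by (simp add: ell2_iff del: split_paired_All)
    have "(\<lambda>g'. cis (- (2 * pi * t * of_int (f1 g'))) * gtr L1 \<phi> \<eta> g') = gtr L1 \<phi> ?\<eta>"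
      using f by (auto simp: gtr_def fun_eq_iff simp del: split_paired_All)
    moreover have "f1 (\<psi> g) = f2 g" if "g \<in> GL L2"
      using f[OF \<psi>_GL[OF that]] \<phi>\<psi>[OF that] by simp
    ultimately show ?thesis
      using True e gtr_ell2(1)[OF True] by (simp add: conj_op_def gen_gauge_def) (simp add: gtr_def)
  next
    case False
    then show ?thesis
      by (simp add: conj_op_def gen_gauge_def)
  qed
qed

lemma conj_star_iso: "star_iso L1 L2 \<Phi>"
  unfolding star_iso_def
proof (intro conjI ballI allI)
  show "bij_betw \<Phi> (OL L1) (OL L2)"
    by (rule bij_betw_byWitness[where f' = "conj_op L2 L1 \<psi> \<phi>"])
       (use conj_conj A.OL_bounded B.OL_bounded gpair.conj_conj[OF sym] conj_OL gpair.conj_OL[OF sym] in auto)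
qed (auto simp: conj_op_add conj_op_scale intro: conj_comp conj_adj A.OL_bounded)

lemma conj_DL_image: "\<Phi> ` DL L1 = DL L2"
proof
  show "\<Phi> ` DL L1 \<subseteq> DL L2"
    using conj_DL by blast
  show "DL L2 \<subseteq> \<Phi> ` DL L1"
  proof
    fix T assume T: "T \<in> DL L2"
    then have "\<Phi> (conj_op L2 L1 \<psi> \<phi> T) = T"
      using gpair.conj_conj[OF sym] B.DL_subset_OL B.OL_bounded by blast
    then show "T \<in> \<Phi> ` DL L1"
      using gpair.conj_DL[OF sym T] by (metis imageI)
  qed
qed

end

lemma groupoid_iso_imp_star_iso:
  assumes "lgsys L1" "lgsys L2" "groupoid_iso L1 L2 \<phi>" "\<And>g. g \<in> GL L1 \<Longrightarrow> f1 g = f2 (\<phi> g)"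
  shows "\<exists>\<Phi>. star_iso L1 L2 \<Phi> \<and> \<Phi> ` DL L1 = DL L2 \<and>
            (\<forall>t::real. \<forall>T\<in>OL L1. \<Phi> (gen_gauge L1 f1 t T) = gen_gauge L2 f2 t (\<Phi> T))"
proof -
  interpret gpair L1 L2 \<phi> "inv_into (GL L1) \<phi>"
    by (rule groupoid_iso_gpair[OF assms(1-3)])
  show ?thesis
    using conj_star_iso conj_DL_image conj_gauge[of _ f1 f2, OF A.OL_bounded assms(4)]
    by (intro exI[of _ "conj_op L1 L2 \<phi> (inv_into (GL L1) \<phi>)"] conjI ballI allI)
qed

section \<open>Diagonal projections and Stone duality\<close>

text \<open>The sets H C with C containing x are nonempty and closed under finite intersections, so
  by compactness they have a common point y. Passing to complements shows that y lies in no other H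
  C.\<close>

lemma clopen_iso_point:
  assumes Y: "compact_space Y" and H: "\<And>C. clopenin X C \<Longrightarrow> clopenin Y (H C)"
    and inj: "\<And>C. clopenin X C \<Longrightarrow> H C = {} \<Longrightarrow> C = {}" and empty: "H {} = {}"
    and inter: "\<And>C D. clopenin X C \<Longrightarrow> clopenin X D \<Longrightarrow> H (C \<inter> D) = H C \<inter> H D"
    and x: "x \<in> topspace X"
  shows "\<exists>y\<in>topspace Y. \<forall>C. clopenin X C \<longrightarrow> (x \<in> C \<longleftrightarrow> y \<in> H C)"
proof -
  have "\<exists>y\<in>topspace Y. \<forall>C. clopenin X C \<and> x \<in> C \<longrightarrow> y \<in> H C"
  proof (rule ccontr)
    assume "\<not> ?thesis"
    then have cover: "topspace Y \<subseteq> \<Union>((\<lambda>C. topspace Y - H C) ` {C. clopenin X C \<and> x \<in> C})"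
      by auto
    have op: "\<forall>S\<in>(\<lambda>C. topspace Y - H C) ` {C. clopenin X C \<and> x \<in> C}. openin Y S"
      using H by (auto simp: clopenin_def openin_diff)
    have "compactin Y (topspace Y)"
      using Y by (simp add: compact_space_def)
    then obtain \<F> where \<F>: "finite \<F>" "\<F> \<subseteq> (\<lambda>C. topspace Y - H C) ` {C. clopenin X C \<and> x \<in> C}" "topspace Y \<subseteq> \<Union>\<F>"
      using op cover unfolding compactin_def by meson
    obtain F where F: "F \<subseteq> {C. clopenin X C \<and> x \<in> C}" "finite F" "\<F> = (\<lambda>C. topspace Y - H C) ` F"
      using finite_subset_image[OF \<F>(1,2)] by (elim exE conjE)
    have F3: "topspace Y \<subseteq> \<Union>((\<lambda>C. topspace Y - H C) ` F)"
      using \<F>(3) F(3) by simp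
    have "\<exists>C. clopenin X C \<and> x \<in> C \<and> (\<forall>C'\<in>F. H C \<subseteq> H C')"
      using F(2,1)
    proof (induction rule: finite_induct)
      case empty
      then show ?case using x clopenin_topspace by blast
    next
      case (insert C F)
      then obtain C1 where "clopenin X C1" "x \<in> C1" "\<forall>C'\<in>F. H C1 \<subseteq> H C'" by auto
      then show ?case
        using insert.prems clopenin_Int[of X C C1] inter[of C C1] by (intro exI[of _ "C \<inter> C1"]) auto
    qed
    then obtain C where C: "clopenin X C" "x \<in> C" "\<forall>C'\<in>F. H C \<subseteq> H C'" by blast
    have "H C = {}"
      using C(3) F3 clopenin_subset[OF H[OF C(1)]] by blast
    then show False
      using inj[OF C(1)] C(2) by blast
  qed
  then obtain y where y: "y \<in> topspace Y" "\<And>C. clopenin X C \<Longrightarrow> x \<in> C \<Longrightarrow> y \<in> H C" by blast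
  have "y \<notin> H C" if C: "clopenin X C" "x \<notin> C" for C
  proof -
    have c': "clopenin X (topspace X - C)"
      by (intro clopenin_Diff C clopenin_topspace)
    have "y \<in> H (topspace X - C)"
      using y(2)[OF c'] x C(2) by blast
    moreover have "H (topspace X - C) \<inter> H C = {}"
      using inter[OF c' C(1)] empty by (simp add: Int_commute Diff_disjoint)
    ultimately show ?thesis by blast
  qed
  with y show ?thesis by blast
qed

lemma continuous_map_clopen_base:
  assumes Y: "compact_space Y" "clopen_separated Y" and h: "\<And>x. x \<in> topspace X \<Longrightarrow> h x \<in> topspace Y"
    and K: "\<And>D. clopenin Y D \<Longrightarrow> clopenin X (K D)"
      "\<And>x D. x \<in> topspace X \<Longrightarrow> clopenin Y D \<Longrightarrow> x \<in> K D \<longleftrightarrow> h x \<in> D"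
  shows "continuous_map X Y h"
  unfolding continuous_map
proof (intro conjI allI impI)
  fix V assume V: "openin Y V"
  show "openin X {x \<in> topspace X. h x \<in> V}"
  proof (subst openin_subopen, intro ballI)
    fix x assume x: "x \<in> {x \<in> topspace X. h x \<in> V}"
    then obtain D where D: "clopenin Y D" "h x \<in> D" "D \<subseteq> V"
      using clopen_neighbourhood[OF Y V] by blast
    have "x \<in> K D" "K D \<subseteq> {x \<in> topspace X. h x \<in> V}"
      using x D(2,3) K(2)[OF _ D(1)] clopenin_subset[OF K(1)[OF D(1)]] by blast+
    then show "\<exists>T. openin X T \<and> x \<in> T \<and> T \<subseteq> {x \<in> topspace X. h x \<in> V}"
      using K(1)[OF D(1)] by (intro exI[of _ "K D"]) (simp add: clopenin_def)
  qed
qed (use h in auto)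

text \<open>Stone duality for a bijection of clopen sets that preserves intersections; these
  determine inclusion, hence the whole Boolean structure. The maps h and k come from
  \<open>clopen_iso_point\<close> applied to H and to its inverse.\<close>

lemma clopen_iso_homeomorphism:
  assumes X: "compact_space X" "clopen_separated X" and Y: "compact_space Y" "clopen_separated Y"
    and H: "bij_betw H {C. clopenin X C} {D. clopenin Y D}"
    and inter: "\<And>C D. clopenin X C \<Longrightarrow> clopenin X D \<Longrightarrow> H (C \<inter> D) = H C \<inter> H D"
  shows "\<exists>h k. homeomorphic_maps X Y h k \<and> (\<forall>C. clopenin X C \<longrightarrow> h ` C = H C)"
proof -
  define K where "K = inv_into {C. clopenin X C} H"
  have Hc: "clopenin Y (H C)" if "clopenin X C" for C
    using bij_betw_apply[OF H] that by simp
  have Kc: "clopenin X (K D)" and HK: "H (K D) = D" if "clopenin Y D" for D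
    using bij_betw_apply[OF bij_betw_inv_into[OF H]] bij_betw_inv_into_right[OF H] that by (simp_all add: K_def)
  have KH: "K (H C) = C" if "clopenin X C" for C
    using bij_betw_inv_into_left[OF H] that by (simp add: K_def)
  \<comment> \<open>Since {} is the H-image of K {}, applying H to the intersection of {} and K {}
    gives H {} as an intersection with {}.\<close>
  have H0: "H {} = {}"
    using inter[of "{}" "K {}"] HK[of "{}"] Kc[of "{}"] by simp
  have K0: "K {} = {}"
    using KH[of "{}"] H0 by simp
  have interK: "K (C \<inter> D) = K C \<inter> K D" if "clopenin Y C" "clopenin Y D" for C D
    using KH[OF clopenin_Int[OF Kc[OF that(1)] Kc[OF that(2)]]] inter[OF Kc[OF that(1)] Kc[OF that(2)]] HK that by simp
  have "\<exists>y\<in>topspace Y. \<forall>C. clopenin X C \<longrightarrow> (x \<in> C \<longleftrightarrow> y \<in> H C)" if "x \<in> topspace X" for x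
    by (rule clopen_iso_point[OF Y(1) Hc _ H0 inter that]) (use KH K0 in metis)+
  then obtain h where h: "\<And>x. x \<in> topspace X \<Longrightarrow> h x \<in> topspace Y"
      "\<And>x C. x \<in> topspace X \<Longrightarrow> clopenin X C \<Longrightarrow> x \<in> C \<longleftrightarrow> h x \<in> H C"
    by metis
  have "\<exists>x\<in>topspace X. \<forall>D. clopenin Y D \<longrightarrow> (y \<in> D \<longleftrightarrow> x \<in> K D)" if "y \<in> topspace Y" for y
    by (rule clopen_iso_point[OF X(1) Kc _ K0 interK that]) (use HK H0 in metis)+
  then obtain k where k: "\<And>y. y \<in> topspace Y \<Longrightarrow> k y \<in> topspace X"
      "\<And>y D. y \<in> topspace Y \<Longrightarrow> clopenin Y D \<Longrightarrow> y \<in> D \<longleftrightarrow> k y \<in> K D"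
    by metis
  have kh: "k (h x) = x" if x: "x \<in> topspace X" for x
  proof (rule ccontr)
    assume "k (h x) \<noteq> x"
    then obtain C where C: "clopenin X C" "k (h x) \<in> C" "x \<notin> C"
      using X(2) k(1)[OF h(1)[OF x]] x unfolding clopen_separated_def by metis
    then show False
      using k(2)[OF h(1)[OF x] Hc[OF C(1)]] h(2)[OF x C(1)] KH[OF C(1)] by simp
  qed
  have hk: "h (k y) = y" if y: "y \<in> topspace Y" for y
  proof (rule ccontr)
    assume "h (k y) \<noteq> y"
    then obtain D where D: "clopenin Y D" "h (k y) \<in> D" "y \<notin> D"
      using Y(2) h(1)[OF k(1)[OF y]] y unfolding clopen_separated_def by metis
    then show False
      using h(2)[OF k(1)[OF y] Kc[OF D(1)]] k(2)[OF y D(1)] HK[OF D(1)] by simp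
  qed
  have ch: "continuous_map X Y h"
    by (rule continuous_map_clopen_base[OF Y h(1), where K = K]) (use h(2) Kc HK in auto)
  have ck: "continuous_map Y X k"
    by (rule continuous_map_clopen_base[OF X k(1), where K = H]) (use k(2) Hc KH in auto)
  have "h ` C = H C" if C: "clopenin X C" for C
  proof (intro set_eqI iffI)
    fix y assume "y \<in> h ` C"
    then show "y \<in> H C"
      using h(2)[OF _ C] clopenin_subset[OF C] by blast
  next
    fix y assume y: "y \<in> H C"
    then have "y \<in> topspace Y"
      using clopenin_subset[OF Hc[OF C]] by blast
    then have "y = h (k y)" "k y \<in> C"
      using hk k(2)[OF _ Hc[OF C]] KH[OF C] y by auto
    then show "y \<in> h ` C" by blast
  qed
  moreover have "homeomorphic_maps X Y h k"
    unfolding homeomorphic_maps_def using ch ck kh hk by blast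
  ultimately show ?thesis by blast
qed

section \<open>Diagonal projections and bisection operators\<close>

definition pr :: "('v, 'e, 'a) lgs \<Rightarrow> (nat \<Rightarrow> 'a \<times> (nat \<Rightarrow> 'v)) set \<Rightarrow> ('v, 'a) gop" where
  "pr L C = lam L (dfun (\<lambda>x. if x \<in> C then 1 else 0))"

definition bop :: "('v, 'e, 'a) lgs \<Rightarrow> (nat \<Rightarrow> 'a \<times> (nat \<Rightarrow> 'v)) set \<Rightarrow> nat \<Rightarrow> nat \<Rightarrow> (nat \<Rightarrow> 'a \<times> (nat \<Rightarrow> 'v)) set \<Rightarrow> ('v, 'a) gop" where
  "bop L U k l V = lam L (bisfun (\<lambda>_. 1) U k l V)"

lemma pr_apply: "\<xi> \<in> ell2 L \<Longrightarrow> pr L C \<xi> g = (if g \<in> GL L \<and> rg g \<in> C then \<xi> g else 0)"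
  by (simp add: pr_def lam_dfun)

lemma pr_apply_outside: "\<xi> \<notin> ell2 L \<Longrightarrow> pr L C \<xi> = (\<lambda>_. 0)"
  by (simp add: pr_def lam_outside)

lemma l2inner_self:
  assumes "sq_summable \<xi>"
  shows "l2inner \<xi> \<xi> = of_real ((l2norm \<xi>)\<^sup>2)"
proof -
  have "((\<lambda>g. complex_of_real ((cmod (\<xi> g))\<^sup>2)) has_sum of_real (infsum (\<lambda>g. (cmod (\<xi> g))\<^sup>2) UNIV)) UNIV"
    using assms by (intro has_sum_of_real has_sum_infsum) (simp add: sq_summable_def)
  then show ?thesis
    unfolding l2inner_def complex_norm_square l2norm_def by (simp add: infsumI infsum_nonneg)
qed

context lgsys begin

lemma clopen_indicator:
  assumes "clopenin (X_top L) C"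
  shows "continuous_map (X_top L) euclidean (\<lambda>x. if x \<in> C then 1 else (0::complex))"
  by (rule continuous_map_clopen_extension[OF assms]) simp

lemma pr_DL: "clopenin (X_top L) C \<Longrightarrow> pr L C \<in> DL L"
  unfolding DL_eq pr_def using clopen_indicator by blast

lemma pr_OL: "clopenin (X_top L) C \<Longrightarrow> pr L C \<in> OL L"
  using pr_DL DL_subset_OL by blast

lemma pr_comp:
  assumes "clopenin (X_top L) C" "clopenin (X_top L) D"
  shows "pr L C \<circ> pr L D = pr L (C \<inter> D)"
proof (intro ext)
  fix \<xi> g
  have "pr L D \<xi> \<in> ell2 L"
    by (rule bounded_op_ell2'[OF OL_bounded[OF pr_OL[OF assms(2)]]])
  then show "(pr L C \<circ> pr L D) \<xi> g = pr L (C \<inter> D) \<xi> g"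
    by (cases "\<xi> \<in> ell2 L") (auto simp: pr_apply pr_apply_outside)
qed

lemma pr_inj:
  assumes "C \<subseteq> XL L" "D \<subseteq> XL L" "pr L C = pr L D"
  shows "C = D"
proof -
  have "x \<in> C \<longleftrightarrow> x \<in> D" if x: "x \<in> XL L" for x
  proof -
    have "pr L E (delta (gunit x)) (gunit x) = (if x \<in> E then 1 else 0)" for E
      using x by (simp add: pr_apply) (simp add: delta_def gunit_def)
    then have "(if x \<in> C then 1 else 0 :: complex) = (if x \<in> D then 1 else 0)"
      using assms(3) by metis
    then show ?thesis
      by (auto split: if_splits)
  qed
  with assms(1,2) show ?thesis by blast
qed

text \<open>A function equal to its own square takes the values 0 and 1, so by continuity it is the
  indicator of a clopen set. Being a diagonal idempotent is preserved by \<Phi>, which is how clopen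
  sets are transported.\<close>

lemma DL_idempotent:
  assumes "T \<in> DL L" "T \<circ> T = T"
  shows "\<exists>C. clopenin (X_top L) C \<and> T = pr L C"
proof -
  obtain h where T: "T = lam L (dfun h)" and h: "continuous_map (X_top L) euclidean h"
    using assms(1) unfolding DL_eq by blast
  \<comment> \<open>Evaluating at units turns the composition into the square of
    \<open>h x\<close>.\<close>
  have 01: "h x = 0 \<or> h x = 1" if x: "x \<in> XL L" for x
  proof -
    have "T (delta (gunit x)) \<in> ell2 L"
      by (rule bounded_op_ell2'[OF OL_bounded[OF subsetD[OF DL_subset_OL assms(1)]]])
    then have "(T \<circ> T) (delta (gunit x)) (gunit x) = h x * T (delta (gunit x)) (gunit x)"
      using x by (simp add: T lam_dfun) (simp add: gunit_def)
    moreover have "T (delta (gunit x)) (gunit x) = h x"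
      using x by (simp add: T lam_dfun) (simp add: delta_def gunit_def)
    ultimately have "(T \<circ> T) (delta (gunit x)) (gunit x) = h x * h x" "T (delta (gunit x)) (gunit x) = h x"
      by simp_all
    then have "h x * h x = h x"
      using assms(2) by simp
    then show ?thesis by auto
  qed
  define C where "C = {x \<in> topspace (X_top L). h x \<in> {1}}"
  have "closedin (X_top L) C" "closedin (X_top L) {x \<in> topspace (X_top L). h x \<in> {0}}"
    unfolding C_def by (intro closedin_continuous_map_preimage[OF h]; simp)+
  moreover have "C = topspace (X_top L) - {x \<in> topspace (X_top L). h x \<in> {0}}"
    using 01 by (auto simp: C_def)
  ultimately have "clopenin (X_top L) C"
    unfolding clopenin_def by blast
  moreover have "T = pr L C"
  proof (intro ext)
    fix \<xi> g
    show "T \<xi> g = pr L C \<xi> g"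
      using 01[of "rg g"] GL_rg[of g L]
      by (cases "\<xi> \<in> ell2 L") (auto simp: T lam_dfun pr_apply lam_outside pr_apply_outside C_def)
  qed
  ultimately show ?thesis by blast
qed

text \<open>Evaluating \<open>w P w\<^sup>*\<close> at the unit \<open>y\<close> gives the sum of \<open>|jfun w d|\<^sup>2\<close> over the \<open>d\<close> with range \<open>y\<close>
  and source in \<open>C\<close>, so positivity detects the support of \<open>jfun w\<close>.\<close>
lemma corner_support:
  assumes w: "w \<in> OL L" and C: "clopenin (X_top L) C"
    and eq: "w \<circ> pr L C \<circ> op_adj L w = pr L D" and y: "y \<in> XL L"
  shows "y \<in> D \<longleftrightarrow> (\<exists>d\<in>GL L. rg d = y \<and> sc d \<in> C \<and> jfun w d \<noteq> 0)"
proof -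
  have bw: "bounded_op L w" and bp: "bounded_op L (pr L C)"
    using OL_bounded w pr_OL[OF C] by blast+
  define \<eta> where "\<eta> = op_adj L w (delta (gunit y))"
  have u: "delta (gunit y) \<in> ell2 L"
    using y by simp
  have \<eta>: "\<eta> \<in> ell2 L"
    unfolding \<eta>_def by (rule bounded_op_ell2'[OF bounded_op_op_adj(1)[OF bw]])
  \<comment> \<open>Only elements with source y contribute, and inversion turns them into elements d
    with range y, matching the index set of the conclusion.\<close>
  have \<eta>_val: "\<eta> g = (if sc g = y then cnj (jfun w (ginv g)) else 0)" if g: "g \<in> GL L" for g
  proof -
    have "\<eta> g = cnj (w (delta g) (gunit y))"
      unfolding \<eta>_def using op_adj_delta[OF bw] y by simp
    moreover have "gquot (gunit y) g = ginv g" if "sc g = y"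
      using that by (simp add: gquot_def gunit_def ginv_def)
    moreover have "sc (gunit y) = y"
      by (simp add: gunit_def)
    ultimately show ?thesis
      using OL_delta[OF w g, of "gunit y"] y by auto
  qed
  have p\<eta>: "pr L C \<eta> \<in> ell2 L"
    by (rule bounded_op_ell2'[OF bp])
  \<comment> \<open>The projection is self-adjoint and idempotent, so the diagonal entry at the unit
    of y is a squared norm, which vanishes exactly when every term does.\<close>
  have "l2inner (w (pr L C \<eta>)) (delta (gunit y)) = l2inner (pr L C \<eta>) \<eta>"
    unfolding \<eta>_def[symmetric] using l2inner_op_adj[OF bw p\<eta> u] by (simp add: \<eta>_def)
  also have "\<dots> = l2inner (pr L C \<eta>) (pr L C \<eta>)"
    unfolding l2inner_def using ell2_outside[OF \<eta>] by (intro infsum_cong) (simp add: pr_apply[OF \<eta>])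
  also have "\<dots> = of_real ((l2norm (pr L C \<eta>))\<^sup>2)"
    by (rule l2inner_self[OF ell2_sq[OF p\<eta>]])
  finally have "(w \<circ> pr L C \<circ> op_adj L w) (delta (gunit y)) (gunit y) = of_real ((l2norm (pr L C \<eta>))\<^sup>2)"
    by (simp add: l2inner_delta_right \<eta>_def)
  moreover have "pr L D (delta (gunit y)) (gunit y) = (if y \<in> D then 1 else 0)"
    using u y by (simp add: pr_apply) (simp add: delta_def gunit_def)
  ultimately have "(if y \<in> D then 1 else 0) = complex_of_real ((l2norm (pr L C \<eta>))\<^sup>2)"
    unfolding eq by simp
  then have "y \<in> D \<longleftrightarrow> l2norm (pr L C \<eta>) \<noteq> 0"
    by (auto split: if_splits)
  also have "\<dots> \<longleftrightarrow> pr L C \<eta> \<noteq> (\<lambda>_. 0)"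
    using l2norm_eq_0D[OF ell2_sq[OF p\<eta>]] by auto
  also have "\<dots> \<longleftrightarrow> (\<exists>g\<in>GL L. rg g \<in> C \<and> \<eta> g \<noteq> 0)"
    unfolding fun_eq_iff pr_apply[OF \<eta>] by meson
  also have "\<dots> \<longleftrightarrow> (\<exists>d\<in>GL L. rg d = y \<and> sc d \<in> C \<and> jfun w d \<noteq> 0)"
  proof
    assume "\<exists>g\<in>GL L. rg g \<in> C \<and> \<eta> g \<noteq> 0"
    then obtain g where g: "g \<in> GL L" "rg g \<in> C" "\<eta> g \<noteq> 0" by blast
    then have "sc g = y" "jfun w (ginv g) \<noteq> 0"
      using \<eta>_val[OF g(1)] by (auto split: if_splits)
    then show "\<exists>d\<in>GL L. rg d = y \<and> sc d \<in> C \<and> jfun w d \<noteq> 0"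
      using g by (intro bexI[of _ "ginv g"]) simp_all
  next
    assume "\<exists>d\<in>GL L. rg d = y \<and> sc d \<in> C \<and> jfun w d \<noteq> 0"
    then obtain d where d: "d \<in> GL L" "rg d = y" "sc d \<in> C" "jfun w d \<noteq> 0" by blast
    then show "\<exists>g\<in>GL L. rg g \<in> C \<and> \<eta> g \<noteq> 0"
      using \<eta>_val[of "ginv d"] by (intro bexI[of _ "ginv d"]) simp_all
  qed
  finally show ?thesis .
qed

lemma one_continuous: "continuous_map (X_top L) euclidean (\<lambda>_. 1 :: complex)"
  by simp

lemma bop_OL: "bis L U k l V \<Longrightarrow> bop L U k l V \<in> OL L"
  unfolding bop_def by (intro lam_OL bisfun_Cc one_continuous)

lemma bop_apply:
  assumes "bis L U k l V" "\<xi> \<in> ell2 L"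
  shows "bop L U k l V \<xi> g = (if g \<in> GL L \<and> rg g \<in> U then \<xi> (gtrans k l V g) else 0)"
  unfolding bop_def by (simp add: lam_bisfun[OF assms])

lemma op_adj_bop:
  assumes b: "bis L U k l V"
  shows "op_adj L (bop L U k l V) = bop L V l k U"
proof -
  have "ginv g \<in> Zset U k l V \<longleftrightarrow> g \<in> Zset V l k U" for g
    by (auto simp: Zset_iff)
  then have "(\<lambda>g. cnj (bisfun (\<lambda>_. 1) U k l V (ginv g))) = bisfun (\<lambda>_. 1) V l k U"
    by (intro ext) (simp add: bisfun_def)
  then show ?thesis
    unfolding bop_def using op_adj_lam[OF bisfun_Cc[OF b one_continuous]] by simp
qed

text \<open>Conjugation by a bisection operator moves a diagonal projection along the partial
  homeomorphism: the operator forward and then back returns \<xi> g, cut off by whether the partner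
  of the range lies in C. The image of this identity under \<Phi> is what
  \<open>corner_support\<close> is applied to.\<close>

lemma bop_corner:
  assumes b: "bis L U k l V" and C: "clopenin (X_top L) C"
  shows "bop L U k l V \<circ> pr L C \<circ> op_adj L (bop L U k l V) = pr L {x \<in> U. partner k l V x \<in> C}"
proof (intro ext)
  fix \<xi> g
  let ?B = "bop L U k l V" and ?B' = "bop L V l k U"
  have bB: "bounded_op L ?B'" and bp: "bounded_op L (pr L C)" and bB0: "bounded_op L ?B"
    by (intro OL_bounded bop_OL bis_sym[OF b] b pr_OL C)+
  show "(?B \<circ> pr L C \<circ> op_adj L ?B) \<xi> g = pr L {x \<in> U. partner k l V x \<in> C} \<xi> g"
  proof (cases "\<xi> \<in> ell2 L")
    case True
    have e1: "?B' \<xi> \<in> ell2 L"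
      by (rule bounded_op_ell2'[OF bB])
    have e2: "pr L C (?B' \<xi>) \<in> ell2 L"
      by (rule bounded_op_ell2'[OF bp])
    have "pr L C (?B' \<xi>) (gtrans k l V g) = (if partner k l V (rg g) \<in> C then \<xi> g else 0)" if g: "g \<in> GL L" "rg g \<in> U"
    proof -
      have "rg (gtrans k l V g) = partner k l V (rg g)"
        by (simp add: gtrans_def)
      then show ?thesis
        using GL_gtrans[OF b g] partner_in[OF b g(2)] gtrans_gtrans[OF b g(2)]
        by (simp add: pr_apply[OF e1] bop_apply[OF bis_sym[OF b] True])
    qed
    then show ?thesis
      by (simp add: op_adj_bop[OF b] bop_apply[OF b e2] pr_apply[OF True])
  next
    case False
    then have "?B' \<xi> = (\<lambda>_. 0)"
      by (rule bounded_op_outside[OF bB])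
    then show ?thesis
      using False by (simp add: op_adj_bop[OF b] bounded_op_zero[OF bp] bounded_op_zero[OF bB0] pr_apply_outside)
  qed
qed

end

section \<open>The homeomorphism of unit spaces\<close>

definition alg_iso :: "('v1, 'e1, 'a1) lgs \<Rightarrow> ('v2, 'e2, 'a2) lgs \<Rightarrow> (('v1, 'a1) gop \<Rightarrow> ('v2, 'a2) gop) \<Rightarrow> bool" where
  "alg_iso L1 L2 \<Phi> \<longleftrightarrow> bij_betw \<Phi> (OL L1) (OL L2) \<and> \<Phi> ` DL L1 = DL L2 \<and>
     (\<forall>S\<in>OL L1. \<forall>T\<in>OL L1. \<Phi> (S \<circ> T) = \<Phi> S \<circ> \<Phi> T) \<and>
     (\<forall>T\<in>OL L1. \<Phi> (op_adj L1 T) = op_adj L2 (\<Phi> T))"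

text \<open>Injectivity on \<open>OL L1\<close>, which is closed under products and adjoints,
  transfers the identities to the inverse. The germ argument can therefore be run for \<Phi> and for
  its inverse.\<close>

lemma alg_iso_inv:
  assumes "lgsys L1" "alg_iso L1 L2 \<Phi>"
  shows "alg_iso L2 L1 (inv_into (OL L1) \<Phi>)"
proof -
  interpret A: lgsys L1 by fact
  let ?\<Psi> = "inv_into (OL L1) \<Phi>"
  have bij: "bij_betw \<Phi> (OL L1) (OL L2)" and D: "\<Phi> ` DL L1 = DL L2"
    and mult: "\<And>S T. S \<in> OL L1 \<Longrightarrow> T \<in> OL L1 \<Longrightarrow> \<Phi> (S \<circ> T) = \<Phi> S \<circ> \<Phi> T"
    and adj: "\<And>T. T \<in> OL L1 \<Longrightarrow> \<Phi> (op_adj L1 T) = op_adj L2 (\<Phi> T)"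
    using assms(2) unfolding alg_iso_def by blast+
  have in1: "?\<Psi> T \<in> OL L1" and inv: "\<Phi> (?\<Psi> T) = T" if "T \<in> OL L2" for T
    using bij_betw_apply[OF bij_betw_inv_into[OF bij] that] bij_betw_inv_into_right[OF bij that] by blast+
  have inv': "?\<Psi> (\<Phi> T) = T" if "T \<in> OL L1" for T
    using bij_betw_inv_into_left[OF bij that] .
  show ?thesis
    unfolding alg_iso_def
  proof (intro conjI ballI)
    show "bij_betw ?\<Psi> (OL L2) (OL L1)"
      by (rule bij_betw_inv_into[OF bij])
    have "?\<Psi> ` \<Phi> ` DL L1 = DL L1"
      using inv' A.DL_subset_OL by (force simp: image_image)
    then show "?\<Psi> ` DL L2 = DL L1"
      using D by simp
  next
    fix S T assume *: "S \<in> OL L2" "T \<in> OL L2"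
    have "\<Phi> (?\<Psi> S \<circ> ?\<Psi> T) = S \<circ> T"
      using mult[OF in1[OF *(1)] in1[OF *(2)]] inv * by simp
    then show "?\<Psi> (S \<circ> T) = ?\<Psi> S \<circ> ?\<Psi> T"
      using inv'[OF A.OL_comp[OF in1[OF *(1)] in1[OF *(2)]]] by simp
  next
    fix T assume *: "T \<in> OL L2"
    have "\<Phi> (op_adj L1 (?\<Psi> T)) = op_adj L2 T"
      using adj[OF in1[OF *]] inv[OF *] by simp
    then show "?\<Psi> (op_adj L2 T) = op_adj L1 (?\<Psi> T)"
      using inv'[OF A.OL_adj[OF in1[OF *]]] by simp
  qed
qed

text \<open>Idempotents of the two diagonals correspond under \<Phi>, and their products to
  intersections of clopen sets, so Stone duality applies.\<close>

lemma alg_iso_homeomorphism: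
  assumes "lgsys L1" "lgsys L2" "alg_iso L1 L2 \<Phi>"
  shows "\<exists>h k. homeomorphic_maps (X_top L1) (X_top L2) h k \<and>
    (\<forall>C. clopenin (X_top L1) C \<longrightarrow> \<Phi> (pr L1 C) = pr L2 (h ` C))"
proof -
  interpret A: lgsys L1 by fact
  interpret B: lgsys L2 by fact
  have bij: "bij_betw \<Phi> (OL L1) (OL L2)" and D: "\<Phi> ` DL L1 = DL L2"
    and mult: "\<And>S T. S \<in> OL L1 \<Longrightarrow> T \<in> OL L1 \<Longrightarrow> \<Phi> (S \<circ> T) = \<Phi> S \<circ> \<Phi> T"
    using assms(3) unfolding alg_iso_def by blast+
  have inj: "S = T" if "S \<in> OL L1" "T \<in> OL L1" "\<Phi> S = \<Phi> T" for S T
    using bij that unfolding bij_betw_def inj_on_def by blast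
  have "\<exists>E. clopenin (X_top L2) E \<and> \<Phi> (pr L1 C) = pr L2 E" if C: "clopenin (X_top L1) C" for C
  proof (rule B.DL_idempotent)
    show "\<Phi> (pr L1 C) \<in> DL L2"
      using D A.pr_DL[OF C] by blast
    show "\<Phi> (pr L1 C) \<circ> \<Phi> (pr L1 C) = \<Phi> (pr L1 C)"
      using mult[OF A.pr_OL[OF C] A.pr_OL[OF C]] A.pr_comp[OF C C] by simp
  qed
  then obtain H where H: "\<And>C. clopenin (X_top L1) C \<Longrightarrow> clopenin (X_top L2) (H C)"
      "\<And>C. clopenin (X_top L1) C \<Longrightarrow> \<Phi> (pr L1 C) = pr L2 (H C)"
    by metis
  have sub1: "C \<subseteq> XL L1" if "clopenin (X_top L1) C" for C
    using clopenin_subset[OF that] by simp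
  have sub2: "C \<subseteq> XL L2" if "clopenin (X_top L2) C" for C
    using clopenin_subset[OF that] by simp
  have "bij_betw H {C. clopenin (X_top L1) C} {E. clopenin (X_top L2) E}"
    unfolding bij_betw_def
  proof
    show "inj_on H {C. clopenin (X_top L1) C}"
    proof (rule inj_onI)
      fix C C' assume *: "C \<in> {C. clopenin (X_top L1) C}" "C' \<in> {C. clopenin (X_top L1) C}" "H C = H C'"
      then have "pr L1 C = pr L1 C'"
        using H(2) by (intro inj A.pr_OL) auto
      then show "C = C'"
        using * sub1 by (intro A.pr_inj) auto
    qed
    show "H ` {C. clopenin (X_top L1) C} = {E. clopenin (X_top L2) E}"
    proof
      show "{E. clopenin (X_top L2) E} \<subseteq> H ` {C. clopenin (X_top L1) C}"
      proof
        fix E assume "E \<in> {E. clopenin (X_top L2) E}"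
        then have E: "clopenin (X_top L2) E" by simp
        have "pr L2 E \<in> \<Phi> ` DL L1"
          unfolding D by (rule B.pr_DL[OF E])
        then obtain T where T: "T \<in> DL L1" "\<Phi> T = pr L2 E"
          by (elim imageE) simp
        have TO: "T \<in> OL L1"
          using T(1) A.DL_subset_OL by blast
        have "T \<circ> T = T"
          using mult[OF TO TO] T(2) B.pr_comp[OF E E] by (intro inj A.OL_comp TO) simp
        then obtain C where C: "clopenin (X_top L1) C" "T = pr L1 C"
          using A.DL_idempotent[OF T(1)] by blast
        have "E = H C"
          using T(2) C H[OF C(1)] sub2 E by (intro B.pr_inj) auto
        then show "E \<in> H ` {C. clopenin (X_top L1) C}"
          using C(1) by blast
      qed
    qed (use H(1) in blast)
  qed
  moreover have "H (C \<inter> C') = H C \<inter> H C'" if C: "clopenin (X_top L1) C" "clopenin (X_top L1) C'" for C C'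
  proof (rule B.pr_inj)
    have "\<Phi> (pr L1 C \<circ> pr L1 C') = pr L2 (H C) \<circ> pr L2 (H C')"
      using mult[OF A.pr_OL[OF C(1)] A.pr_OL[OF C(2)]] H(2) C by simp
    then show "pr L2 (H (C \<inter> C')) = pr L2 (H C \<inter> H C')"
      using A.pr_comp[OF C] B.pr_comp[OF H(1)[OF C(1)] H(1)[OF C(2)]] H(2)[OF clopenin_Int[OF C]] by simp
  qed (intro sub2 H(1) C clopenin_Int)+
  ultimately obtain h k where "homeomorphic_maps (X_top L1) (X_top L2) h k" "\<forall>C. clopenin (X_top L1) C \<longrightarrow> h ` C = H C"
    using clopen_iso_homeomorphism[OF A.compact_X A.X_clopen_separated B.compact_X B.X_clopen_separated] by blast
  then show ?thesis
    using H(2) by auto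
qed

section \<open>Conjugate germs\<close>

lemma bis_section_in:
  "bis L U k l V \<Longrightarrow> x \<in> U \<Longrightarrow> (x, int k - int l, partner k l V x) \<in> Zset U k l V"
  by (simp add: Zset_bis_iff)

text \<open>A nonempty open set on which two different shift powers agree would lie in an interior
  that is empty. Essential freeness enters in this form.\<close>

lemma essentially_free_exponents:
  assumes "essentially_free L" "openin (X_top L) N" "y \<in> N" "N \<subseteq> XL L"
    "\<And>y. y \<in> N \<Longrightarrow> shifts m y = shifts n y"
  shows "m = n"
proof (rule ccontr)
  assume "m \<noteq> n"
  then have "X_top L interior_of {x \<in> XL L. shifts m x = shifts n x} = {}"
    using assms(1) by (simp add: essentially_free_def)
  moreover have "N \<subseteq> X_top L interior_of {x \<in> XL L. shifts m x = shifts n x}"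
    by (rule interior_of_maximal) (use assms in auto)
  ultimately show False
    using assms(3) by blast
qed

text \<open>When O1 and O2 are bisections, this says that near \<open>rg d\<close> the partial
  homeomorphism of O2 is the h-conjugate of that of O1. Stating it with open sets rather than
  partial maps makes it independent of a choice of bisections and lets the support of a coefficient
  function serve as O2.\<close>

definition germ_conj :: "('v1, 'e1, 'a1) lgs \<Rightarrow> ('v2, 'e2, 'a2) lgs \<Rightarrow>
    ((nat \<Rightarrow> 'a1 \<times> (nat \<Rightarrow> 'v1)) \<Rightarrow> (nat \<Rightarrow> 'a2 \<times> (nat \<Rightarrow> 'v2))) \<Rightarrow> ('v1, 'a1) gel \<Rightarrow> ('v2, 'a2) gel \<Rightarrow> bool" where
  "germ_conj L1 L2 h g d \<longleftrightarrow> g \<in> GL L1 \<and> d \<in> GL L2 \<and> rg d = h (rg g) \<and> sc d = h (sc g) \<and>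
     (\<exists>O1 O2. openin (G_top L1) O1 \<and> openin (G_top L2) O2 \<and> g \<in> O1 \<and> d \<in> O2 \<and>
        (\<forall>g'\<in>O1. \<forall>d'\<in>O2. rg d' = h (rg g') \<longrightarrow> sc d' = h (sc g')))"

lemma germ_conjD:
  assumes "germ_conj L1 L2 h g d"
  shows "g \<in> GL L1" "d \<in> GL L2" "rg d = h (rg g)" "sc d = h (sc g)"
  using assms by (simp_all add: germ_conj_def)

locale germs = A: lgsys L1 + B: lgsys L2
  for L1 :: "('v1, 'e1, 'a1) lgs" and L2 :: "('v2, 'e2, 'a2) lgs" +
  fixes h :: "(nat \<Rightarrow> 'a1 \<times> (nat \<Rightarrow> 'v1)) \<Rightarrow> (nat \<Rightarrow> 'a2 \<times> (nat \<Rightarrow> 'v2))"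
    and k :: "(nat \<Rightarrow> 'a2 \<times> (nat \<Rightarrow> 'v2)) \<Rightarrow> (nat \<Rightarrow> 'a1 \<times> (nat \<Rightarrow> 'v1))"
  assumes hk: "homeomorphic_maps (X_top L1) (X_top L2) h k"
    and ef1: "essentially_free L1" and ef2: "essentially_free L2"
begin

lemma sym: "germs L2 L1 k h"
  by unfold_locales (use hk ef1 ef2 homeomorphic_maps_sym in auto)

lemma cont_h: "continuous_map (X_top L1) (X_top L2) h" and cont_k: "continuous_map (X_top L2) (X_top L1) k"
  and k_h: "x \<in> XL L1 \<Longrightarrow> k (h x) = x" and h_k: "y \<in> XL L2 \<Longrightarrow> h (k y) = y"
  using hk unfolding homeomorphic_maps_def by auto

lemma h_XL: "x \<in> XL L1 \<Longrightarrow> h x \<in> XL L2"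
  using continuous_map_image_subset_topspace[OF cont_h] by auto

lemma k_XL: "y \<in> XL L2 \<Longrightarrow> k y \<in> XL L1"
  using continuous_map_image_subset_topspace[OF cont_k] by auto

lemma germ_conj_sym:
  assumes "germ_conj L1 L2 h g d"
  shows "germ_conj L2 L1 k d g"
proof -
  obtain O1 O2 where *: "openin (G_top L1) O1" "openin (G_top L2) O2" "g \<in> O1" "d \<in> O2"
      "\<And>g' d'. g' \<in> O1 \<Longrightarrow> d' \<in> O2 \<Longrightarrow> rg d' = h (rg g') \<Longrightarrow> sc d' = h (sc g')"
    and gd: "g \<in> GL L1" "d \<in> GL L2" "rg d = h (rg g)" "sc d = h (sc g)"
    using assms unfolding germ_conj_def by blast
  have sub: "O1 \<subseteq> GL L1" "O2 \<subseteq> GL L2"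
    using openin_subset[OF *(1)] openin_subset[OF *(2)] by simp_all
  have "sc g' = k (sc d')" if "d' \<in> O2" "g' \<in> O1" "rg g' = k (rg d')" for d' g'
  proof -
    have d': "d' \<in> GL L2" and g': "g' \<in> GL L1"
      using that sub by auto
    have "rg d' = h (rg g')"
      using that(3) h_k[OF GL_rg[OF d']] by simp
    from *(5)[OF that(2,1) this] show ?thesis
      using k_h[OF GL_sc[OF g']] by simp
  qed
  then show ?thesis
    unfolding germ_conj_def using *(1-4) gd k_h[OF GL_rg[OF gd(1)]] k_h[OF GL_sc[OF gd(1)]]
    by (intro conjI exI[of _ O2] exI[of _ O1]) auto
qed

lemma germ_conj_sc_eq:
  assumes "bis L1 U p q V" "Zset U p q V \<subseteq> O1" "bis L2 U' p' q' V'" "Zset U' p' q' V' \<subseteq> O2"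
    and "\<forall>g'\<in>O1. \<forall>d'\<in>O2. rg d' = h (rg g') \<longrightarrow> sc d' = h (sc g')"
    and "x \<in> U" "h x \<in> U'"
  shows "partner p' q' V' (h x) = h (partner p q V x)"
  using assms(5)[rule_format, OF subsetD[OF assms(2) bis_section_in[OF assms(1,6)]]
      subsetD[OF assms(4) bis_section_in[OF assms(3,7)]]] by simp

text \<open>Range and source of d1 and d2 are prescribed by h, so only the degree is in question.
  Near \<open>h (rg g)\<close>, bisections through d1 and d2 induce the same partial map, the
  h-conjugate of that of g; comparing their exponents gives two shift powers that agree on an open
  set.\<close>

lemma germ_conj_unique:
  assumes "germ_conj L1 L2 h g d1" "germ_conj L1 L2 h g d2"
  shows "d1 = d2"
proof -
  obtain O1 O2 where O: "openin (G_top L1) O1" "openin (G_top L2) O2" "g \<in> O1" "d1 \<in> O2"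
      "\<forall>g'\<in>O1. \<forall>d'\<in>O2. rg d' = h (rg g') \<longrightarrow> sc d' = h (sc g')"
    and g: "g \<in> GL L1" and d1: "rg d1 = h (rg g)" "sc d1 = h (sc g)"
    using assms(1) unfolding germ_conj_def by blast
  obtain O1' O2' where O': "openin (G_top L1) O1'" "openin (G_top L2) O2'" "g \<in> O1'" "d2 \<in> O2'"
      "\<forall>g'\<in>O1'. \<forall>d'\<in>O2'. rg d' = h (rg g') \<longrightarrow> sc d' = h (sc g')"
    and d2: "rg d2 = h (rg g)" "sc d2 = h (sc g)"
    using assms(2) unfolding germ_conj_def by blast
  have gO: "g \<in> O1 \<inter> O1'"
    using O(3) O'(3) by simp
  obtain U p q V where b: "bis L1 U p q V" "g \<in> Zset U p q V" "Zset U p q V \<subseteq> O1 \<inter> O1'"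
    using A.openin_G_bis[OF openin_Int[OF O(1) O'(1)] gO] .
  obtain U1 k1 l1 V1 where b1: "bis L2 U1 k1 l1 V1" "d1 \<in> Zset U1 k1 l1 V1" "Zset U1 k1 l1 V1 \<subseteq> O2"
    using B.openin_G_bis[OF O(2,4)] .
  obtain U2 k2 l2 V2 where b2: "bis L2 U2 k2 l2 V2" "d2 \<in> Zset U2 k2 l2 V2" "Zset U2 k2 l2 V2 \<subseteq> O2'"
    using B.openin_G_bis[OF O'(2,4)] .
  define N where "N = U1 \<inter> U2 \<inter> {y \<in> topspace (X_top L2). k y \<in> U}"
  have "openin (X_top L2) N"
    unfolding N_def
    by (intro openin_Int B.bis_open[OF b1(1)] B.bis_open[OF b2(1)] openin_continuous_map_preimage[OF cont_k] A.bis_open[OF b(1)])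
  moreover have "h (rg g) \<in> N"
    using b1(2) b2(2) b(2) d1 d2 h_XL[OF GL_rg[OF g]] k_h[OF GL_rg[OF g]] by (auto simp: N_def Zset_iff)
  moreover have "N \<subseteq> XL L2"
    by (auto simp: N_def)
  \<comment> \<open>Apply \<open>shifts l2\<close> to the relation of the first bisection and
    \<open>shifts l1\<close> to that of the second; in both, the common partner is then shifted l1 +
    l2 times.\<close>
  moreover have "shifts (l2 + k1) y = shifts (l1 + k2) y" if y: "y \<in> N" for y
  proof -
    have y': "y \<in> U1" "y \<in> U2" "k y \<in> U" "h (k y) = y"
      using y h_k by (auto simp: N_def)
    have "partner k1 l1 V1 y = h (partner p q V (k y))"
      using germ_conj_sc_eq[OF b(1) _ b1(1,3) O(5) y'(3)] b(3) y' by simp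
    moreover have "partner k2 l2 V2 y = h (partner p q V (k y))"
      using germ_conj_sc_eq[OF b(1) _ b2(1,3) O'(5) y'(3)] b(3) y' by simp
    ultimately have e: "partner k1 l1 V1 y = partner k2 l2 V2 y" by simp
    have "shifts (l2 + k1) y = shifts (l2 + l1) (partner k1 l1 V1 y)"
      using shifts_partner[OF b1(1) y'(1)] by (simp add: shifts_add)
    also have "\<dots> = shifts (l1 + l2) (partner k2 l2 V2 y)"
      by (simp add: e add.commute)
    also have "\<dots> = shifts (l1 + k2) y"
      using shifts_partner[OF b2(1) y'(2)] by (simp add: shifts_add)
    finally show ?thesis .
  qed
  ultimately have "l2 + k1 = l1 + k2"
    by (rule essentially_free_exponents[OF ef2])
  then have "dg d1 = dg d2"
    using b1(2) b2(2) by (auto simp: Zset_iff)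
  then show ?thesis
    using d1 d2 by (simp add: prod_eq_iff)
qed

lemma gtrans_gmult:
  assumes "bis L U p q V" "g \<in> Zset U p q V" "sc g = rg g'"
  shows "gtrans p q V (gmult g g') = g'"
  using assms(2,3) unfolding Zset_bis_iff[OF assms(1)] by (simp add: gtrans_def gmult_def prod_eq_iff)

lemma germ_conj_mult:
  assumes "germ_conj L1 L2 h g d" "germ_conj L1 L2 h g' d'" "sc g = rg g'"
  shows "germ_conj L1 L2 h (gmult g g') (gmult d d')"
proof -
  obtain O1 O2 where O: "openin (G_top L1) O1" "openin (G_top L2) O2" "g \<in> O1" "d \<in> O2"
      "\<forall>g'\<in>O1. \<forall>d'\<in>O2. rg d' = h (rg g') \<longrightarrow> sc d' = h (sc g')"
    and gd: "g \<in> GL L1" "d \<in> GL L2" "rg d = h (rg g)" "sc d = h (sc g)"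
    using assms(1) unfolding germ_conj_def by blast
  obtain O1' O2' where O': "openin (G_top L1) O1'" "openin (G_top L2) O2'" "g' \<in> O1'" "d' \<in> O2'"
      "\<forall>g'\<in>O1'. \<forall>d'\<in>O2'. rg d' = h (rg g') \<longrightarrow> sc d' = h (sc g')"
    and gd': "g' \<in> GL L1" "d' \<in> GL L2" "rg d' = h (rg g')" "sc d' = h (sc g')"
    using assms(2) unfolding germ_conj_def by blast
  have sd: "sc d = rg d'"
    using gd gd' assms(3) by simp
  obtain U p q V where b: "bis L1 U p q V" "g \<in> Zset U p q V" "Zset U p q V \<subseteq> O1"
    using A.openin_G_bis[OF O(1,3)] .
  obtain U1 p1 q1 V1 where b1: "bis L2 U1 p1 q1 V1" "d \<in> Zset U1 p1 q1 V1" "Zset U1 p1 q1 V1 \<subseteq> O2"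
    using B.openin_G_bis[OF O(2,4)] .
  \<comment> \<open>Neighbourhoods of the products: the elements whose left factor lies in the
    chosen bisection and whose remaining factor, isolated by \<open>gtrans\<close>, lies in the
    neighbourhood of the second factor. The two conjugacy conditions are then used in
    succession.\<close>
  let ?O1 = "{e \<in> GL L1. rg e \<in> U \<and> gtrans p q V e \<in> O1'}"
  let ?O2 = "{e \<in> GL L2. rg e \<in> U1 \<and> gtrans p1 q1 V1 e \<in> O2'}"
  have "openin (G_top L1) ?O1"
    by (rule A.openin_gtrans[OF b(1) O'(1)])
  moreover have "openin (G_top L2) ?O2"
    by (rule B.openin_gtrans[OF b1(1) O'(2)])
  moreover have m: "gmult g g' \<in> GL L1" "gmult d d' \<in> GL L2"
    by (intro GL_mult gd gd' assms(3) sd)+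
  have "gmult g g' \<in> ?O1"
    using m(1) gtrans_gmult[OF b(1,2) assms(3)] O'(3) b(2) by (simp add: Zset_iff) (simp add: gmult_def)
  moreover have "gmult d d' \<in> ?O2"
    using m(2) gtrans_gmult[OF b1(1,2) sd] O'(4) b1(2) by (simp add: Zset_iff) (simp add: gmult_def)
  moreover have "sc e' = h (sc e)" if e: "e \<in> ?O1" and e': "e' \<in> ?O2" and r: "rg e' = h (rg e)" for e e'
  proof -
    have "partner p1 q1 V1 (h (rg e)) = h (partner p q V (rg e))"
      by (rule germ_conj_sc_eq[OF b(1,3) b1(1,3) O(5)]) (use e e' r in auto)
    then have "rg (gtrans p1 q1 V1 e') = h (rg (gtrans p q V e))"
      using r by (simp add: gtrans_def)
    then have "sc (gtrans p1 q1 V1 e') = h (sc (gtrans p q V e))"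
      using O'(5) e e' by blast
    then show ?thesis
      by (simp add: gtrans_def)
  qed
  ultimately have "\<exists>O1 O2. openin (G_top L1) O1 \<and> openin (G_top L2) O2 \<and> gmult g g' \<in> O1 \<and> gmult d d' \<in> O2 \<and>
        (\<forall>g'\<in>O1. \<forall>d'\<in>O2. rg d' = h (rg g') \<longrightarrow> sc d' = h (sc g'))"
    by (intro exI[of _ ?O1] exI[of _ ?O2] conjI ballI impI)
  then show ?thesis
    unfolding germ_conj_def using m gd gd' by (simp add: gmult_def)
qed

text \<open>The open sets that witness the relation for g and d also witness it for nearby pairs; d1
  is the element over \<open>h (rg g1)\<close> in a small bisection around d. Together with
  uniqueness this becomes continuity of the germ map.\<close>

lemma germ_conj_continuous:
  assumes R: "germ_conj L1 L2 h g d" and W: "openin (G_top L2) W" "d \<in> W"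
  shows "\<exists>O'. openin (G_top L1) O' \<and> g \<in> O' \<and> (\<forall>g1\<in>O'. \<exists>d1\<in>W. germ_conj L1 L2 h g1 d1)"
proof -
  obtain O1 O2 where O: "openin (G_top L1) O1" "openin (G_top L2) O2" "g \<in> O1" "d \<in> O2"
      "\<forall>g'\<in>O1. \<forall>d'\<in>O2. rg d' = h (rg g') \<longrightarrow> sc d' = h (sc g')"
    and gd: "g \<in> GL L1" "d \<in> GL L2" "rg d = h (rg g)"
    using R unfolding germ_conj_def by blast
  have dW: "d \<in> O2 \<inter> W"
    using O(4) W(2) by simp
  obtain U p q V where b: "bis L2 U p q V" "d \<in> Zset U p q V" "Zset U p q V \<subseteq> O2 \<inter> W"
    using B.openin_G_bis[OF openin_Int[OF O(2) W(1)] dW] .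
  define O' where "O' = O1 \<inter> {g \<in> topspace (G_top L1). (h \<circ> (\<lambda>g. rg g)) g \<in> U}"
  have "openin (G_top L1) O'"
    unfolding O'_def
    by (intro openin_Int O openin_continuous_map_preimage[OF continuous_map_compose[OF A.continuous_rg cont_h]] B.bis_open[OF b(1)])
  moreover have "g \<in> O'"
    using O(3) gd b(2) by (auto simp: O'_def Zset_iff)
  moreover have "\<exists>d1\<in>W. germ_conj L1 L2 h g1 d1" if g1: "g1 \<in> O'" for g1
  proof -
    define d1 where "d1 = (h (rg g1), int p - int q, partner p q V (h (rg g1)))"
    have "d1 \<in> Zset U p q V"
      unfolding d1_def by (rule bis_section_in[OF b(1)]) (use g1 in \<open>simp add: O'_def\<close>)
    then have d1: "d1 \<in> O2" "d1 \<in> W" "d1 \<in> GL L2"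
      using b(3) B.Zset_bis_subset[OF b(1)] by auto
    have g1': "g1 \<in> O1" "g1 \<in> GL L1"
      using g1 by (auto simp: O'_def)
    have r: "rg d1 = h (rg g1)"
      by (simp add: d1_def)
    then have "sc d1 = h (sc g1)"
      using O(5) g1'(1) d1(1) by blast
    then have "germ_conj L1 L2 h g1 d1"
      unfolding germ_conj_def using O(1,2,5) g1' d1 r by blast
    then show ?thesis
      using d1(2) by blast
  qed
  ultimately show ?thesis by blast
qed

lemma germ_map_continuous:
  assumes \<phi>: "\<And>g. g \<in> GL L1 \<Longrightarrow> germ_conj L1 L2 h g (\<phi> g)"
  shows "continuous_map (G_top L1) (G_top L2) \<phi>"
  unfolding continuous_map
proof (intro conjI allI impI)
  show "\<phi> ` topspace (G_top L1) \<subseteq> topspace (G_top L2)"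
    using germ_conjD(2)[OF \<phi>] by (simp add: image_subset_iff del: split_paired_All split_paired_Ball_Sigma)
  fix W assume W: "openin (G_top L2) W"
  show "openin (G_top L1) {g \<in> topspace (G_top L1). \<phi> g \<in> W}"
  proof (subst openin_subopen, intro ballI)
    fix g assume "g \<in> {g \<in> topspace (G_top L1). \<phi> g \<in> W}"
    then have g: "g \<in> GL L1" "\<phi> g \<in> W" by simp_all
    obtain O' where O': "openin (G_top L1) O'" "g \<in> O'" "\<forall>g1\<in>O'. \<exists>d1\<in>W. germ_conj L1 L2 h g1 d1"
      using germ_conj_continuous[OF \<phi>[OF g(1)] W g(2)] by (elim exE conjE)
    have "\<phi> g1 \<in> W" "g1 \<in> topspace (G_top L1)" if "g1 \<in> O'" for g1
    proof -
      show g1: "g1 \<in> topspace (G_top L1)"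
        using openin_subset[OF O'(1)] that by (rule subsetD)
      obtain d1 where "d1 \<in> W" "germ_conj L1 L2 h g1 d1"
        using bspec[OF O'(3) \<open>g1 \<in> O'\<close>] by (elim bexE)
      moreover have "\<phi> g1 = d1"
        using germ_conj_unique[OF \<phi> calculation(2)] g1 by simp
      ultimately show "\<phi> g1 \<in> W" by simp
    qed
    then show "\<exists>T. openin (G_top L1) T \<and> g \<in> T \<and> T \<subseteq> {g \<in> topspace (G_top L1). \<phi> g \<in> W}"
      using O'(1,2) by (intro exI[of _ O'] conjI subsetI CollectI)
  qed
qed

text \<open>Uniqueness of conjugate germs carries the argument: with symmetry of the relation it
  makes \<phi> and \<psi> inverse to each other, and with compatibility with products it makes
  \<phi> multiplicative.\<close>

lemma groupoid_iso_of_germs: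
  assumes tot1: "\<And>g. g \<in> GL L1 \<Longrightarrow> \<exists>d. germ_conj L1 L2 h g d"
    and tot2: "\<And>d. d \<in> GL L2 \<Longrightarrow> \<exists>g. germ_conj L2 L1 k d g"
  obtains \<phi> where "groupoid_iso L1 L2 \<phi>" "\<And>g. g \<in> GL L1 \<Longrightarrow> germ_conj L1 L2 h g (\<phi> g)"
proof -
  obtain \<phi> where \<phi>: "\<And>g. g \<in> GL L1 \<Longrightarrow> germ_conj L1 L2 h g (\<phi> g)"
    using tot1 by metis
  obtain \<psi> where \<psi>: "\<And>d. d \<in> GL L2 \<Longrightarrow> germ_conj L2 L1 k d (\<psi> d)"
    using tot2 by metis
  have \<phi>_GL: "\<phi> g \<in> GL L2" if "g \<in> GL L1" for g
    by (rule germ_conjD(2)[OF \<phi>[OF that]])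
  have \<psi>_GL: "\<psi> d \<in> GL L1" if "d \<in> GL L2" for d
    by (rule germ_conjD(2)[OF \<psi>[OF that]])
  have \<psi>\<phi>: "\<psi> (\<phi> g) = g" if "g \<in> GL L1" for g
    by (rule germs.germ_conj_unique[OF sym \<psi>[OF \<phi>_GL[OF that]] germ_conj_sym[OF \<phi>[OF that]]])
  have \<phi>\<psi>: "\<phi> (\<psi> d) = d" if "d \<in> GL L2" for d
    by (rule germ_conj_unique[OF \<phi>[OF \<psi>_GL[OF that]] germs.germ_conj_sym[OF sym \<psi>[OF that]]])
  have "continuous_map (G_top L1) (G_top L2) \<phi>"
    by (rule germ_map_continuous[OF \<phi>])
  moreover have "continuous_map (G_top L2) (G_top L1) \<psi>"
    by (rule germs.germ_map_continuous[OF sym \<psi>])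
  ultimately have "homeomorphic_maps (G_top L1) (G_top L2) \<phi> \<psi>"
    unfolding homeomorphic_maps_def A.topspace_G B.topspace_G using \<psi>\<phi> \<phi>\<psi> by (intro conjI ballI)
  then have "homeomorphic_map (G_top L1) (G_top L2) \<phi>"
    using homeomorphic_maps_map by blast
  moreover have "bij_betw \<phi> (GL L1) (GL L2)"
    by (rule bij_betw_byWitness[where f' = \<psi>]) (use \<psi>\<phi> \<phi>\<psi> \<phi>_GL \<psi>_GL in \<open>simp_all add: image_subset_iff del: split_paired_All split_paired_Ball_Sigma\<close>)
  moreover have "(gcomp g g' \<longleftrightarrow> gcomp (\<phi> g) (\<phi> g')) \<and> (gcomp g g' \<longrightarrow> \<phi> (gmult g g') = gmult (\<phi> g) (\<phi> g'))"
    if g: "g \<in> GL L1" and g': "g' \<in> GL L1" for g g'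
  proof -
    note germ_conjD(4)[OF \<phi>[OF g]] germ_conjD(3)[OF \<phi>[OF g']]
    then have "gcomp g g' \<longleftrightarrow> gcomp (\<phi> g) (\<phi> g')"
      unfolding gcomp_def using k_h[OF GL_sc[OF g]] k_h[OF GL_rg[OF g']] by metis
    moreover have "\<phi> (gmult g g') = gmult (\<phi> g) (\<phi> g')" if c: "sc g = rg g'"
      by (rule germ_conj_unique[OF \<phi>[OF GL_mult[OF g g' c]] germ_conj_mult[OF \<phi>[OF g] \<phi>[OF g'] c]])
    ultimately show ?thesis
      unfolding gcomp_def by blast
  qed
  ultimately have "groupoid_iso L1 L2 \<phi>"
    unfolding groupoid_iso_def by (intro conjI ballI) auto
  with \<phi> show ?thesis
    by (rule that[rotated])
qed

end

text \<open>The projection obtained by conjugating with w has two descriptions: transport along the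
  bisection, carried over by \<Phi>, and the support of \<open>jfun w\<close>. Comparing them for
  all clopen C pins the source of every d in the support, and the whole space as C shows that the
  support has an element over each point of \<open>h\<close> followed by U.\<close>

lemma (in germs) alg_iso_germ:
  assumes iso: "alg_iso L1 L2 \<Phi>" and pr: "\<And>C. clopenin (X_top L1) C \<Longrightarrow> \<Phi> (pr L1 C) = pr L2 (h ` C)"
    and b: "bis L1 U p q V" and g: "g \<in> Zset U p q V"
  shows "\<exists>d\<in>GL L2. germ_conj L1 L2 h g d \<and> jfun (\<Phi> (bop L1 U p q V)) d \<noteq> 0"
proof -
  have bij: "bij_betw \<Phi> (OL L1) (OL L2)"
    and mult: "\<And>S T. S \<in> OL L1 \<Longrightarrow> T \<in> OL L1 \<Longrightarrow> \<Phi> (S \<circ> T) = \<Phi> S \<circ> \<Phi> T"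
    and adj: "\<And>T. T \<in> OL L1 \<Longrightarrow> \<Phi> (op_adj L1 T) = op_adj L2 (\<Phi> T)"
    using iso unfolding alg_iso_def by blast+
  define w where "w = \<Phi> (bop L1 U p q V)"
  have bO: "bop L1 U p q V \<in> OL L1"
    by (rule A.bop_OL[OF b])
  have w: "w \<in> OL L2"
    unfolding w_def by (rule bij_betw_apply[OF bij bO])
  have UX: "U \<subseteq> XL L1" "V \<subseteq> XL L1"
    using A.bis_subset_XL[OF b] .
  have key: "x \<in> U \<and> partner p q V x \<in> C \<longleftrightarrow> (\<exists>d\<in>GL L2. rg d = h x \<and> sc d \<in> h ` C \<and> jfun w d \<noteq> 0)"
    if C: "clopenin (X_top L1) C" and x: "x \<in> XL L1" for C x
  proof -
    let ?D = "{x \<in> U. partner p q V x \<in> C}"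
    have "\<Phi> (bop L1 U p q V \<circ> pr L1 C \<circ> op_adj L1 (bop L1 U p q V)) = w \<circ> pr L2 (h ` C) \<circ> op_adj L2 w"
      by (simp only: mult[OF A.OL_comp[OF bO A.pr_OL[OF C]] A.OL_adj[OF bO]] mult[OF bO A.pr_OL[OF C]] adj[OF bO] pr[OF C] w_def)
    then have "w \<circ> pr L2 (h ` C) \<circ> op_adj L2 w = pr L2 (h ` ?D)"
      using A.bop_corner[OF b C] pr[OF A.clopenin_partner_preimage[OF b C]] by simp
    moreover have "clopenin (X_top L2) (h ` C)"
    proof -
      have "h ` C = {y \<in> topspace (X_top L2). k y \<in> C}"
        using clopenin_subset[OF C] h_XL k_h h_k by (force simp: image_iff)
      then show ?thesis
        using clopenin_preimage[OF cont_k C] by simp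
    qed
    ultimately have "h x \<in> h ` ?D \<longleftrightarrow> (\<exists>d\<in>GL L2. rg d = h x \<and> sc d \<in> h ` C \<and> jfun w d \<noteq> 0)"
      using B.corner_support[OF w _ _ h_XL[OF x]] by blast
    moreover have "h x \<in> h ` ?D \<longleftrightarrow> x \<in> ?D"
    proof
      assume "h x \<in> h ` ?D"
      then obtain x' where x': "x' \<in> ?D" "h x = h x'" by blast
      then have "x' \<in> XL L1"
        using UX(1) by blast
      then have "x = x'"
        using arg_cong[OF x'(2), of k] by (simp only: k_h x)
      then show "x \<in> ?D"
        using x'(1) by (simp only:)
    qed (rule imageI)
    ultimately show ?thesis by simp
  qed
  have top1: "clopenin (X_top L1) (XL L1)"
    using clopenin_topspace[of "X_top L1"] by simp
  \<comment> \<open>Every clopen C containing \<open>k (sc d)\<close> also contains the partner of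
    \<open>k (rg d)\<close>; clopen sets separate points, so the two are equal.\<close>
  have supp: "k (rg d) \<in> U \<and> sc d = h (partner p q V (k (rg d)))" if d: "d \<in> GL L2" "jfun w d \<noteq> 0" for d
  proof -
    have r: "k (rg d) \<in> XL L1" "h (k (rg d)) = rg d" and s: "k (sc d) \<in> XL L1" "h (k (sc d)) = sc d"
      using k_XL h_k GL_rg[OF d(1)] GL_sc[OF d(1)] by auto
    have in_C: "k (rg d) \<in> U \<and> partner p q V (k (rg d)) \<in> C" if "clopenin (X_top L1) C" "k (sc d) \<in> C" for C
      using key[OF that(1) r(1)] that(2) d r(2) s(2) by (metis imageI)
    then have U: "k (rg d) \<in> U"
      using top1 s(1) by blast
    have "partner p q V (k (rg d)) = k (sc d)"
    proof (rule ccontr)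
      assume ne: "partner p q V (k (rg d)) \<noteq> k (sc d)"
      have "partner p q V (k (rg d)) \<in> XL L1"
        using partner_in[OF b U] UX(2) by blast
      then obtain C where "clopenin (X_top L1) C" "k (sc d) \<in> C" "partner p q V (k (rg d)) \<notin> C"
        using A.X_clopen_separated s(1) ne unfolding clopen_separated_def A.topspace_X by metis
      then show False
        using in_C by blast
    qed
    then show ?thesis
      using U s(2) by simp
  qed
  have gGL: "g \<in> GL L1" and gU: "rg g \<in> U" "sc g = partner p q V (rg g)"
    using g A.Zset_bis_subset[OF b] unfolding Zset_bis_iff[OF b] by (auto simp: Zset_bis_iff[OF b])
  \<comment> \<open>Taking the whole unit space for C yields an element of the support over
    \<open>h (rg g)\<close>.\<close>
  have "\<exists>d\<in>GL L2. rg d = h (rg g) \<and> sc d \<in> h ` XL L1 \<and> jfun w d \<noteq> 0"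
    using key[OF top1 GL_rg[OF gGL]] gU(1) partner_in[OF b gU(1)] UX(2) by blast
  then obtain d where d: "d \<in> GL L2" "rg d = h (rg g)" "jfun w d \<noteq> 0" by blast
  have kr: "k (h (rg g')) = rg g'" if "g' \<in> GL L1" for g'
    by (rule k_h[OF GL_rg[OF that]])
  have "germ_conj L1 L2 h g d"
    unfolding germ_conj_def
  proof (intro conjI exI ballI impI)
    show "g \<in> GL L1" "d \<in> GL L2" "rg d = h (rg g)" by fact+
    show "sc d = h (sc g)"
      using supp[OF d(1,3)] d(2) kr[OF gGL] gU(2) by simp
    show "openin (G_top L1) (Zset U p q V)"
      by (rule A.openin_Zset_bis[OF b])
    show "openin (G_top L2) {e \<in> GL L2. jfun w e \<noteq> 0}"
      by (rule B.open_jfun_support[OF w])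
    show "g \<in> Zset U p q V" by fact
    show "d \<in> {e \<in> GL L2. jfun w e \<noteq> 0}"
      using d by simp
    fix g' d' assume g': "g' \<in> Zset U p q V" and d': "d' \<in> {e \<in> GL L2. jfun w e \<noteq> 0}" and r: "rg d' = h (rg g')"
    have "g' \<in> GL L1"
      using subsetD[OF A.Zset_bis_subset[OF b] g'] .
    then show "sc d' = h (sc g')"
      using supp[of d'] d' r kr[of g'] g' by (simp add: Zset_bis_iff[OF b])
  qed
  then show ?thesis
    using d unfolding w_def by blast
qed

section \<open>Gauge actions and cocycles\<close>

lemma (in lgsys) gen_gauge_bop:
  assumes f: "cont_hom L f" and b: "bis L U p q V" and n: "\<And>g. g \<in> Zset U p q V \<Longrightarrow> f g = n"
  shows "gen_gauge L f t (bop L U p q V) = op_scale (cis (2 * pi * t * of_int n)) (bop L U p q V)"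
proof (intro ext)
  fix \<xi> g
  show "gen_gauge L f t (bop L U p q V) \<xi> g = op_scale (cis (2 * pi * t * of_int n)) (bop L U p q V) \<xi> g"
  proof (cases "\<xi> \<in> ell2 L")
    case True
    let ?\<xi> = "\<lambda>g'. cis (- (2 * pi * t * of_int (f g'))) * \<xi> g'"
    have "sq_summable ?\<xi>"
      by (rule sq_summable_mult_bounded(1)[OF ell2_sq[OF True], of 1]) (simp_all add: norm_mult)
    then have e: "?\<xi> \<in> ell2 L"
      using ell2_outside[OF True] by (simp add: ell2_iff del: split_paired_All)
    \<comment> \<open>As f is a homomorphism and g is the product of a bisection element with
      \<open>gtrans p q V g\<close>, the two values of f differ by the constant n.\<close>
    have "cis (2 * pi * t * of_int (f g)) * cis (- (2 * pi * t * of_int (f (gtrans p q V g)))) = cis (2 * pi * t * of_int n)"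
      if g: "g \<in> GL L" "rg g \<in> U"
    proof -
      let ?b = "(rg g, int p - int q, partner p q V (rg g))"
      have bZ: "?b \<in> Zset U p q V"
        by (rule bis_section_in[OF b g(2)])
      then have bG: "?b \<in> GL L"
        using Zset_bis_subset[OF b] by blast
      have "gcomp ?b (gtrans p q V g)" "gmult ?b (gtrans p q V g) = g"
        by (simp_all add: gcomp_def gtrans_def gmult_def prod_eq_iff)
      then have "f g = f ?b + f (gtrans p q V g)"
        using f bG GL_gtrans[OF b g] unfolding cont_hom_def by metis
      then show ?thesis
        using n[OF bZ] by (simp add: cis_mult algebra_simps)
    qed
    then show ?thesis
      using True by (simp add: gen_gauge_def op_scale_def bop_apply[OF b e] bop_apply[OF b True] mult.assoc[symmetric])
  next
    case False
    then show ?thesis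
      by (simp add: gen_gauge_def op_scale_def bop_def lam_outside)
  qed
qed

lemma cis_eq_imp_eq:
  fixes m n :: int
  assumes "\<And>t::real. cis (2 * pi * t * of_int m) = cis (2 * pi * t * of_int n)"
  shows "m = n"
proof (rule ccontr)
  assume "m \<noteq> n"
  then have ne: "real_of_int m - real_of_int n \<noteq> 0" by simp
  \<comment> \<open>Chosen so that the two angles differ by \<pi>, which gives opposite
    values.\<close>
  define t where "t = 1 / (2 * (real_of_int m - real_of_int n))"
  have "2 * pi * t * of_int m = 2 * pi * t * of_int n + pi"
    using ne by (simp add: t_def field_simps)
  then have "cis (2 * pi * t * of_int m) = - cis (2 * pi * t * of_int n)"
    by (simp add: cis_mult[symmetric])
  then show False
    using assms[of t] cis_neq_zero[of "2 * pi * t * of_int n"] by simp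
qed

text \<open>At the unit of the source f vanishes, so the inner phase disappears and the action
  multiplies \<open>jfun w d\<close> by the phase of \<open>f d\<close>. Comparing with the
  eigenvalue for all t at a nonzero coefficient gives equality of the integers.\<close>

lemma (in lgsys) gen_gauge_jfun:
  assumes f: "cont_hom L f" and d: "d \<in> GL L" "jfun w d \<noteq> 0"
    and eq: "\<And>t. gen_gauge L f t w = op_scale (cis (2 * pi * t * of_int n)) w"
  shows "f d = n"
proof (rule cis_eq_imp_eq)
  fix t
  let ?u = "gunit (sc d)"
  have u: "?u \<in> GL L"
    using GL_sc[OF d(1)] by simp
  have "gcomp ?u ?u" "gmult ?u ?u = ?u"
    by (simp_all add: gcomp_def gmult_def gunit_def)
  then have fu: "f ?u = 0"
    using f u unfolding cont_hom_def by fastforce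
  have "(\<lambda>g'. cis (- (2 * pi * t * of_int (f g'))) * delta ?u g') = delta ?u"
    using fu by (auto simp: delta_def)
  then have "gen_gauge L f t w (delta ?u) d = cis (2 * pi * t * of_int (f d)) * jfun w d"
    using u by (simp add: gen_gauge_def jfun_def)
  then show "cis (2 * pi * t * of_int (f d)) = cis (2 * pi * t * of_int n)"
    using d(2) by (simp add: eq op_scale_def jfun_def)
qed

lemma star_iso_imp_groupoid_iso:
  assumes L1: "lgsys L1" and L2: "lgsys L2" and ef: "essentially_free L1" "essentially_free L2"
    and f: "cont_hom L1 f1" "cont_hom L2 f2"
    and iso: "star_iso L1 L2 \<Phi>" "\<Phi> ` DL L1 = DL L2"
    and gauge: "\<forall>t::real. \<forall>T\<in>OL L1. \<Phi> (gen_gauge L1 f1 t T) = gen_gauge L2 f2 t (\<Phi> T)"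
  shows "\<exists>\<phi>. groupoid_iso L1 L2 \<phi> \<and> (\<forall>g\<in>GL L1. f1 g = f2 (\<phi> g))"
proof -
  have alg: "alg_iso L1 L2 \<Phi>"
    using iso unfolding alg_iso_def star_iso_def by (elim conjE, intro conjI) auto
  have scale: "\<Phi> (op_scale c T) = op_scale c (\<Phi> T)" if "T \<in> OL L1" for c T
    using iso(1) that unfolding star_iso_def by (elim conjE) auto
  obtain h k where hk: "homeomorphic_maps (X_top L1) (X_top L2) h k"
    and pr: "\<And>C. clopenin (X_top L1) C \<Longrightarrow> \<Phi> (pr L1 C) = pr L2 (h ` C)"
    using alg_iso_homeomorphism[OF L1 L2 alg] by blast
  interpret A: lgsys L1 by fact
  interpret B: lgsys L2 by fact
  interpret germs L1 L2 h k
    by unfold_locales (use hk ef in auto)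
  let ?\<Psi> = "inv_into (OL L1) \<Phi>"
  have alg': "alg_iso L2 L1 ?\<Psi>"
    by (rule alg_iso_inv[OF L1 alg])
  have bij: "bij_betw \<Phi> (OL L1) (OL L2)"
    using alg unfolding alg_iso_def by blast
  \<comment> \<open>The inverse isomorphism carries projections along k, as the germ argument in the
    other direction requires.\<close>
  have pr': "?\<Psi> (pr L2 D) = pr L1 (k ` D)" if D: "clopenin (X_top L2) D" for D
  proof -
    have sub: "D \<subseteq> XL L2"
      using clopenin_subset[OF D] by simp
    have "k ` D = {x \<in> topspace (X_top L1). h x \<in> D}"
      using sub h_k k_h k_XL by (force simp: image_iff)
    then have kD: "clopenin (X_top L1) (k ` D)"
      using clopenin_preimage[OF cont_h D] by simp
    have "h ` k ` D = D"
      using sub h_k by (force simp: image_image)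
    then have "\<Phi> (pr L1 (k ` D)) = pr L2 D"
      using pr[OF kD] by simp
    then show ?thesis
      using bij_betw_inv_into_left[OF bij A.pr_OL[OF kD]] by simp
  qed
  have ex: "\<exists>d. germ_conj L1 L2 h g d \<and> f1 g = f2 d" if g: "g \<in> GL L1" for g
  proof -
    \<comment> \<open>Being continuous and integer valued, f1 is locally constant; the bisection
      around g is taken inside a level set.\<close>
    have "openin (G_top L1) {g' \<in> topspace (G_top L1). f1 g' \<in> {f1 g}}"
      using f(1) unfolding cont_hom_def by (intro openin_continuous_map_preimage) auto
    moreover have "g \<in> {g' \<in> topspace (G_top L1). f1 g' \<in> {f1 g}}"
      using g by simp
    ultimately obtain U p q V where b: "bis L1 U p q V" "g \<in> Zset U p q V"
        "Zset U p q V \<subseteq> {g' \<in> topspace (G_top L1). f1 g' \<in> {f1 g}}"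
      by (rule A.openin_G_bis)
    obtain d where d: "d \<in> GL L2" "germ_conj L1 L2 h g d" "jfun (\<Phi> (bop L1 U p q V)) d \<noteq> 0"
      using alg_iso_germ[OF alg pr b(1,2)] by blast
    \<comment> \<open>The bisection operator is an eigenvector of the gauge automorphisms with
      eigenvalue given by \<open>f1 g\<close>; equivariance and homogeneity of \<Phi> pass this to
      its image.\<close>
    have "gen_gauge L2 f2 t (\<Phi> (bop L1 U p q V)) = op_scale (cis (2 * pi * t * of_int (f1 g))) (\<Phi> (bop L1 U p q V))" for t
    proof -
      have "f1 g' = f1 g" if "g' \<in> Zset U p q V" for g'
        using subsetD[OF b(3) that] by simp
      from A.gen_gauge_bop[OF f(1) b(1) this, of t] gauge A.bop_OL[OF b(1)] scale[OF A.bop_OL[OF b(1)]]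
      show ?thesis by metis
    qed
    from B.gen_gauge_jfun[OF f(2) d(1,3) this] show ?thesis
      using d(2) by (intro exI[of _ d] conjI) simp_all
  qed
  have ex': "\<exists>g. germ_conj L2 L1 k d g" if d: "d \<in> GL L2" for d
  proof -
    have "d \<in> topspace (G_top L2)"
      using d by simp
    from B.openin_G_bis[OF openin_topspace this] obtain U p q V where b: "bis L2 U p q V" "d \<in> Zset U p q V" .
    then show ?thesis
      using germs.alg_iso_germ[OF sym alg' pr'] by blast
  qed
  obtain \<phi> where \<phi>: "groupoid_iso L1 L2 \<phi>" "\<And>g. g \<in> GL L1 \<Longrightarrow> germ_conj L1 L2 h g (\<phi> g)"
    using groupoid_iso_of_germs[OF _ ex'] ex by blast
  \<comment> \<open>The element d found in \<open>ex\<close> is \<open>\<phi> g\<close> by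
    uniqueness of the conjugate germ.\<close>
  have "f1 g = f2 (\<phi> g)" if "g \<in> GL L1" for g
    using ex[OF that] germ_conj_unique[OF \<phi>(2)[OF that]] by auto
  with \<phi>(1) show ?thesis by blast
qed

theorem theorem3p3:
  fixes L1 :: "('v1, 'e1, 'a1) lgs" and L2 :: "('v2, 'e2, 'a2) lgs"
    and f1 :: "('v1, 'a1) gel \<Rightarrow> int" and f2 :: "('v2, 'a2) gel \<Rightarrow> int"
  assumes "is_lgs L1" "is_lgs L2"
    and "left_resolving L1" "left_resolving L2"
    and "essentially_free L1" "essentially_free L2"
    and "cont_hom L1 f1" "cont_hom L2 f2"
  shows "(\<exists>\<phi>. groupoid_iso L1 L2 \<phi> \<and> (\<forall>g\<in>GL L1. f1 g = f2 (\<phi> g)))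
     \<longleftrightarrow> (\<exists>\<Phi>. star_iso L1 L2 \<Phi> \<and> \<Phi> ` DL L1 = DL L2 \<and>
            (\<forall>t::real. \<forall>T\<in>OL L1. \<Phi> (gen_gauge L1 f1 t T) = gen_gauge L2 f2 t (\<Phi> T)))"
proof -
  have L: "lgsys L1" "lgsys L2"
    using assms(1-4) by (simp_all add: lgsys_def)
  show ?thesis
  proof
    assume "\<exists>\<phi>. groupoid_iso L1 L2 \<phi> \<and> (\<forall>g\<in>GL L1. f1 g = f2 (\<phi> g))"
    then obtain \<phi> where "groupoid_iso L1 L2 \<phi>" "\<And>g. g \<in> GL L1 \<Longrightarrow> f1 g = f2 (\<phi> g)"
      by blast
    then show "\<exists>\<Phi>. star_iso L1 L2 \<Phi> \<and> \<Phi> ` DL L1 = DL L2 \<and>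
            (\<forall>t::real. \<forall>T\<in>OL L1. \<Phi> (gen_gauge L1 f1 t T) = gen_gauge L2 f2 t (\<Phi> T))"
      by (rule groupoid_iso_imp_star_iso[OF L])
  next
    assume "\<exists>\<Phi>. star_iso L1 L2 \<Phi> \<and> \<Phi> ` DL L1 = DL L2 \<and>
            (\<forall>t::real. \<forall>T\<in>OL L1. \<Phi> (gen_gauge L1 f1 t T) = gen_gauge L2 f2 t (\<Phi> T))"
    then show "\<exists>\<phi>. groupoid_iso L1 L2 \<phi> \<and> (\<forall>g\<in>GL L1. f1 g = f2 (\<phi> g))"
      by (elim exE conjE) (rule star_iso_imp_groupoid_iso[OF L assms(5-8)])
  qed
qed

end
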